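(* Let $(\hat X,B)$ and $(X,W)$ be unique weak solutions, possibly on two different probability spaces $(\Omega,\mathcal F,\mathbb P)$ and $(\widetilde\Omega,\widetilde{\mathcal F},\widetilde{\mathbb P})$, of $$\hat X_t=x+\int_0^t\hat\sigma(u,\hat X_u)\,dB_u+\int_0^t\hat\mu(u,\hat X_u)\,du,\qquad X_t=\lambda+\int_0^t\sigma(u,X_u)\,dW_u+\int_0^t\mu(u,X_u)\,du,$$ where $x\ge 0$, $\lambda\ge 0$ and $B,W$ are standard Brownian motions. Assume that $\hat X$ and $X$ are nonnegative and that for all $t\ge0$ $$\mathbb E\int_0^t\hat\sigma^2(u,\hat X_u)\,du<\infty,\qquad \mathbb E\int_0^t|\hat\mu(u,\hat X_u)|\,du<\infty .$$ Let $g:[0,\infty)\times[0,\infty)\to\mathbb R$ and $V:[0,\infty)\times[0,\infty)\to[0,\infty)$ be continuous, and let $h(\lambda)=e^{-x\lambda}$ for $\lambda\ge0$. Assume that, for these functions $V,g,h$, the pair $(\sigma,\mu)$ is in the $\mathcal{FK}$-class, and that for all $t\ge0$ and $\lambda\ge0$ $$\mathbb E\,e^{-\lambda\hat X_t}\Big[\tfrac{\lambda^2}{2}\hat\sigma^2(t,\hat X_t)-\lambda\hat\mu(t,\hat X_t)\Big]=\mathbb E\,e^{-\lambda\hat X_t}\Big[\hat X_t^2\,\tfrac{\sigma^2(t,\lambda)}{2}-\hat X_t\,\mu(t,\lambda)-V(t,\lambda)\Big]+g(t,\lambda).$$ Then for all $t\ge0$ and $\lambda\ge0$ (with $X_0=\lambda$)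 $$\mathbb E e^{-\lambda\hat X_t}=\widetilde{\mathbb E}\,e^{-xX_t-\int_0^tV(t-u,X_u)du}+\widetilde{\mathbb E}\int_0^t g(t-s,X_s)\,e^{-\int_0^sV(t-u,X_u)du}\,ds,$$ where $\widetilde{\mathbb E}$ denotes expectation under $\widetilde{\mathbb P}$.
   Context: All filtrations satisfy the usual conditions. $\mathcal{FK}$-class: let $I=[0,\infty)$ and $\sigma,\mu:[0,\infty)\times I\to\mathbb R$. For given functions $V,g:[0,\infty)\times I\to\mathbb R$ and $h:I\to\mathbb R$, the pair $(\sigma,\mu)$ is in the $\mathcal{FK}$-class if (a) for every $\lambda\in I$ the SDE $dX_u=\sigma(u,X_u)dW_u+\mu(u,X_u)du$, $X_0=\lambda$, has a weak solution, unique in law; and (b) with $A_t=\frac12\sigma^2(t,\cdot)\frac{\partial^2}{\partial\lambda^2}+\mu(t,\cdot)\frac{\partial}{\partial\lambda}$, the Cauchy problem $$\frac{\partial f}{\partial t}=A_tf-Vf+g,\qquad f(0,\lambda)=h(\lambda),$$ has a unique classical solution $f$ (continuous on $[0,\infty)\times I$ and $\mathcal C^{1,2}$ in the interior), and it is given by $$f(t,\lambda)=\mathbb E\,h(X_t)e^{-\int_0^tV(t-u,X_u)du}+\mathbb E\int_0^tg(t-s,X_s)e^{-\int_0^sV(t-u,X_u)du}ds,\qquad X_0=\lambda .$$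
   Formalization: It is additionally assumed that σ and μ are continuous on (0,∞)×(0,∞); without such regularity the claim is false, since E e^{-λX̂_t} need not be differentiable in t and so need not be a classical solution. *)

theory Defs
  imports "HOL-Probability.Probability"
begin

text \<open>
  Processes are functions \<open>X :: real \<Rightarrow> 'a \<Rightarrow> real\<close> of time and sample point; only times
  \<open>t \<ge> 0\<close> matter.  The state space of all equations is \<open>[0,\<infinity>)\<close>, so coefficients are only ever
  evaluated on \<open>[0,\<infinity>) \<times> [0,\<infinity>)\<close>.
\<close>

definition usual_filtration :: "'a measure \<Rightarrow> (real \<Rightarrow> 'a measure) \<Rightarrow> bool" where
  "usual_filtration M F \<longleftrightarrow>
     complete_measure M \<and>
     (\<forall>t\<ge>0. subalgebra M (F t)) \<and>
     (\<forall>s t. 0 \<le> s \<longrightarrow> s \<le> t \<longrightarrow> sets (F s) \<subseteq> sets (F t)) \<and>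
     null_sets M \<subseteq> sets (F 0) \<and>
     (\<forall>t\<ge>0. (\<Inter>s\<in>{t<..}. sets (F s)) \<subseteq> sets (F t))"

definition adapted :: "(real \<Rightarrow> 'a measure) \<Rightarrow> (real \<Rightarrow> 'a \<Rightarrow> real) \<Rightarrow> bool" where
  "adapted F X \<longleftrightarrow> (\<forall>t\<ge>0. X t \<in> borel_measurable (F t))"

definition progressive :: "(real \<Rightarrow> 'a measure) \<Rightarrow> (real \<Rightarrow> 'a \<Rightarrow> real) \<Rightarrow> bool" where
  "progressive F H \<longleftrightarrow>
     (\<forall>t\<ge>0. (\<lambda>(s, \<omega>). H s \<omega>) \<in> borel_measurable (restrict_space borel {0..t} \<Otimes>\<^sub>M F t))"

definition continuous_paths :: "'a measure \<Rightarrow> (real \<Rightarrow> 'a \<Rightarrow> real) \<Rightarrow> bool" where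
  "continuous_paths M X \<longleftrightarrow> (\<forall>\<omega>\<in>space M. continuous_on {0..} (\<lambda>t. X t \<omega>))"

definition brownian_motion ::
    "'a measure \<Rightarrow> (real \<Rightarrow> 'a measure) \<Rightarrow> (real \<Rightarrow> 'a \<Rightarrow> real) \<Rightarrow> bool" where
  "brownian_motion M F W \<longleftrightarrow>
     adapted F W \<and> continuous_paths M W \<and> (AE \<omega> in M. W 0 \<omega> = 0) \<and>
     (\<forall>s t. 0 \<le> s \<longrightarrow> s < t \<longrightarrow>
        distributed M lborel (\<lambda>\<omega>. W t \<omega> - W s \<omega>) (normal_density 0 (sqrt (t - s))) \<and>
        prob_space.indep_set M (sets (F s))
          (sets (vimage_algebra (space M) (\<lambda>\<omega>. W t \<omega> - W s \<omega>) borel)))"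

definition tendsto_zero_in_prob :: "'a measure \<Rightarrow> (nat \<Rightarrow> 'a \<Rightarrow> real) \<Rightarrow> bool" where
  "tendsto_zero_in_prob M Y \<longleftrightarrow>
     (\<forall>k. Y k \<in> borel_measurable M) \<and>
     (\<forall>\<epsilon>>0. (\<lambda>k. measure M {\<omega>\<in>space M. \<epsilon> < \<bar>Y k \<omega>\<bar>}) \<longlonglongrightarrow> 0)"

text \<open>
  The triple \<open>(n, \<tau>, \<xi>)\<close> encodes the bounded elementary integrand
  \<open>\<Sum>i<n. \<xi>\<^sub>i 1\<^bsub>(\<tau>\<^sub>i, \<tau>\<^sub>i\<^sub>+\<^sub>1]\<^esub>\<close> with deterministic times and \<open>\<xi>\<^sub>i\<close> measurable at time \<open>\<tau>\<^sub>i\<close>.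
\<close>

definition elementary ::
    "'a measure \<Rightarrow> (real \<Rightarrow> 'a measure) \<Rightarrow> nat \<Rightarrow> (nat \<Rightarrow> real) \<Rightarrow> (nat \<Rightarrow> 'a \<Rightarrow> real) \<Rightarrow> bool" where
  "elementary M F n \<tau> \<xi> \<longleftrightarrow>
     0 \<le> \<tau> 0 \<and>
     (\<forall>i<n. \<tau> i \<le> \<tau> (Suc i) \<and> \<xi> i \<in> borel_measurable (F (\<tau> i)) \<and>
            (\<exists>C. \<forall>\<omega>\<in>space M. \<bar>\<xi> i \<omega>\<bar> \<le> C))"

definition elementary_value ::
    "nat \<Rightarrow> (nat \<Rightarrow> real) \<Rightarrow> (nat \<Rightarrow> 'a \<Rightarrow> real) \<Rightarrow> real \<Rightarrow> 'a \<Rightarrow> real" where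
  "elementary_value n \<tau> \<xi> s \<omega> = (\<Sum>i<n. \<xi> i \<omega> * indicator {\<tau> i<..\<tau> (Suc i)} s)"

definition elementary_integral ::
    "nat \<Rightarrow> (nat \<Rightarrow> real) \<Rightarrow> (nat \<Rightarrow> 'a \<Rightarrow> real) \<Rightarrow> (real \<Rightarrow> 'a \<Rightarrow> real) \<Rightarrow> real \<Rightarrow> 'a \<Rightarrow> real" where
  "elementary_integral n \<tau> \<xi> W t \<omega> =
     (\<Sum>i<n. \<xi> i \<omega> * (W (min t (\<tau> (Suc i))) \<omega> - W (min t (\<tau> i)) \<omega>))"

text \<open>
  \<open>ito_integral M F W H J\<close>: the process \<open>J\<close> is (a continuous version of) the Ito integral
  \<open>J\<^sub>t = \<integral>\<^sub>0\<^sup>t H\<^sub>s dW\<^sub>s\<close> of a progressive \<open>H\<close> with \<open>\<integral>\<^sub>0\<^sup>t H\<^sub>s\<^sup>2 ds < \<infinity>\<close> almost surely.  As usual it is the limit,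
  uniformly on compacts in probability, of the integrals of elementary integrands that converge
  to \<open>H\<close> in \<open>L\<^sup>2([0,T])\<close> in probability.  This determines \<open>J\<close> up to indistinguishability.
\<close>

definition ito_integral ::
    "'a measure \<Rightarrow> (real \<Rightarrow> 'a measure) \<Rightarrow> (real \<Rightarrow> 'a \<Rightarrow> real) \<Rightarrow> (real \<Rightarrow> 'a \<Rightarrow> real) \<Rightarrow>
     (real \<Rightarrow> 'a \<Rightarrow> real) \<Rightarrow> bool" where
  "ito_integral M F W H J \<longleftrightarrow>
     progressive F H \<and>
     (AE \<omega> in M. \<forall>t\<ge>0. set_integrable lborel {0..t} (\<lambda>s. (H s \<omega>)\<^sup>2)) \<and>
     adapted F J \<and> continuous_paths M J \<and>
     (\<exists>n \<tau> \<xi>. (\<forall>k. elementary M F (n k) (\<tau> k) (\<xi> k)) \<and>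
       (\<forall>T\<ge>0.
         tendsto_zero_in_prob M
           (\<lambda>k \<omega>. LINT s:{0..T}|lborel. (elementary_value (n k) (\<tau> k) (\<xi> k) s \<omega> - H s \<omega>)\<^sup>2) \<and>
         tendsto_zero_in_prob M
           (\<lambda>k \<omega>. SUP t\<in>{0..T}. \<bar>elementary_integral (n k) (\<tau> k) (\<xi> k) W t \<omega> - J t \<omega>\<bar>)))"

definition borel_coeff :: "(real \<Rightarrow> real \<Rightarrow> real) \<Rightarrow> bool" where
  "borel_coeff b \<longleftrightarrow> (\<lambda>(t, y). b t y) \<in> borel_measurable (restrict_space borel ({0..} \<times> {0..}))"

text \<open>
  \<open>weak_solution M F W X \<sigma> \<mu> x\<close>: on \<open>(M, F)\<close> the pair \<open>(X, W)\<close> is a weak solution with values in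
  \<open>[0,\<infinity>)\<close> of \<open>X\<^sub>t = x + \<integral>\<^sub>0\<^sup>t \<sigma>(u,X\<^sub>u) dW\<^sub>u + \<integral>\<^sub>0\<^sup>t \<mu>(u,X\<^sub>u) du\<close>.
\<close>

definition weak_solution ::
    "'a measure \<Rightarrow> (real \<Rightarrow> 'a measure) \<Rightarrow> (real \<Rightarrow> 'a \<Rightarrow> real) \<Rightarrow> (real \<Rightarrow> 'a \<Rightarrow> real) \<Rightarrow>
     (real \<Rightarrow> real \<Rightarrow> real) \<Rightarrow> (real \<Rightarrow> real \<Rightarrow> real) \<Rightarrow> real \<Rightarrow> bool" where
  "weak_solution M F W X \<sigma> \<mu> x \<longleftrightarrow>
     prob_space M \<and> usual_filtration M F \<and> brownian_motion M F W \<and>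
     borel_coeff \<sigma> \<and> borel_coeff \<mu> \<and>
     adapted F X \<and> continuous_paths M X \<and> (\<forall>t\<ge>0. \<forall>\<omega>\<in>space M. 0 \<le> X t \<omega>) \<and>
     (AE \<omega> in M. \<forall>t\<ge>0. set_integrable lborel {0..t} (\<lambda>u. \<mu> u (X u \<omega>))) \<and>
     (\<exists>J. ito_integral M F W (\<lambda>u \<omega>. \<sigma> u (X u \<omega>)) J \<and>
          (AE \<omega> in M. \<forall>t\<ge>0. X t \<omega> = x + J t \<omega> + (LINT u:{0..t}|lborel. \<mu> u (X u \<omega>))))"

definition path_law :: "'a measure \<Rightarrow> (real \<Rightarrow> 'a \<Rightarrow> real) \<Rightarrow> (real \<Rightarrow> real) measure" where
  "path_law M X = distr M (PiM {0..} (\<lambda>_. borel)) (\<lambda>\<omega>. \<lambda>t\<in>{0..}. X t \<omega>)"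

text \<open>
  HOL cannot quantify over sample spaces of all types inside a formula, so the notions below are
  relative to the probability spaces whose sample points have the type given as first argument
  (any measure, filtration and Brownian motion on that type is allowed).
\<close>

definition unique_in_law ::
    "'a itself \<Rightarrow> (real \<Rightarrow> real \<Rightarrow> real) \<Rightarrow> (real \<Rightarrow> real \<Rightarrow> real) \<Rightarrow> real \<Rightarrow> bool" where
  "unique_in_law TYPE('a) \<sigma> \<mu> x \<longleftrightarrow>
     (\<forall>(M :: 'a measure) F W X (M' :: 'a measure) F' W' X'.
        weak_solution M F W X \<sigma> \<mu> x \<longrightarrow> weak_solution M' F' W' X' \<sigma> \<mu> x \<longrightarrow>
        path_law M X = path_law M' X')"

definition classical_solution ::
    "(real \<Rightarrow> real \<Rightarrow> real) \<Rightarrow> (real \<Rightarrow> real \<Rightarrow> real) \<Rightarrow> (real \<Rightarrow> real \<Rightarrow> real) \<Rightarrow>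
     (real \<Rightarrow> real \<Rightarrow> real) \<Rightarrow> (real \<Rightarrow> real) \<Rightarrow> (real \<Rightarrow> real \<Rightarrow> real) \<Rightarrow> bool" where
  "classical_solution \<sigma> \<mu> V g h f \<longleftrightarrow>
     continuous_on ({0..} \<times> {0..}) (\<lambda>(t, l). f t l) \<and>
     (\<forall>l\<ge>0. f 0 l = h l) \<and>
     (\<exists>f\<^sub>t f\<^sub>l f\<^sub>l\<^sub>l.
        continuous_on ({0<..} \<times> {0<..}) (\<lambda>(t, l). f\<^sub>t t l) \<and>
        continuous_on ({0<..} \<times> {0<..}) (\<lambda>(t, l). f\<^sub>l t l) \<and>
        continuous_on ({0<..} \<times> {0<..}) (\<lambda>(t, l). f\<^sub>l\<^sub>l t l) \<and>
        (\<forall>t>0. \<forall>l>0.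
           ((\<lambda>s. f s l) has_real_derivative f\<^sub>t t l) (at t) \<and>
           ((\<lambda>y. f t y) has_real_derivative f\<^sub>l t l) (at l) \<and>
           ((\<lambda>y. f\<^sub>l t y) has_real_derivative f\<^sub>l\<^sub>l t l) (at l) \<and>
           f\<^sub>t t l = (1/2 * (\<sigma> t l)\<^sup>2 * f\<^sub>l\<^sub>l t l + \<mu> t l * f\<^sub>l t l) - V t l * f t l + g t l))"

text \<open>
  \<open>feynman_kac M X V g h t r\<close>: both expectations in the Feynman-Kac formula exist and their sum is \<open>r\<close>.
\<close>

definition feynman_kac ::
    "'a measure \<Rightarrow> (real \<Rightarrow> 'a \<Rightarrow> real) \<Rightarrow> (real \<Rightarrow> real \<Rightarrow> real) \<Rightarrow> (real \<Rightarrow> real \<Rightarrow> real) \<Rightarrow>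
     (real \<Rightarrow> real) \<Rightarrow> real \<Rightarrow> real \<Rightarrow> bool" where
  "feynman_kac M X V g h t r \<longleftrightarrow>
     (let D = (\<lambda>s \<omega>. exp (- (LINT u:{0..s}|lborel. V (t - u) (X u \<omega>)))) in
       (AE \<omega> in M. set_integrable lborel {0..t} (\<lambda>u. V (t - u) (X u \<omega>)) \<and>
                   set_integrable lborel {0..t} (\<lambda>s. g (t - s) (X s \<omega>) * D s \<omega>)) \<and>
       integrable M (\<lambda>\<omega>. h (X t \<omega>) * D t \<omega>) \<and>
       integrable M (\<lambda>\<omega>. LINT s:{0..t}|lborel. g (t - s) (X s \<omega>) * D s \<omega>) \<and>
       r = (LINT \<omega>|M. h (X t \<omega>) * D t \<omega>) +
           (LINT \<omega>|M. (LINT s:{0..t}|lborel. g (t - s) (X s \<omega>) * D s \<omega>)))"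

definition FK_class ::
    "'a itself \<Rightarrow> (real \<Rightarrow> real \<Rightarrow> real) \<Rightarrow> (real \<Rightarrow> real \<Rightarrow> real) \<Rightarrow> (real \<Rightarrow> real \<Rightarrow> real) \<Rightarrow>
     (real \<Rightarrow> real \<Rightarrow> real) \<Rightarrow> (real \<Rightarrow> real) \<Rightarrow> bool" where
  "FK_class TYPE('a) \<sigma> \<mu> V g h \<longleftrightarrow>
     (\<forall>l\<ge>0. (\<exists>(M :: 'a measure) F W X. weak_solution M F W X \<sigma> \<mu> l) \<and>
             unique_in_law TYPE('a) \<sigma> \<mu> l) \<and>
     (\<exists>f. classical_solution \<sigma> \<mu> V g h f \<and>
          (\<forall>f'. classical_solution \<sigma> \<mu> V g h f' \<longrightarrow> (\<forall>t\<ge>0. \<forall>l\<ge>0. f' t l = f t l)) \<and>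
          (\<forall>l\<ge>0. \<forall>(M :: 'a measure) F W X. weak_solution M F W X \<sigma> \<mu> l \<longrightarrow>
             (\<forall>t\<ge>0. feynman_kac M X V g h t (f t l))))"

end

theory Submission
  imports Defs
begin

text \<open>
  By uniqueness in the Feynman-Kac class it suffices that \<open>f t l = E exp (- l Xh\<^sub>t)\<close> is a classical
  solution of the Cauchy problem.  Ito's formula in expectation expresses \<open>f\<close> as the time integral of
  the left-hand side of the duality relation, and the right-hand side is the spatial operator applied
  to \<open>f\<close>, because \<open>- E Xh\<^sub>t exp (- l Xh\<^sub>t)\<close> and \<open>E Xh\<^sub>t\<^sup>2 exp (- l Xh\<^sub>t)\<close> are the first two derivatives in \<open>l\<close>;
  continuity of these expressions upgrades the integral equation to a differential equation.

  Ito's formula is only needed in expectation, for a bounded test function.  For an elementary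
  integrand it follows from a second-order Taylor expansion along refining partitions and the
  independence of Brownian increments.  The general case is a limit of elementary integrands whose
  energy is truncated at a level \<open>N\<close>, where first the approximation is refined and then \<open>N\<close> tends to
  infinity.
\<close>

section \<open>Test functions\<close>

text \<open>The definition \<open>ito_integral\<close> gives convergence in probability only, while
  the formula is wanted in expectation: on the exceptional events the generator of an approximant
  involves its energy, for which no integrable bound is at hand. Capping the energy makes those
  events cost at most a constant times \<open>N\<close> times their probability. The approximants
  keep the drift process of the solution unchanged, so where the cap is inactive they differ from it
  only by the error of the stochastic integral, which is small uniformly on \<open>[0,T]\<close>.
  The derivatives are studied at \<open>l > 0\<close> only. There
  \<open>y ^ k * exp (- (l * y))\<close> is bounded on the half-line, so the derivatives in
  \<open>l\<close> exist although no moments of \<open>Xh\<close> are assumed. The boundary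
  \<open>l = 0\<close> enters only through continuity of the transform and its initial value, since
  \<open>classical_solution\<close> asks for derivatives only in the open quadrant.\<close>

locale test_function =
  fixes \<phi> \<phi>1 \<phi>2 :: "real \<Rightarrow> real" and C :: real
  assumes deriv_phi: "\<And>y. (\<phi> has_real_derivative \<phi>1 y) (at y)"
    and deriv_phi1: "\<And>y. (\<phi>1 has_real_derivative \<phi>2 y) (at y)"
    and bound_phi: "\<And>y. \<bar>\<phi> y\<bar> \<le> C"
    and bound_phi1: "\<And>y. \<bar>\<phi>1 y\<bar> \<le> C"
    and bound_phi2: "\<And>y. \<bar>\<phi>2 y\<bar> \<le> C"
    and lipschitz_phi2: "\<And>y z. \<bar>\<phi>2 y - \<phi>2 z\<bar> \<le> C * \<bar>y - z\<bar>"
begin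

lemma C_nonneg: "0 \<le> C"
  using bound_phi[of 0] by linarith

lemma lipschitz_phi: "\<bar>\<phi> y - \<phi> z\<bar> \<le> C * \<bar>y - z\<bar>"
  using field_differentiable_bound[of UNIV \<phi> \<phi>1 C y z] deriv_phi bound_phi1 by auto

lemma lipschitz_phi1: "\<bar>\<phi>1 y - \<phi>1 z\<bar> \<le> C * \<bar>y - z\<bar>"
  using field_differentiable_bound[of UNIV \<phi>1 \<phi>2 C y z] deriv_phi1 bound_phi2 by auto

lemma continuous_phi: "continuous_on UNIV \<phi>" "continuous_on UNIV \<phi>1" "continuous_on UNIV \<phi>2"
proof -
  show "continuous_on UNIV \<phi>" "continuous_on UNIV \<phi>1"
    using deriv_phi deriv_phi1 by (auto intro!: continuous_at_imp_continuous_on DERIV_isCont)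
  have "C-lipschitz_on UNIV \<phi>2"
    using lipschitz_phi2 C_nonneg by (auto simp: lipschitz_on_def dist_real_def)
  then show "continuous_on UNIV \<phi>2"
    by (rule lipschitz_on_continuous_on)
qed

lemma measurable_phi [measurable]:
  "\<phi> \<in> borel_measurable borel" "\<phi>1 \<in> borel_measurable borel" "\<phi>2 \<in> borel_measurable borel"
  using continuous_phi by (auto intro: borel_measurable_continuous_onI)

text \<open>Mean value theorem for \<open>\<phi> y - \<phi>1 a * y\<close> on the ball of radius
  \<open>|h|\<close>: its derivative there is at most \<open>C * |h|\<close>, because
  \<open>\<phi>1\<close> is Lipschitz.\<close>

lemma taylor1: "\<bar>\<phi> (a + h) - \<phi> a - \<phi>1 a * h\<bar> \<le> C * h\<^sup>2"
proof -
  have "norm ((\<phi> (a + h) - \<phi>1 a * (a + h)) - (\<phi> a - \<phi>1 a * a)) \<le> (C * \<bar>h\<bar>) * norm (a + h - a)"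
  proof (rule field_differentiable_bound[where S="cball a \<bar>h\<bar>"
        and f="\<lambda>y. \<phi> y - \<phi>1 a * y" and f'="\<lambda>y. \<phi>1 y - \<phi>1 a"])
    show "((\<lambda>y. \<phi> y - \<phi>1 a * y) has_field_derivative \<phi>1 z - \<phi>1 a) (at z within cball a \<bar>h\<bar>)" for z
      by (rule DERIV_subset[OF _ subset_UNIV])
         (auto intro!: derivative_eq_intros deriv_phi)
    show "norm (\<phi>1 z - \<phi>1 a) \<le> C * \<bar>h\<bar>" if "z \<in> cball a \<bar>h\<bar>" for z
      using lipschitz_phi1[of z a] that mult_left_mono[OF _ C_nonneg, of "\<bar>z - a\<bar>" "\<bar>h\<bar>"]
      by (auto simp: dist_real_def abs_minus_commute)
  qed (auto simp: dist_real_def)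
  then show ?thesis by (simp add: algebra_simps power2_eq_square)
qed

text \<open>The argument of \<open>taylor1\<close> twice: for \<open>\<phi>1\<close> first, then for
  \<open>\<phi>\<close> minus its quadratic polynomial. The cubic remainder is drawn from a
  Lipschitz second derivative and not from a third one, because the continuation of the exponential
  used below has a kink in \<open>\<phi>2\<close> at 0.\<close>

lemma taylor2: "\<bar>\<phi> (a + h) - \<phi> a - \<phi>1 a * h - \<phi>2 a * h\<^sup>2 / 2\<bar> \<le> C * \<bar>h\<bar> ^ 3"
proof -
  let ?S = "cball a \<bar>h\<bar>"
  have 1: "\<bar>\<phi>1 z - \<phi>1 a - \<phi>2 a * (z - a)\<bar> \<le> C * \<bar>h\<bar>\<^sup>2" if "z \<in> ?S" for z
  proof -
    have "norm ((\<phi>1 z - \<phi>2 a * z) - (\<phi>1 a - \<phi>2 a * a)) \<le> (C * \<bar>h\<bar>) * norm (z - a)"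
    proof (rule field_differentiable_bound[where S="?S"
          and f="\<lambda>y. \<phi>1 y - \<phi>2 a * y" and f'="\<lambda>y. \<phi>2 y - \<phi>2 a"])
      show "((\<lambda>y. \<phi>1 y - \<phi>2 a * y) has_field_derivative \<phi>2 z - \<phi>2 a) (at z within cball a \<bar>h\<bar>)" for z
        by (rule DERIV_subset[OF _ subset_UNIV])
           (auto intro!: derivative_eq_intros deriv_phi1)
      show "norm (\<phi>2 z - \<phi>2 a) \<le> C * \<bar>h\<bar>" if "z \<in> cball a \<bar>h\<bar>" for z
        using lipschitz_phi2[of z a] that mult_left_mono[OF _ C_nonneg, of "\<bar>z - a\<bar>" "\<bar>h\<bar>"]
        by (auto simp: dist_real_def abs_minus_commute)
    qed (use that in \<open>auto simp: dist_real_def\<close>)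
    also have "\<dots> \<le> (C * \<bar>h\<bar>) * \<bar>h\<bar>"
      using that C_nonneg by (intro mult_left_mono) (auto simp: dist_real_def abs_minus_commute)
    finally show ?thesis by (simp add: algebra_simps power2_eq_square)
  qed
  let ?G = "\<lambda>y. \<phi> y - \<phi>1 a * (y - a) - \<phi>2 a * (y - a)\<^sup>2 / 2"
  have "norm (?G (a + h) - ?G a) \<le> (C * \<bar>h\<bar>\<^sup>2) * norm (a + h - a)"
  proof (rule field_differentiable_bound[where S="?S"
        and f="?G" and f'="\<lambda>y. \<phi>1 y - \<phi>1 a - \<phi>2 a * (y - a)"])
    show "(?G has_field_derivative \<phi>1 z - \<phi>1 a - \<phi>2 a * (z - a)) (at z within ?S)" for z
      by (rule DERIV_subset[OF _ subset_UNIV])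
         (auto intro!: derivative_eq_intros deriv_phi)
  qed (use 1 in \<open>auto simp: dist_real_def\<close>)
  then show ?thesis by (simp add: algebra_simps power2_eq_square power3_eq_cube)
qed

end

section \<open>Continuing the exponential to negative arguments\<close>

lemma has_real_derivative_glue:
  fixes f g :: "real \<Rightarrow> real"
  assumes "\<And>z. (f has_real_derivative f' z) (at z)" "\<And>z. (g has_real_derivative g' z) (at z)"
    and "f 0 = g 0" "f' 0 = g' 0"
  shows "((\<lambda>z. if z < 0 then f z else g z) has_real_derivative (if z < 0 then f' z else g' z)) (at z)"
proof -
  consider "z < 0" | "z > 0" | "z = 0" by linarith
  then show ?thesis
  proof cases
    case 1
    have "eventually (\<lambda>y. y \<in> {..<0}) (nhds z)"
      using 1 by (intro eventually_nhds_in_open) auto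
    then have "eventually (\<lambda>y. (if y < 0 then f y else g y) = f y) (nhds z)"
      by eventually_elim auto
    then show ?thesis using 1 assms(1)[of z] by (subst DERIV_cong_ev[OF refl _ refl]) auto
  next
    case 2
    have "eventually (\<lambda>y. y \<in> {0<..}) (nhds z)"
      using 2 by (intro eventually_nhds_in_open) auto
    then have "eventually (\<lambda>y. (if y < 0 then f y else g y) = g y) (nhds z)"
      by eventually_elim auto
    then show ?thesis using 2 assms(2)[of z] by (subst DERIV_cong_ev[OF refl _ refl]) auto
  next
    case 3
    let ?k = "\<lambda>z. if z < 0 then f z else g z"
    have "((\<lambda>h. (?k (0 + h) - ?k 0) / h) \<longlongrightarrow> g' 0) (at 0)"
    proof (rule filterlim_split_at)
      have "((\<lambda>h. (f (0 + h) - f 0) / h) \<longlongrightarrow> f' 0) (at_left 0)"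
        using assms(1)[of 0] unfolding DERIV_def by (rule filterlim_mono) (auto simp: at_le)
      moreover have "eventually (\<lambda>h. (f (0 + h) - f 0) / h = (?k (0 + h) - ?k 0) / h) (at_left 0)"
        using assms(3) by (auto simp: eventually_at_filter)
      ultimately show "((\<lambda>h. (?k (0 + h) - ?k 0) / h) \<longlongrightarrow> g' 0) (at_left 0)"
        using assms(4) by (auto elim: Lim_transform_eventually)
      have "((\<lambda>h. (g (0 + h) - g 0) / h) \<longlongrightarrow> g' 0) (at_right 0)"
        using assms(2)[of 0] unfolding DERIV_def by (rule filterlim_mono) (auto simp: at_le)
      moreover have "eventually (\<lambda>h. (g (0 + h) - g 0) / h = (?k (0 + h) - ?k 0) / h) (at_right 0)"
        by (auto simp: eventually_at_filter)
      ultimately show "((\<lambda>h. (?k (0 + h) - ?k 0) / h) \<longlongrightarrow> g' 0) (at_right 0)"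
        by (auto elim: Lim_transform_eventually)
    qed
    then show ?thesis using 3 by (auto simp: DERIV_def)
  qed
qed

text \<open>One term of the exponential series is at most the whole sum. This bounds the Laplace
  integrands for \<open>l > 0\<close> as well as the glued test function.\<close>

lemma power_times_exp_le:
  fixes l y :: real
  assumes "0 \<le> y" "0 < l"
  shows "y ^ k * exp (- (l * y)) \<le> fact k / l ^ k"
proof -
  have "(l * y) ^ k / fact k \<le> exp (l * y)"
  proof -
    have s: "(\<lambda>n. (l * y) ^ n /\<^sub>R fact n) sums exp (l * y)" by (rule exp_converges)
    have "(\<Sum>n\<in>{k}. (l * y) ^ n /\<^sub>R fact n) \<le> (\<Sum>n. (l * y) ^ n /\<^sub>R fact n)"
      using s assms by (intro sum_le_suminf) (auto simp: sums_iff)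
    then show ?thesis using s by (simp add: sums_iff divide_inverse mult.commute)
  qed
  then show ?thesis using assms
    by (simp add: exp_minus field_simps power_mult_distrib)
qed

text \<open>For arguments on opposite sides the estimate passes through the junction 0, where the
  two functions agree; as 0 lies between them, the two distances add up to
  \<open>|y - z|\<close>.\<close>

lemma lipschitz_glue:
  fixes f g :: "real \<Rightarrow> real"
  assumes "\<And>z. (f has_real_derivative f' z) (at z)" "\<And>z. (g has_real_derivative g' z) (at z)"
    and "f 0 = g 0" "\<And>z. z \<le> 0 \<Longrightarrow> \<bar>f' z\<bar> \<le> K" "\<And>z. 0 \<le> z \<Longrightarrow> \<bar>g' z\<bar> \<le> K"
  defines "k \<equiv> \<lambda>z. if z < 0 then f z else g z"
  shows "\<bar>k y - k z\<bar> \<le> K * \<bar>y - z\<bar>"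
proof -
  have f: "\<bar>f y - f z\<bar> \<le> K * \<bar>y - z\<bar>" if "y \<le> 0" "z \<le> 0" for y z
    using field_differentiable_bound[of "{..0}" f f' K y z] that assms(4)
      DERIV_subset[OF assms(1) subset_UNIV] by auto
  have g: "\<bar>g y - g z\<bar> \<le> K * \<bar>y - z\<bar>" if "y \<ge> 0" "z \<ge> 0" for y z
    using field_differentiable_bound[of "{0..}" g g' K y z] that assms(5)
      DERIV_subset[OF assms(2) subset_UNIV] by auto
  have K: "0 \<le> K" using assms(4)[of 0] by simp
  have *: "\<bar>f y - g z\<bar> \<le> K * \<bar>y - z\<bar>" if "y < 0" "0 \<le> z" for y z
  proof -
    have "\<bar>f y - g z\<bar> \<le> \<bar>f y - f 0\<bar> + \<bar>g 0 - g z\<bar>" using assms(3) by linarith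
    also have "\<dots> \<le> K * \<bar>y - 0\<bar> + K * \<bar>0 - z\<bar>" using that by (intro add_mono f g) auto
    also have "\<dots> = K * \<bar>y - z\<bar>" using that by (simp add: algebra_simps)
    finally show ?thesis .
  qed
  show ?thesis
    using f[of y z] g[of y z] *[of y z] *[of z y]
    by (auto simp: k_def abs_minus_commute)
qed

text \<open>The approximating processes below need not be nonnegative, so \<open>exp (- l y)\<close> is continued
  to \<open>y < 0\<close> by an exponential polynomial matched to second order at \<open>0\<close>.\<close>

lemma ex_test_function_exp:
  fixes l :: real
  assumes "0 < l"
  obtains \<phi> \<phi>1 \<phi>2 C where "test_function \<phi> \<phi>1 \<phi>2 C"
    "\<And>y. 0 \<le> y \<Longrightarrow> \<phi> y = exp (- (l * y))"
    "\<And>y. 0 \<le> y \<Longrightarrow> \<phi>1 y = - (l * exp (- (l * y)))"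
    "\<And>y. 0 \<le> y \<Longrightarrow> \<phi>2 y = l\<^sup>2 * exp (- (l * y))"
proof -
  \<comment> \<open>Case \<open>l = 1\<close>; the general one follows by the scaling
    \<open>l * y\<close>. At 0 the function \<open>exp z * (a + b * z + c * z\<^sup>2)\<close> has
    value \<open>a\<close> and derivatives \<open>a + b\<close> and
    \<open>a + 2 * b + 2 * c\<close>; matching 1, -1, 1 forces \<open>a = 1\<close>,
    \<open>b = -2\<close>, \<open>c = 2\<close>.\<close>
  define k where "k z = (if z < 0 then exp z * (1 - 2 * z + 2 * z\<^sup>2) else exp (- z))" for z :: real
  define k1 where "k1 z = (if z < 0 then exp z * (- 1 + 2 * z + 2 * z\<^sup>2) else - exp (- z))" for z :: real
  define k2 where "k2 z = (if z < 0 then exp z * (1 + 6 * z + 2 * z\<^sup>2) else exp (- z))" for z :: real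
  have dk: "(k has_real_derivative k1 z) (at z)" for z
    unfolding k_def[abs_def] k1_def[abs_def]
    by (rule has_real_derivative_glue)
       (auto intro!: derivative_eq_intros simp: algebra_simps power2_eq_square)
  have dk1: "(k1 has_real_derivative k2 z) (at z)" for z
    unfolding k1_def[abs_def] k2_def[abs_def]
    by (rule has_real_derivative_glue)
       (auto intro!: derivative_eq_intros simp: algebra_simps power2_eq_square)
  have e: "exp z * \<bar>a + b * z + c * z\<^sup>2\<bar> \<le> \<bar>a\<bar> + \<bar>b\<bar> + 2 * \<bar>c\<bar>" if "z \<le> 0" for a b c z :: real
  proof -
    have "exp z * \<bar>a + b * z + c * z\<^sup>2\<bar> \<le> exp z * (\<bar>a\<bar> + \<bar>b\<bar> * (- z) + \<bar>c\<bar> * (- z)\<^sup>2)"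
      using that by (intro mult_left_mono) (auto simp: abs_mult intro!: order_trans[OF abs_triangle_ineq] add_mono)
    also have "\<dots> = \<bar>a\<bar> * exp z + \<bar>b\<bar> * ((- z) ^ 1 * exp (- (1 * (- z)))) + \<bar>c\<bar> * ((- z) ^ 2 * exp (- (1 * (- z))))"
      by (simp add: algebra_simps)
    also have "\<dots> \<le> \<bar>a\<bar> * 1 + \<bar>b\<bar> * (fact 1 / 1 ^ 1) + \<bar>c\<bar> * (fact 2 / 1 ^ 2)"
      using that by (intro add_mono mult_left_mono power_times_exp_le) auto
    finally show ?thesis by (simp add: fact_numeral)
  qed
  \<comment> \<open>The largest instance of \<open>e\<close> belongs to the derivative of
    \<open>k2\<close> on the negative side, with \<open>7 + 10 + 2 * 2 = 21\<close>; this one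
    constant also covers \<open>k\<close>, \<open>k1\<close> and \<open>k2\<close>.\<close>
  have bk: "\<bar>k z\<bar> \<le> 21" for z
    using e[of z 1 "-2" 2] by (auto simp: k_def abs_mult intro: order_trans[of _ 1])
  have bk1: "\<bar>k1 z\<bar> \<le> 21" for z
    using e[of z "-1" 2 2] by (auto simp: k1_def abs_mult intro: order_trans[of _ 1])
  have bk2: "\<bar>k2 z\<bar> \<le> 21" for z
    using e[of z 1 6 2] by (auto simp: k2_def abs_mult intro: order_trans[of _ 1])
  have lk2: "\<bar>k2 y - k2 z\<bar> \<le> 21 * \<bar>y - z\<bar>" for y z
    unfolding k2_def
  proof (rule lipschitz_glue)
    show "((\<lambda>z. exp z * (1 + 6 * z + 2 * z\<^sup>2)) has_real_derivative exp z * (7 + 10 * z + 2 * z\<^sup>2)) (at z)" for z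
      by (auto intro!: derivative_eq_intros simp: algebra_simps)
    show "((\<lambda>z. exp (- z)) has_real_derivative - exp (- z)) (at z)" for z :: real
      by (auto intro!: derivative_eq_intros)
    show "\<bar>exp z * (7 + 10 * z + 2 * z\<^sup>2)\<bar> \<le> 21" if "z \<le> 0" for z :: real
      using e[OF that, of 7 10 2] by (simp add: abs_mult)
  qed (auto intro: order_trans[of _ 1])
  \<comment> \<open>Scaling multiplies the bounds of the function and of its two derivatives, and
    the Lipschitz constant of the last, by \<open>1\<close>, \<open>l\<close>,
    \<open>l\<^sup>2\<close> and \<open>l ^ 3\<close>; the sum dominates each of them.\<close>
  define C where "C = 21 * (1 + l + l\<^sup>2 + l ^ 3)"
  have C: "21 \<le> C" "21 * l \<le> C" "21 * l\<^sup>2 \<le> C" "21 * l ^ 3 \<le> C"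
    using assms by (auto simp: C_def)
  have "test_function (\<lambda>y. k (l * y)) (\<lambda>y. l * k1 (l * y)) (\<lambda>y. l\<^sup>2 * k2 (l * y)) C"
  proof
    fix y z :: real
    show "((\<lambda>y. k (l * y)) has_real_derivative l * k1 (l * y)) (at y)"
      using DERIV_chain2[OF dk DERIV_cmult_Id, of l y UNIV] by (simp add: mult.commute)
    show "((\<lambda>y. l * k1 (l * y)) has_real_derivative l\<^sup>2 * k2 (l * y)) (at y)"
      using DERIV_cmult[OF DERIV_chain2[OF dk1 DERIV_cmult_Id, of l y UNIV], of l]
      by (simp add: power2_eq_square ac_simps)
    show "\<bar>k (l * y)\<bar> \<le> C" using bk C by (blast intro: order_trans)
    have "\<bar>l * k1 (l * y)\<bar> \<le> l * 21"
      using bk1[of "l * y"] assms by (auto simp: abs_mult)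
    then show "\<bar>l * k1 (l * y)\<bar> \<le> C" using C by linarith
    have "\<bar>l\<^sup>2 * k2 (l * y)\<bar> \<le> l\<^sup>2 * 21"
      using bk2[of "l * y"] assms by (auto simp: abs_mult)
    then show "\<bar>l\<^sup>2 * k2 (l * y)\<bar> \<le> C" using C by linarith
    have "\<bar>l\<^sup>2 * k2 (l * y) - l\<^sup>2 * k2 (l * z)\<bar> = l\<^sup>2 * \<bar>k2 (l * y) - k2 (l * z)\<bar>"
      by (simp add: abs_mult flip: right_diff_distrib)
    also have "\<dots> \<le> l\<^sup>2 * (21 * \<bar>l * y - l * z\<bar>)"
      by (intro mult_left_mono lk2) auto
    also have "\<dots> = 21 * l ^ 3 * \<bar>y - z\<bar>"
      using assms by (simp add: abs_mult power2_eq_square power3_eq_cube flip: right_diff_distrib)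
    also have "\<dots> \<le> C * \<bar>y - z\<bar>" using C by (intro mult_right_mono) auto
    finally show "\<bar>l\<^sup>2 * k2 (l * y) - l\<^sup>2 * k2 (l * z)\<bar> \<le> C * \<bar>y - z\<bar>" .
  qed
  then show ?thesis
    by (rule that) (use assms in \<open>auto simp: k_def k1_def k2_def mult_less_0_iff\<close>)
qed

section \<open>Pathwise Riemann sums\<close>

lemma set_lebesgue_integral_split:
  fixes f :: "real \<Rightarrow> real"
  assumes "set_integrable lborel {a..c} f" "a \<le> b" "b \<le> c"
  shows "(LINT r:{a..c}|lborel. f r) = (LINT r:{a..b}|lborel. f r) + (LINT r:{b..c}|lborel. f r)"
proof -
  have "{a..c} = {a..b} \<union> {b..c}" using assms by auto
  then show ?thesis
  proof (simp only:, intro set_integral_Un_AE)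
    show "AE r in lborel. \<not> (r \<in> {a..b} \<and> r \<in> {b..c})"
      using AE_lborel_singleton[of b] by eventually_elim auto
  qed (use assms in \<open>auto intro: set_integrable_subset\<close>)
qed

lemma set_lebesgue_integral_point: "(LINT r:{a}|lborel. f r) = (0::real)" for a :: real
proof -
  have "AE r in lborel. indicator {a} r *\<^sub>R f r = 0"
    using AE_lborel_singleton[of a] by eventually_elim auto
  then show ?thesis by (simp add: set_lebesgue_integral_def integral_eq_zero_AE)
qed

lemma sum_set_lebesgue_integral_grid:
  fixes f :: "real \<Rightarrow> real" and p :: "nat \<Rightarrow> real"
  assumes "set_integrable lborel {p 0..p n} f" and mono: "\<And>i. p i \<le> p (Suc i)"
  shows "(\<Sum>i<n. LINT r:{p i..p (Suc i)}|lborel. f r) = (LINT r:{p 0..p n}|lborel. f r)"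
  using assms(1)
proof (induction n)
  case 0
  show ?case by (simp add: set_lebesgue_integral_point)
next
  case (Suc n)
  have "p 0 \<le> p n" using lift_Suc_mono_le[of p 0 n] mono by auto
  moreover have "set_integrable lborel {p 0..p n} f"
    using mono[of n] by (intro set_integrable_subset[OF Suc.prems]) auto
  ultimately show ?case
    using set_lebesgue_integral_split[OF Suc.prems, of "p n"] mono[of n] Suc.IH by simp
qed

lemma set_integrable_mult_continuous:
  fixes f g :: "real \<Rightarrow> real"
  assumes "set_integrable lborel {a..b} f" "continuous_on {a..b} g"
  shows "set_integrable lborel {a..b} (\<lambda>r. g r * f r)"
proof -
  obtain K where K: "\<And>r. r \<in> {a..b} \<Longrightarrow> \<bar>g r\<bar> \<le> K"
    using compact_imp_bounded[OF compact_continuous_image[OF assms(2) compact_Icc]]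
    unfolding bounded_iff real_norm_def by (metis image_eqI)
  have meas: "(\<lambda>r. indicator {a..b} r *\<^sub>R g r) \<in> borel_measurable lborel"
    using borel_measurable_continuous_on_indicator[OF _ assms(2)] by simp
  have *: "(\<lambda>r. indicator {a..b} r *\<^sub>R (g r * f r)) = (\<lambda>r. (indicator {a..b} r *\<^sub>R g r) * (indicator {a..b} r *\<^sub>R f r))"
    by (auto simp: indicator_def)
  show ?thesis
    unfolding set_integrable_def *
  proof (rule Bochner_Integration.integrable_bound)
    show "integrable lborel (\<lambda>r. \<bar>K\<bar> * \<bar>indicator {a..b} r *\<^sub>R f r\<bar>)"
      using assms(1) by (auto simp: set_integrable_def)
    show "(\<lambda>r. (indicator {a..b} r *\<^sub>R g r) * (indicator {a..b} r *\<^sub>R f r)) \<in> borel_measurable lborel"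
      using meas assms(1) by (auto simp: set_integrable_def)
    have "\<bar>g r\<bar> * \<bar>f r\<bar> \<le> \<bar>K\<bar> * \<bar>f r\<bar>" if "r \<in> {a..b}" for r
      using K[OF that] by (intro mult_right_mono) auto
    then show "AE r in lborel. norm ((indicator {a..b} r *\<^sub>R g r) * (indicator {a..b} r *\<^sub>R f r))
        \<le> norm (\<bar>K\<bar> * \<bar>indicator {a..b} r *\<^sub>R f r\<bar>)"
      by (auto simp: abs_mult indicator_def)
  qed
qed

lemma set_integral_abs_le:
  fixes f g :: "real \<Rightarrow> real"
  assumes "set_integrable lborel S f" "set_integrable lborel S g" "\<And>r. r \<in> S \<Longrightarrow> \<bar>f r\<bar> \<le> g r"
  shows "\<bar>LINT r:S|lborel. f r\<bar> \<le> (LINT r:S|lborel. g r)"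
proof -
  have "\<bar>LINT r:S|lborel. f r\<bar> \<le> (LINT r:S|lborel. \<bar>f r\<bar>)"
    using set_integral_norm_bound[OF assms(1)] by simp
  also have "\<dots> \<le> (LINT r:S|lborel. g r)"
    using assms by (intro set_integral_mono set_integrable_abs) auto
  finally show ?thesis .
qed

section \<open>Second-order expansion along a single path\<close>

context test_function
begin

lemma continuous_compose:
  assumes "continuous_on S Z"
  shows "continuous_on S (\<lambda>r. \<phi> (Z r))" "continuous_on S (\<lambda>r. \<phi>1 (Z r))" "continuous_on S (\<lambda>r. \<phi>2 (Z r))"
  using continuous_on_compose2[OF continuous_phi(1) assms] continuous_on_compose2[OF continuous_phi(2) assms]
    continuous_on_compose2[OF continuous_phi(3) assms] by auto

lemma set_integrable_generator:
  fixes Z m :: "real \<Rightarrow> real"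
  assumes "continuous_on {u..v} Z" "set_integrable lborel {u..v} m"
  shows "set_integrable lborel {u..v} (\<lambda>r. \<phi>1 (Z r) * m r + \<phi>2 (Z r) * \<xi>\<^sup>2 / 2)"
proof -
  have "continuous_on {u..v} (\<lambda>r. \<phi>2 (Z r) * \<xi>\<^sup>2 / 2)"
    using continuous_compose[OF assms(1)] by (auto intro!: continuous_intros)
  then show ?thesis
    by (intro set_integral_add(1) set_integrable_mult_continuous[OF assms(2) continuous_compose(2)[OF assms(1)]]
        borel_integrable_atLeastAtMost')
qed

text \<open>The endpoint \<open>Z v\<close> is \<open>Z u\<close> plus the Brownian step plus the
  drift step, so the first difference is a Taylor expansion in the drift step alone, around
  \<open>Z v\<close>. Three errors add up: the quadratic remainder and the freezing of
  \<open>\<phi>1\<close> at \<open>Z v\<close>, each at most \<open>C * e\<close> times the integral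
  of \<open>|m|\<close>, and the freezing of \<open>\<phi>2\<close> at \<open>Z u\<close>, which
  gives the last summand. The term with \<open>\<phi>2 (Z u)\<close> is what the Brownian step
  contributes on average.\<close>

lemma path_increment:
  fixes Z A b m :: "real \<Rightarrow> real"
  assumes uv: "u \<le> v" and cont: "continuous_on {u..v} Z"
    and inc: "Z v - Z u = \<xi> * (b v - b u) + (A v - A u)"
    and drift: "A v - A u = (LINT r:{u..v}|lborel. m r)" and int: "set_integrable lborel {u..v} m"
    and small: "\<And>r. r \<in> {u..v} \<Longrightarrow> \<bar>Z v - Z r\<bar> \<le> e" "\<And>r. r \<in> {u..v} \<Longrightarrow> \<bar>Z u - Z r\<bar> \<le> e"
      "\<bar>A v - A u\<bar> \<le> e"
  shows "\<bar>\<phi> (Z v) - \<phi> (Z u + \<xi> * (b v - b u)) + \<phi>2 (Z u) * \<xi>\<^sup>2 * (v - u) / 2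
      - (LINT r:{u..v}|lborel. \<phi>1 (Z r) * m r + \<phi>2 (Z r) * \<xi>\<^sup>2 / 2)\<bar>
    \<le> C * e * (2 * (LINT r:{u..v}|lborel. \<bar>m r\<bar>) + \<xi>\<^sup>2 * (v - u) / 2)"
proof -
  let ?I = "\<lambda>f. LINT r:{u..v}|lborel. f r"
  have e: "0 \<le> e" using small(3) by linarith
  have abs_int: "set_integrable lborel {u..v} (\<lambda>r. \<bar>m r\<bar>)" using int by (rule set_integrable_abs)
  have i1: "set_integrable lborel {u..v} (\<lambda>r. \<phi>1 (Z r) * m r)"
    by (rule set_integrable_mult_continuous[OF int continuous_compose(2)[OF cont]])
  have i2: "set_integrable lborel {u..v} (\<lambda>r. \<phi>2 (Z r) * \<xi>\<^sup>2 / 2)"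
    using continuous_compose(3)[OF cont] by (intro borel_integrable_atLeastAtMost') (auto intro!: continuous_intros)
  have const: "?I (\<lambda>r. k) = k * (v - u)" "set_integrable lborel {u..v} (\<lambda>r. k)" for k
    using uv by (auto simp: set_lebesgue_integral_def intro!: borel_integrable_atLeastAtMost')
  have A: "\<bar>A v - A u\<bar> \<le> ?I (\<lambda>r. \<bar>m r\<bar>)"
    unfolding drift using set_integral_norm_bound[OF int] by simp
  let ?d = "A v - A u"
  have "\<bar>\<phi> (Z v) - \<phi> (Z u + \<xi> * (b v - b u)) - \<phi>1 (Z v) * ?d\<bar> \<le> C * ?d\<^sup>2"
  proof -
    have "Z u + \<xi> * (b v - b u) = Z v + - ?d" using inc by linarith
    then show ?thesis using taylor1[of "Z v" "- ?d"] unfolding \<open>Z u + _ = _\<close> by (simp only: power2_minus mult_minus_right)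
  qed
  also have "\<dots> \<le> C * (e * ?I (\<lambda>r. \<bar>m r\<bar>))"
    using mult_mono[OF small(3) A e] by (intro mult_left_mono C_nonneg) (simp add: power2_eq_square)
  finally have 1: "\<bar>\<phi> (Z v) - \<phi> (Z u + \<xi> * (b v - b u)) - \<phi>1 (Z v) * ?d\<bar> \<le> C * e * ?I (\<lambda>r. \<bar>m r\<bar>)"
    by simp
  have "\<phi>1 (Z v) * ?d - ?I (\<lambda>r. \<phi>1 (Z r) * m r) = ?I (\<lambda>r. (\<phi>1 (Z v) - \<phi>1 (Z r)) * m r)"
    unfolding drift using i1 int
    by (simp add: left_diff_distrib set_integral_diff)
  moreover have "\<bar>?I (\<lambda>r. (\<phi>1 (Z v) - \<phi>1 (Z r)) * m r)\<bar> \<le> ?I (\<lambda>r. C * e * \<bar>m r\<bar>)"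
  proof (rule set_integral_abs_le)
    show "set_integrable lborel {u..v} (\<lambda>r. (\<phi>1 (Z v) - \<phi>1 (Z r)) * m r)"
      using i1 int by (simp add: left_diff_distrib)
    fix r assume "r \<in> {u..v}"
    then have "\<bar>\<phi>1 (Z v) - \<phi>1 (Z r)\<bar> \<le> C * e"
      using lipschitz_phi1[of "Z v" "Z r"] mult_left_mono[OF small(1) C_nonneg] by fastforce
    then show "\<bar>(\<phi>1 (Z v) - \<phi>1 (Z r)) * m r\<bar> \<le> C * e * \<bar>m r\<bar>"
      by (simp add: abs_mult mult_right_mono)
  qed (use abs_int in auto)
  ultimately have 2: "\<bar>\<phi>1 (Z v) * ?d - ?I (\<lambda>r. \<phi>1 (Z r) * m r)\<bar> \<le> C * e * ?I (\<lambda>r. \<bar>m r\<bar>)"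
    by simp
  have "\<phi>2 (Z u) * \<xi>\<^sup>2 * (v - u) / 2 - ?I (\<lambda>r. \<phi>2 (Z r) * \<xi>\<^sup>2 / 2)
      = ?I (\<lambda>r. \<phi>2 (Z u) * \<xi>\<^sup>2 / 2 - \<phi>2 (Z r) * \<xi>\<^sup>2 / 2)"
    using i2 const by (subst set_integral_diff) auto
  moreover have "\<bar>?I (\<lambda>r. \<phi>2 (Z u) * \<xi>\<^sup>2 / 2 - \<phi>2 (Z r) * \<xi>\<^sup>2 / 2)\<bar> \<le> ?I (\<lambda>r. C * e * \<xi>\<^sup>2 / 2)"
  proof (rule set_integral_abs_le)
    fix r assume "r \<in> {u..v}"
    then have *: "\<bar>\<phi>2 (Z u) - \<phi>2 (Z r)\<bar> \<le> C * e"
      using lipschitz_phi2[of "Z u" "Z r"] mult_left_mono[OF small(2) C_nonneg] by fastforce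
    have "\<bar>\<phi>2 (Z u) * \<xi>\<^sup>2 / 2 - \<phi>2 (Z r) * \<xi>\<^sup>2 / 2\<bar> = \<bar>\<phi>2 (Z u) - \<phi>2 (Z r)\<bar> * (\<xi>\<^sup>2 / 2)"
      by (simp add: abs_mult flip: left_diff_distrib diff_divide_distrib)
    also have "\<dots> \<le> C * e * (\<xi>\<^sup>2 / 2)" using * by (rule mult_right_mono) simp
    finally show "\<bar>\<phi>2 (Z u) * \<xi>\<^sup>2 / 2 - \<phi>2 (Z r) * \<xi>\<^sup>2 / 2\<bar> \<le> C * e * \<xi>\<^sup>2 / 2" by simp
  qed (use i2 const in auto)
  ultimately have 3: "\<bar>\<phi>2 (Z u) * \<xi>\<^sup>2 * (v - u) / 2 - ?I (\<lambda>r. \<phi>2 (Z r) * \<xi>\<^sup>2 / 2)\<bar> \<le> C * e * \<xi>\<^sup>2 / 2 * (v - u)"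
    unfolding const by simp
  have "?I (\<lambda>r. \<phi>1 (Z r) * m r + \<phi>2 (Z r) * \<xi>\<^sup>2 / 2) = ?I (\<lambda>r. \<phi>1 (Z r) * m r) + ?I (\<lambda>r. \<phi>2 (Z r) * \<xi>\<^sup>2 / 2)"
    using i1 i2 by (rule set_integral_add)
  moreover have "C * e * (2 * ?I (\<lambda>r. \<bar>m r\<bar>) + \<xi>\<^sup>2 * (v - u) / 2)
      = C * e * ?I (\<lambda>r. \<bar>m r\<bar>) + C * e * ?I (\<lambda>r. \<bar>m r\<bar>) + C * e * \<xi>\<^sup>2 / 2 * (v - u)"
    by (simp add: algebra_simps)
  ultimately show ?thesis using 1 2 3 by linarith
qed

text \<open>Only the drift part of each increment is compensated pathwise; the Brownian part is left
  in the sum because it is handled in expectation by the lemma \<open>gaussian_step\<close> below.\<close>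

lemma path_sum_tendsto:
  fixes Z A b m :: "real \<Rightarrow> real"
  assumes st: "s \<le> t" and contZ: "continuous_on {s..t} Z" and contA: "continuous_on {s..t} A"
    and inc: "\<And>u v. s \<le> u \<Longrightarrow> u \<le> v \<Longrightarrow> v \<le> t \<Longrightarrow> Z v - Z u = \<xi> * (b v - b u) + (A v - A u)"
    and drift: "\<And>u v. s \<le> u \<Longrightarrow> u \<le> v \<Longrightarrow> v \<le> t \<Longrightarrow> A v - A u = (LINT r:{u..v}|lborel. m r)"
    and int: "set_integrable lborel {s..t} m"
  defines "p \<equiv> \<lambda>n i. s + (t - s) * real i / real (Suc n)"
  shows "(\<lambda>n. \<Sum>i<Suc n. \<phi> (Z (p n (Suc i))) - \<phi> (Z (p n i) + \<xi> * (b (p n (Suc i)) - b (p n i)))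
        + \<phi>2 (Z (p n i)) * \<xi>\<^sup>2 * (p n (Suc i) - p n i) / 2)
    \<longlonglongrightarrow> (LINT r:{s..t}|lborel. \<phi>1 (Z r) * m r + \<phi>2 (Z r) * \<xi>\<^sup>2 / 2)"
    (is "?S \<longlonglongrightarrow> ?I")
proof (rule LIMSEQ_I)
  fix e' :: real assume e': "0 < e'"
  define Q where "Q = 2 * (LINT r:{s..t}|lborel. \<bar>m r\<bar>) + \<xi>\<^sup>2 * (t - s) / 2"
  have Q: "0 \<le> Q" using st by (auto simp: Q_def set_lebesgue_integral_def intro!: add_nonneg_nonneg integral_nonneg_AE)
  \<comment> \<open>Makes the total error \<open>C * e * Q\<close> over the grid smaller than
    \<open>e'\<close>; the \<open>+ 1\<close> covers \<open>C * Q = 0\<close>.\<close>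
  define e where "e = e' / (C * Q + 1)"
  have CQ: "0 \<le> C * Q" using Q C_nonneg by simp
  have e: "0 < e" using e' CQ by (auto simp: e_def intro!: divide_pos_pos)
  have eCQ: "C * e * Q < e'"
    using e' CQ by (simp add: e_def field_simps)
  obtain d1 where d1: "0 < d1" "\<And>u v. u \<in> {s..t} \<Longrightarrow> v \<in> {s..t} \<Longrightarrow> \<bar>u - v\<bar> < d1 \<Longrightarrow> \<bar>Z u - Z v\<bar> < e"
    using compact_uniformly_continuous[OF contZ] e unfolding uniformly_continuous_on_def dist_real_def
    by (metis compact_Icc)
  obtain d2 where d2: "0 < d2" "\<And>u v. u \<in> {s..t} \<Longrightarrow> v \<in> {s..t} \<Longrightarrow> \<bar>u - v\<bar> < d2 \<Longrightarrow> \<bar>A u - A v\<bar> < e"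
    using compact_uniformly_continuous[OF contA] e unfolding uniformly_continuous_on_def dist_real_def
    by (metis compact_Icc)
  define d where "d = min d1 d2"
  have d: "0 < d" using d1 d2 by (simp add: d_def)
  have "(\<lambda>n. (t - s) / real (Suc n)) \<longlonglongrightarrow> 0"
    by (intro LIMSEQ_Suc lim_const_over_n)
  then have "eventually (\<lambda>n. (t - s) / real (Suc n) < d) sequentially"
    using d by (rule order_tendstoD)
  then obtain N where N: "\<And>n. n \<ge> N \<Longrightarrow> (t - s) / real (Suc n) < d"
    by (auto simp: eventually_sequentially)
  show "\<exists>no. \<forall>n\<ge>no. norm (?S n - ?I) < e'"
  proof (intro exI allI impI)
    fix n assume n: "N \<le> n"
    have p0: "p n 0 = s" by (simp add: p_def)
    have pn: "p n (Suc n) = t" unfolding p_def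
      using nonzero_mult_div_cancel_right[of "real (Suc n)" "t - s"] by linarith
    have step: "p n (Suc i) - p n i = (t - s) / real (Suc n)" for i
    proof -
      have "(t - s) * real (Suc i) - (t - s) * real i = t - s" by (simp add: algebra_simps)
      then show ?thesis unfolding p_def by (simp only: add_diff_cancel_left flip: diff_divide_distrib)
    qed
    have stepd: "p n (Suc i) - p n i < d" for i using N[OF n] step by simp
    have mono: "p n i \<le> p n (Suc i)" for i
    proof -
      have "0 \<le> (t - s) / real (Suc n)" using st by simp
      then show ?thesis using step[of i] by linarith
    qed
    have sp: "s \<le> p n i" for i using lift_Suc_mono_le[of "p n" 0 i] mono p0 by auto
    have pt: "p n i \<le> t" if "i \<le> Suc n" for i using lift_Suc_mono_le[of "p n" i "Suc n"] mono pn that by auto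
    let ?J = "\<lambda>i f. LINT r:{p n i..p n (Suc i)}|lborel. f r"
    let ?f = "\<lambda>r. \<phi>1 (Z r) * m r + \<phi>2 (Z r) * \<xi>\<^sup>2 / 2"
    have I: "?I = (\<Sum>i<Suc n. ?J i ?f)"
      using sum_set_lebesgue_integral_grid[of "p n" "Suc n" ?f] set_integrable_generator[OF contZ int] mono
      unfolding p0 pn by simp
    have Im: "(LINT r:{s..t}|lborel. \<bar>m r\<bar>) = (\<Sum>i<Suc n. ?J i (\<lambda>r. \<bar>m r\<bar>))"
      using sum_set_lebesgue_integral_grid[of "p n" "Suc n" "\<lambda>r. \<bar>m r\<bar>"] set_integrable_abs[OF int] mono
      unfolding p0 pn by simp
    let ?t = "\<lambda>i. \<phi> (Z (p n (Suc i))) - \<phi> (Z (p n i) + \<xi> * (b (p n (Suc i)) - b (p n i)))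
        + \<phi>2 (Z (p n i)) * \<xi>\<^sup>2 * (p n (Suc i) - p n i) / 2"
    have "norm (?S n - ?I) = \<bar>\<Sum>i<Suc n. ?t i - ?J i ?f\<bar>"
      unfolding I by (simp add: sum_subtractf)
    also have "\<dots> \<le> (\<Sum>i<Suc n. \<bar>?t i - ?J i ?f\<bar>)" by (rule sum_abs)
    also have "\<dots> \<le> (\<Sum>i<Suc n. C * e * (2 * ?J i (\<lambda>r. \<bar>m r\<bar>) + \<xi>\<^sup>2 * (p n (Suc i) - p n i) / 2))"
    proof (intro sum_mono path_increment)
      fix i assume "i \<in> {..<Suc n}"
      then have i: "{p n i..p n (Suc i)} \<subseteq> {s..t}" using sp[of i] pt[of "Suc i"] by auto
      show "continuous_on {p n i..p n (Suc i)} Z" using continuous_on_subset[OF contZ i] .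
      show "Z (p n (Suc i)) - Z (p n i) = \<xi> * (b (p n (Suc i)) - b (p n i)) + (A (p n (Suc i)) - A (p n i))"
        "A (p n (Suc i)) - A (p n i) = (LINT r:{p n i..p n (Suc i)}|lborel. m r)"
        using \<open>i \<in> {..<Suc n}\<close> sp pt[of "Suc i"] mono by (auto intro: inc drift)
      show "set_integrable lborel {p n i..p n (Suc i)} m" using set_integrable_subset[OF int _ i] by simp
      have k: "p n i \<in> {s..t}" "p n (Suc i) \<in> {s..t}" using i mono[of i] by auto
      show "\<bar>A (p n (Suc i)) - A (p n i)\<bar> \<le> e"
        using d2(2)[OF k(2,1)] stepd[of i] mono[of i] by (auto simp: d_def)
      fix r assume r: "r \<in> {p n i..p n (Suc i)}"
      then have "r \<in> {s..t}" using i by auto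
      with d1(2)[OF k(2) this] d1(2)[OF k(1) this] stepd[of i] r
      show "\<bar>Z (p n (Suc i)) - Z r\<bar> \<le> e" "\<bar>Z (p n i) - Z r\<bar> \<le> e" by (auto simp: d_def)
    qed (rule mono)
    also have "\<dots> = C * e * (2 * (\<Sum>i<Suc n. ?J i (\<lambda>r. \<bar>m r\<bar>)) + \<xi>\<^sup>2 * (\<Sum>i<Suc n. p n (Suc i) - p n i) / 2)"
      by (simp only: sum.distrib sum_distrib_left sum_divide_distrib distrib_left)
    also have "(\<Sum>i<Suc n. p n (Suc i) - p n i) = t - s"
      unfolding sum_lessThan_telescope p0 pn by simp
    finally show "norm (?S n - ?I) < e'" using eCQ by (simp add: Im Q_def)
  qed
qed

end

section \<open>Brownian increments\<close>

text \<open>Processes carry no information at negative times, hence the clipping at \<open>0\<close>.\<close>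

definition jointly_measurable :: "'a measure \<Rightarrow> (real \<Rightarrow> 'a \<Rightarrow> real) \<Rightarrow> bool" where
  "jointly_measurable M f \<longleftrightarrow> (\<lambda>(\<omega>, r). f (max 0 r) \<omega>) \<in> borel_measurable (M \<Otimes>\<^sub>M lborel)"

text \<open>Sampling the path at the grid point just below the clipped time uses countably many
  times only, hence is jointly measurable. The mesh \<open>1 / Suc n\<close> tends to 0, and path
  continuity passes to the limit.\<close>

lemma jointly_measurable_continuous_paths:
  assumes cont: "continuous_paths M X" and meas: "\<And>t. 0 \<le> t \<Longrightarrow> X t \<in> borel_measurable M"
  shows "jointly_measurable M X"
  unfolding jointly_measurable_def
proof (rule borel_measurable_LIMSEQ_real)
  fix n :: nat
  have "(\<lambda>p. X (real (nat \<lfloor>real (Suc n) * max 0 (snd p)\<rfloor>) / real (Suc n)) (fst p))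
      \<in> borel_measurable (M \<Otimes>\<^sub>M lborel)"
  proof (rule measurable_compose_countable[where f="\<lambda>k p. X (real k / real (Suc n)) (fst p)"])
    fix k :: nat
    have "X (real k / real (Suc n)) \<in> borel_measurable M" by (rule meas) simp
    then show "(\<lambda>p. X (real k / real (Suc n)) (fst p)) \<in> borel_measurable (M \<Otimes>\<^sub>M lborel)"
      by (rule measurable_compose[OF measurable_fst])
  qed measurable
  then show "(\<lambda>(\<omega>, r). X (real (nat \<lfloor>real (Suc n) * max 0 r\<rfloor>) / real (Suc n)) \<omega>) \<in> borel_measurable (M \<Otimes>\<^sub>M lborel)"
    by (simp add: case_prod_beta')
next
  fix p assume p: "p \<in> space (M \<Otimes>\<^sub>M (lborel :: real measure))"
  then have \<omega>: "fst p \<in> space M" by (auto simp: space_pair_measure)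
  let ?r = "max 0 (snd p)"
  let ?a = "\<lambda>n. real (nat \<lfloor>real (Suc n) * ?r\<rfloor>) / real (Suc n)"
  have "?a \<longlonglongrightarrow> ?r"
  proof (rule real_tendsto_sandwich)
    have lo: "?r - 1 / real (Suc n) \<le> ?a n" and hi: "?a n \<le> ?r" for n
    proof -
      have *: "real (nat \<lfloor>real (Suc n) * ?r\<rfloor>) = real_of_int \<lfloor>real (Suc n) * ?r\<rfloor>"
        by (intro of_nat_nat) simp
      show "?a n \<le> ?r" unfolding *
        by (subst pos_divide_le_eq) (simp_all del: of_nat_Suc add: mult.commute[of ?r])
      have "?r - 1 / real (Suc n) = (real (Suc n) * ?r - 1) / real (Suc n)"
        by (simp add: diff_divide_distrib del: of_nat_Suc)
      also have "\<dots> \<le> ?a n" unfolding *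
        by (intro divide_right_mono) linarith+
      finally show "?r - 1 / real (Suc n) \<le> ?a n" .
    qed
    show "eventually (\<lambda>n. ?r - 1 / real (Suc n) \<le> ?a n) sequentially" using lo by simp
    show "eventually (\<lambda>n. ?a n \<le> ?r) sequentially" using hi by simp
    show "(\<lambda>n. ?r - 1 / real (Suc n)) \<longlonglongrightarrow> ?r"
      using tendsto_diff[OF tendsto_const LIMSEQ_Suc[OF lim_const_over_n[of 1]]] by simp
  qed simp
  moreover have "continuous_on {0..} (\<lambda>t. X t (fst p))"
    using cont \<omega> by (simp add: continuous_paths_def)
  ultimately have "(\<lambda>n. X (?a n) (fst p)) \<longlonglongrightarrow> X ?r (fst p)"
    by (intro continuous_on_tendsto_compose[where s="{0..}" and f="\<lambda>t. X t (fst p)"]) auto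
  then show "(\<lambda>n. case p of (\<omega>, r) \<Rightarrow> X (real (nat \<lfloor>real (Suc n) * max 0 r\<rfloor>) / real (Suc n)) \<omega>)
      \<longlonglongrightarrow> (case p of (\<omega>, r) \<Rightarrow> X (max 0 r) \<omega>)"
    by (simp only: case_prod_beta')
qed

lemma jointly_measurable_arith:
  assumes "jointly_measurable M f" "jointly_measurable M g"
  shows "jointly_measurable M (\<lambda>r \<omega>. f r \<omega> + g r \<omega>)" "jointly_measurable M (\<lambda>r \<omega>. f r \<omega> * g r \<omega>)"
  using assms by (auto simp: jointly_measurable_def case_prod_beta')

lemma jointly_measurable_compose:
  assumes "jointly_measurable M f" and [measurable]: "h \<in> borel_measurable borel"
  shows "jointly_measurable M (\<lambda>r \<omega>. h (f r \<omega>))"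
  using assms by (auto simp: jointly_measurable_def case_prod_beta')

lemma jointly_measurable_time_const:
  assumes "f \<in> borel_measurable M"
  shows "jointly_measurable M (\<lambda>r. f)"
  using assms by (auto simp: jointly_measurable_def case_prod_beta')

lemma set_lebesgue_integral_max_0:
  fixes f :: "real \<Rightarrow> real"
  assumes "0 \<le> a"
  shows "(LINT r:{a..b}|lborel. f r) = (\<integral>r. indicator {a..b} r * f (max 0 r) \<partial>lborel)"
  unfolding set_lebesgue_integral_def using assms
  by (intro Bochner_Integration.integral_cong) (auto simp: indicator_def max_def)

lemma borel_measurable_set_integral:
  assumes "jointly_measurable M f" "0 \<le> a"
  shows "(\<lambda>\<omega>. LINT r:{a..b}|lborel. f r \<omega>) \<in> borel_measurable M"
proof -
  have "(\<lambda>(\<omega>, r). indicator {a..b} r * f (max 0 r) \<omega>) \<in> borel_measurable (M \<Otimes>\<^sub>M lborel)"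
    using assms(1) unfolding jointly_measurable_def case_prod_beta' by measurable
  then show ?thesis
    unfolding set_lebesgue_integral_max_0[OF assms(2)]
    by (rule lborel.borel_measurable_lebesgue_integral)
qed

locale brownian_filtration = prob_space M for M :: "'a measure" +
  fixes F :: "real \<Rightarrow> 'a measure" and B :: "real \<Rightarrow> 'a \<Rightarrow> real"
  assumes subalgebra_F: "\<And>t. 0 \<le> t \<Longrightarrow> subalgebra M (F t)"
    and mono_F: "\<And>s t. 0 \<le> s \<Longrightarrow> s \<le> t \<Longrightarrow> sets (F s) \<subseteq> sets (F t)"
    and brownian: "brownian_motion M F B"
begin

lemma borel_measurable_F: "f \<in> borel_measurable (F t) \<Longrightarrow> 0 \<le> t \<Longrightarrow> f \<in> borel_measurable M"
  using measurable_from_subalg subalgebra_F by blast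

lemma borel_measurable_F_mono:
  assumes "f \<in> borel_measurable (F s)" "0 \<le> s" "s \<le> t"
  shows "f \<in> borel_measurable (F t)"
  using assms subalgebra_F[of s] subalgebra_F[of t] mono_F[of s t]
  by (intro measurable_from_subalg[of "F t" "F s"]) (auto simp: subalgebra_def)

lemma B_measurable: "0 \<le> t \<Longrightarrow> B t \<in> borel_measurable (F t)"
  using brownian by (auto simp: brownian_motion_def adapted_def)

text \<open>Independence is given for sigma-algebras, and the one generated by \<open>U\<close> is
  contained in \<open>F s\<close>. Later \<open>h\<close> is the identity and the square, for the
  first- and second-order Taylor terms.\<close>

lemma indep_increment:
  fixes U h :: "_ \<Rightarrow> real"
  assumes U: "U \<in> borel_measurable (F s)" and st: "0 \<le> s" "s < t" and h: "h \<in> borel_measurable borel"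
  shows "indep_var borel U borel (\<lambda>\<omega>. h (B t \<omega> - B s \<omega>))"
proof -
  let ?D = "\<lambda>\<omega>. B t \<omega> - B s \<omega>"
  have D: "?D \<in> borel_measurable M"
    using borel_measurable_F[OF B_measurable] st by auto
  have U': "U \<in> borel_measurable M" using borel_measurable_F[OF U] st by auto
  have ind: "indep_set (sets (F s)) (sets (vimage_algebra (space M) ?D borel))"
    using brownian st by (auto simp: brownian_motion_def)
  have "indep_var borel U borel ?D"
    unfolding indep_var_eq
  proof (intro conjI U' D)
    have sp: "space (F s) = space M" using subalgebra_F[of s] st by (auto simp: subalgebra_def)
    have 1: "sigma_sets (space M) {U -` A \<inter> space M |A. A \<in> sets borel} \<subseteq> sets (F s)"
      using U unfolding sp[symmetric] by (intro sets.sigma_sets_subset) (auto simp: measurable_def)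
    have 2: "sigma_sets (space M) {?D -` A \<inter> space M |A. A \<in> sets borel} = sets (vimage_algebra (space M) ?D borel)"
      by (simp add: sets_vimage_algebra)
    show "indep_set (sigma_sets (space M) {U -` A \<inter> space M |A. A \<in> sets borel})
        (sigma_sets (space M) {?D -` A \<inter> space M |A. A \<in> sets borel})"
      using ind 1 unfolding 2 indep_sets2_eq by blast
  qed
  from indep_var_compose[OF this, of id borel h borel] h show ?thesis
    by (simp add: comp_def)
qed

text \<open>Moments of a centred normal variable with standard deviation
  \<open>sqrt (t - s)\<close>. For the third absolute moment only the order
  \<open>(t - s) * sqrt (t - s)\<close> matters, since it sums to something small over a fine
  partition; the factor \<open>sqrt (2 / pi)\<close> is bounded by 1.\<close>

lemma increment_moments:
  assumes st: "0 \<le> s" "s < t"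
  shows "integrable M (\<lambda>\<omega>. (B t \<omega> - B s \<omega>) ^ k)"
    and "expectation (\<lambda>\<omega>. B t \<omega> - B s \<omega>) = 0"
    and "expectation (\<lambda>\<omega>. (B t \<omega> - B s \<omega>)\<^sup>2) = t - s"
    and "integrable M (\<lambda>\<omega>. \<bar>B t \<omega> - B s \<omega>\<bar> ^ 3)"
    and "expectation (\<lambda>\<omega>. \<bar>B t \<omega> - B s \<omega>\<bar> ^ 3) \<le> 2 * ((t - s) * sqrt (t - s))"
proof -
  let ?D = "\<lambda>\<omega>. B t \<omega> - B s \<omega>" and ?d = "normal_density 0 (sqrt (t - s))"
  have pos: "0 < sqrt (t - s)" using st by simp
  have D: "distributed M lborel ?D ?d"
    using brownian st by (auto simp: brownian_motion_def)
  have int: "(\<integral>x. ?d x * g x \<partial>lborel) = expectation (\<lambda>\<omega>. g (?D \<omega>))"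
    if [measurable]: "g \<in> borel_measurable borel" for g :: "real \<Rightarrow> real"
    by (rule distributed_integral[OF D]) auto
  have ib: "integrable lborel (\<lambda>x. ?d x * g x) \<longleftrightarrow> integrable M (\<lambda>\<omega>. g (?D \<omega>))"
    if [measurable]: "g \<in> borel_measurable borel" for g :: "real \<Rightarrow> real"
    by (rule distributed_integrable[OF D]) auto
  show "integrable M (\<lambda>\<omega>. (?D \<omega>) ^ k)"
    using ib[of "\<lambda>x. x ^ k"] integrable_normal_moment[OF pos, of 0 k] by simp
  show "expectation ?D = 0"
    using int[of "\<lambda>x. x"] integral_normal_moment_odd[OF pos, of 0 0] by simp
  show "expectation (\<lambda>\<omega>. (?D \<omega>)\<^sup>2) = t - s"
    using int[of "\<lambda>x. x ^ 2"] integral_normal_moment_even[OF pos, of 0 1] st by (simp add: fact_numeral)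
  have 3: "has_bochner_integral lborel (\<lambda>x. ?d x * \<bar>x\<bar> ^ 3) (2 * sqrt (t - s) ^ 3 * sqrt (2 / pi))"
    using normal_moment_abs_odd[OF pos, of 0 1] by (simp add: numeral_3_eq_3)
  show "integrable M (\<lambda>\<omega>. \<bar>?D \<omega>\<bar> ^ 3)"
    using ib[of "\<lambda>x. \<bar>x\<bar> ^ 3"] 3 by (auto simp: has_bochner_integral_iff)
  have "expectation (\<lambda>\<omega>. \<bar>?D \<omega>\<bar> ^ 3) = 2 * sqrt (t - s) ^ 3 * sqrt (2 / pi)"
    using int[of "\<lambda>x. \<bar>x\<bar> ^ 3"] 3 by (auto simp: has_bochner_integral_iff)
  also have "\<dots> \<le> 2 * sqrt (t - s) ^ 3 * 1"
    using st pi_gt3 by (intro mult_left_mono) auto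
  also have "\<dots> = 2 * ((t - s) * sqrt (t - s))"
    using st by (simp add: power3_eq_cube)
  finally show "expectation (\<lambda>\<omega>. \<bar>?D \<omega>\<bar> ^ 3) \<le> 2 * ((t - s) * sqrt (t - s))" .
qed

end

lemma integral_diff_diff:
  fixes f g q :: "'a \<Rightarrow> real"
  assumes "integrable M f" "integrable M g" "integrable M q"
  shows "(\<integral>\<omega>. f \<omega> - g \<omega> - q \<omega> * c / d \<partial>M) = integral\<^sup>L M f - integral\<^sup>L M g - integral\<^sup>L M q * c / d"
  using assms by simp

lemma integral_diff_diff_diff:
  fixes f g q :: "'a \<Rightarrow> real"
  assumes "integrable M f" "integrable M g" "integrable M h" "integrable M q"
  shows "(\<integral>\<omega>. f \<omega> - g \<omega> - h \<omega> - q \<omega> / d \<partial>M)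
    = integral\<^sup>L M f - integral\<^sup>L M g - integral\<^sup>L M h - integral\<^sup>L M q / d"
  using assms by simp

locale brownian_test = brownian_filtration M F B + test_function \<phi> \<phi>1 \<phi>2 C
  for M :: "'a measure" and F B \<phi> \<phi>1 \<phi>2 C
begin

lemma integrable_phi:
  assumes "U \<in> borel_measurable M"
  shows "integrable M (\<lambda>\<omega>. \<phi> (U \<omega>))" "integrable M (\<lambda>\<omega>. \<phi>1 (U \<omega>))" "integrable M (\<lambda>\<omega>. \<phi>2 (U \<omega>))"
  using assms bound_phi bound_phi1 bound_phi2 by (auto intro!: integrable_const_bound[where B=C])

text \<open>Since \<open>U\<close> and \<open>\<xi>\<close> are known at time \<open>s\<close>, they
  are independent of the increment: the linear Taylor term has mean zero, and the squared increment
  may be replaced by \<open>t - s\<close>. What remains is the cubic remainder of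
  \<open>taylor2\<close>.\<close>

lemma gaussian_step:
  assumes U: "U \<in> borel_measurable (F s)" and \<xi>: "\<xi> \<in> borel_measurable (F s)"
    and K: "\<And>\<omega>. \<omega> \<in> space M \<Longrightarrow> \<bar>\<xi> \<omega>\<bar> \<le> K" and st: "0 \<le> s" "s \<le> t"
  shows "\<bar>expectation (\<lambda>\<omega>. \<phi> (U \<omega> + \<xi> \<omega> * (B t \<omega> - B s \<omega>)) - \<phi> (U \<omega>) - \<phi>2 (U \<omega>) * (\<xi> \<omega>)\<^sup>2 * (t - s) / 2)\<bar>
    \<le> 2 * C * K ^ 3 * ((t - s) * sqrt (t - s))"
proof (cases "s = t")
  case False
  with st have st': "0 \<le> s" "s < t" by auto
  let ?D = "\<lambda>\<omega>. B t \<omega> - B s \<omega>"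
  note [measurable] = borel_measurable_F[OF U st(1)] borel_measurable_F[OF \<xi> st(1)]
    borel_measurable_F[OF B_measurable, OF st(1) st(1)]
  have [measurable]: "B t \<in> borel_measurable M" using borel_measurable_F[OF B_measurable] st by auto
  obtain \<omega>0 where "\<omega>0 \<in> space M" using not_empty by blast
  then have K0: "0 \<le> K" using K[of \<omega>0] by linarith
  have \<xi>2: "(\<xi> \<omega>)\<^sup>2 \<le> K\<^sup>2" if "\<omega> \<in> space M" for \<omega>
    using power_mono[OF K[OF that], of 2] by simp
  have i1: "integrable M (\<lambda>\<omega>. \<phi>1 (U \<omega>) * \<xi> \<omega>)"
    using bound_phi1 K C_nonneg by (intro integrable_const_bound[where B="C * K"]) (auto simp: abs_mult intro!: mult_mono)
  have i2: "integrable M (\<lambda>\<omega>. \<phi>2 (U \<omega>) * (\<xi> \<omega>)\<^sup>2)"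
    using bound_phi2 \<xi>2 C_nonneg by (intro integrable_const_bound[where B="C * K\<^sup>2"]) (auto simp: abs_mult intro!: mult_mono)
  have v1: "indep_var borel (\<lambda>\<omega>. \<phi>1 (U \<omega>) * \<xi> \<omega>) borel ?D"
    using U \<xi> by (intro indep_increment[where h="\<lambda>x. x"] st') auto
  have v2: "indep_var borel (\<lambda>\<omega>. \<phi>2 (U \<omega>) * (\<xi> \<omega>)\<^sup>2) borel (\<lambda>\<omega>. (?D \<omega>)\<^sup>2)"
    using U \<xi> by (intro indep_increment[where h="\<lambda>x. x\<^sup>2"] st') auto
  have D1: "integrable M ?D" using increment_moments(1)[OF st', of 1] by simp
  note D2 = increment_moments(1)[OF st', of 2]
  have e1: "integrable M (\<lambda>\<omega>. \<phi>1 (U \<omega>) * \<xi> \<omega> * ?D \<omega>)" "expectation (\<lambda>\<omega>. \<phi>1 (U \<omega>) * \<xi> \<omega> * ?D \<omega>) = 0"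
    using indep_var_integrable[OF v1 i1 D1] indep_var_lebesgue_integral[OF v1 i1 D1] increment_moments(2)[OF st'] by auto
  have e2: "integrable M (\<lambda>\<omega>. \<phi>2 (U \<omega>) * (\<xi> \<omega>)\<^sup>2 * (?D \<omega>)\<^sup>2)"
      "expectation (\<lambda>\<omega>. \<phi>2 (U \<omega>) * (\<xi> \<omega>)\<^sup>2 * (?D \<omega>)\<^sup>2) = expectation (\<lambda>\<omega>. \<phi>2 (U \<omega>) * (\<xi> \<omega>)\<^sup>2) * (t - s)"
    using indep_var_integrable[OF v2 i2 D2] indep_var_lebesgue_integral[OF v2 i2 D2] increment_moments(3)[OF st'] by auto
  let ?R = "\<lambda>\<omega>. \<phi> (U \<omega> + \<xi> \<omega> * ?D \<omega>) - \<phi> (U \<omega>) - \<phi>1 (U \<omega>) * \<xi> \<omega> * ?D \<omega> - \<phi>2 (U \<omega>) * (\<xi> \<omega>)\<^sup>2 * (?D \<omega>)\<^sup>2 / 2"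
  have i\<phi>: "integrable M (\<lambda>\<omega>. \<phi> (U \<omega> + \<xi> \<omega> * ?D \<omega>))" "integrable M (\<lambda>\<omega>. \<phi> (U \<omega>))"
    by (auto intro!: integrable_phi)
  have R: "integrable M ?R"
    by (intro Bochner_Integration.integrable_diff i\<phi> e1(1) integrable_divide e2(1))
  \<comment> \<open>Subtracting the mean-zero linear term and trading \<open>t - s\<close> for the
    squared increment turns the integrand into the Taylor remainder \<open>?R\<close>.\<close>
  have "expectation (\<lambda>\<omega>. \<phi> (U \<omega> + \<xi> \<omega> * ?D \<omega>) - \<phi> (U \<omega>) - \<phi>2 (U \<omega>) * (\<xi> \<omega>)\<^sup>2 * (t - s) / 2)
      = expectation (\<lambda>\<omega>. \<phi> (U \<omega> + \<xi> \<omega> * ?D \<omega>)) - expectation (\<lambda>\<omega>. \<phi> (U \<omega>))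
        - expectation (\<lambda>\<omega>. \<phi>2 (U \<omega>) * (\<xi> \<omega>)\<^sup>2) * (t - s) / 2"
    by (rule integral_diff_diff[OF i\<phi> i2])
  also have "\<dots> = expectation (\<lambda>\<omega>. \<phi> (U \<omega> + \<xi> \<omega> * ?D \<omega>)) - expectation (\<lambda>\<omega>. \<phi> (U \<omega>))
        - expectation (\<lambda>\<omega>. \<phi>1 (U \<omega>) * \<xi> \<omega> * ?D \<omega>) - expectation (\<lambda>\<omega>. \<phi>2 (U \<omega>) * (\<xi> \<omega>)\<^sup>2 * (?D \<omega>)\<^sup>2) / 2"
    unfolding e1(2) e2(2) by (simp only: diff_zero)
  also have "\<dots> = expectation ?R"
    by (rule integral_diff_diff_diff[OF i\<phi> e1(1) e2(1), symmetric])
  finally have eq: "expectation (\<lambda>\<omega>. \<phi> (U \<omega> + \<xi> \<omega> * ?D \<omega>) - \<phi> (U \<omega>) - \<phi>2 (U \<omega>) * (\<xi> \<omega>)\<^sup>2 * (t - s) / 2)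
      = expectation ?R" .
  have "\<bar>expectation ?R\<bar> \<le> expectation (\<lambda>\<omega>. \<bar>?R \<omega>\<bar>)" by (rule integral_abs_bound)
  also have "\<dots> \<le> expectation (\<lambda>\<omega>. C * K ^ 3 * \<bar>?D \<omega>\<bar> ^ 3)"
  proof (rule integral_mono)
    show "integrable M (\<lambda>\<omega>. \<bar>?R \<omega>\<bar>)" using R by (rule integrable_abs)
    show "integrable M (\<lambda>\<omega>. C * K ^ 3 * \<bar>?D \<omega>\<bar> ^ 3)" using increment_moments(4)[OF st'] by simp
    fix \<omega> assume \<omega>: "\<omega> \<in> space M"
    have "\<bar>?R \<omega>\<bar> \<le> C * \<bar>\<xi> \<omega> * ?D \<omega>\<bar> ^ 3"
      using taylor2[of "U \<omega>" "\<xi> \<omega> * ?D \<omega>"] by (simp only: power_mult_distrib mult.assoc)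
    also have "\<dots> = C * (\<bar>\<xi> \<omega>\<bar> ^ 3 * \<bar>?D \<omega>\<bar> ^ 3)" by (simp add: abs_mult power_mult_distrib)
    also have "\<dots> \<le> C * (K ^ 3 * \<bar>?D \<omega>\<bar> ^ 3)"
      using K[OF \<omega>] C_nonneg by (intro mult_left_mono mult_right_mono power_mono) simp_all
    finally show "\<bar>?R \<omega>\<bar> \<le> C * K ^ 3 * \<bar>?D \<omega>\<bar> ^ 3" by (simp add: mult.assoc)
  qed
  also have "\<dots> = C * K ^ 3 * expectation (\<lambda>\<omega>. \<bar>?D \<omega>\<bar> ^ 3)" by simp
  also have "\<dots> \<le> C * K ^ 3 * (2 * ((t - s) * sqrt (t - s)))"
    using increment_moments(5)[OF st'] C_nonneg K0 by (intro mult_left_mono) auto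
  finally show ?thesis unfolding eq by (simp only: mult_ac)
qed simp

end

section \<open>Ito formula in expectation for elementary integrands\<close>

lemma elementary_mono:
  assumes "elementary M F n \<tau> \<xi>" "i \<le> j" "j \<le> n"
  shows "\<tau> i \<le> \<tau> j"
  using assms(2,3)
proof (induction j rule: dec_induct)
  case (step k)
  then show ?case using assms(1) by (auto simp: elementary_def intro: order_trans)
qed simp

lemma elementary_nonneg:
  assumes "elementary M F n \<tau> \<xi>" "j \<le> n"
  shows "0 \<le> \<tau> j"
  using elementary_mono[OF assms(1), of 0 j] assms by (auto simp: elementary_def)

lemma sum_single:
  fixes f :: "nat \<Rightarrow> real"
  assumes "\<And>i. i < n \<Longrightarrow> i \<noteq> j \<Longrightarrow> f i = 0"
  shows "(\<Sum>i<n. f i) = (if j < n then f j else 0)"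
proof -
  have "(\<Sum>i<n. f i) = (\<Sum>i<n. if i = j then f i else 0)"
    using assms by (intro sum.cong) auto
  then show ?thesis by simp
qed

text \<open>An index \<open>j < n\<close> says that \<open>[a,b]\<close> lies inside block
  \<open>j\<close>; an index from \<open>n\<close> on says that it lies outside all blocks and gives
  the coefficient 0. The second case serves the stretches before \<open>\<tau> 0\<close> and after
  \<open>\<tau> n\<close>.\<close>

lemma elementary_integral_increment:
  assumes e: "elementary M F n \<tau> \<xi>" and uv: "a \<le> u" "u \<le> v" "v \<le> b"
    and idle: "\<And>i. i < n \<Longrightarrow> i \<noteq> j \<Longrightarrow> \<tau> (Suc i) \<le> a \<or> b \<le> \<tau> i"
    and active: "j < n \<Longrightarrow> \<tau> j \<le> a \<and> b \<le> \<tau> (Suc j)"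
  shows "elementary_integral n \<tau> \<xi> W v \<omega> - elementary_integral n \<tau> \<xi> W u \<omega>
    = (if j < n then \<xi> j \<omega> else 0) * (W v \<omega> - W u \<omega>)"
proof -
  let ?d = "\<lambda>i. \<xi> i \<omega> * (W (min v (\<tau> (Suc i))) \<omega> - W (min v (\<tau> i)) \<omega>)
    - \<xi> i \<omega> * (W (min u (\<tau> (Suc i))) \<omega> - W (min u (\<tau> i)) \<omega>)"
  have "elementary_integral n \<tau> \<xi> W v \<omega> - elementary_integral n \<tau> \<xi> W u \<omega> = (\<Sum>i<n. ?d i)"
    by (simp add: elementary_integral_def sum_subtractf)
  also have "\<dots> = (if j < n then ?d j else 0)"
  proof (rule sum_single)
    fix i assume i: "i < n" "i \<noteq> j"
    have m: "\<tau> i \<le> \<tau> (Suc i)" using e i by (auto simp: elementary_def)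
    from idle[OF i] show "?d i = 0"
    proof
      assume "\<tau> (Suc i) \<le> a"
      then have "min v (\<tau> (Suc i)) = \<tau> (Suc i)" "min v (\<tau> i) = \<tau> i" "min u (\<tau> (Suc i)) = \<tau> (Suc i)" "min u (\<tau> i) = \<tau> i"
        using m uv by auto
      then show ?thesis by simp
    next
      assume "b \<le> \<tau> i"
      then have "min v (\<tau> (Suc i)) = v" "min v (\<tau> i) = v" "min u (\<tau> (Suc i)) = u" "min u (\<tau> i) = u"
        using m uv by auto
      then show ?thesis by simp
    qed
  qed
  also have "\<dots> = (if j < n then \<xi> j \<omega> else 0) * (W v \<omega> - W u \<omega>)"
  proof (cases "j < n")
    case True
    then have "min v (\<tau> (Suc j)) = v" "min v (\<tau> j) = \<tau> j" "min u (\<tau> (Suc j)) = u" "min u (\<tau> j) = \<tau> j"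
      using active uv by auto
    then show ?thesis using True by (simp add: right_diff_distrib)
  qed simp
  finally show ?thesis .
qed

text \<open>Blocks are open on the left, so the point \<open>a\<close> may still belong to the
  preceding block; hence \<open>a < r\<close>. Under an integral this point is null.\<close>

lemma elementary_value_eq:
  assumes e: "elementary M F n \<tau> \<xi>" and r: "a < r" "r \<le> b"
    and idle: "\<And>i. i < n \<Longrightarrow> i \<noteq> j \<Longrightarrow> \<tau> (Suc i) \<le> a \<or> b \<le> \<tau> i"
    and active: "j < n \<Longrightarrow> \<tau> j \<le> a \<and> b \<le> \<tau> (Suc j)"
  shows "elementary_value n \<tau> \<xi> r \<omega> = (if j < n then \<xi> j \<omega> else 0)"
proof -
  have "elementary_value n \<tau> \<xi> r \<omega> = (if j < n then \<xi> j \<omega> * indicator {\<tau> j<..\<tau> (Suc j)} r else 0)"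
    unfolding elementary_value_def using idle r by (intro sum_single) (fastforce simp: indicator_def)
  then show ?thesis using active r by auto
qed

lemma elementary_value_measurable:
  assumes "\<And>i. i < n \<Longrightarrow> \<xi> i \<in> borel_measurable M"
  shows "jointly_measurable M (elementary_value n \<tau> \<xi>)"
proof -
  have "(\<lambda>p. \<Sum>i<n. \<xi> i (fst p) * indicator {\<tau> i<..\<tau> (Suc i)} (max 0 (snd p)))
     \<in> borel_measurable (M \<Otimes>\<^sub>M (lborel::real measure))"
  proof (intro borel_measurable_sum borel_measurable_times)
    fix i assume "i \<in> {..<n}"
    with assms show "(\<lambda>p. \<xi> i (fst p)) \<in> borel_measurable (M \<Otimes>\<^sub>M (lborel::real measure))"
      by (intro measurable_compose[OF measurable_fst]) auto
  qed measurable
  then show ?thesis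
    by (simp add: jointly_measurable_def elementary_value_def case_prod_beta')
qed

lemma elementary_value_bounded:
  assumes "elementary M F n \<tau> \<xi>"
  obtains K where "0 \<le> K" "\<And>r \<omega>. \<omega> \<in> space M \<Longrightarrow> \<bar>elementary_value n \<tau> \<xi> r \<omega>\<bar> \<le> K"
proof -
  have "\<exists>c. \<forall>i<n. \<forall>\<omega>\<in>space M. \<bar>\<xi> i \<omega>\<bar> \<le> c i"
    using assms unfolding elementary_def by metis
  then obtain c where c: "\<And>i \<omega>. i < n \<Longrightarrow> \<omega> \<in> space M \<Longrightarrow> \<bar>\<xi> i \<omega>\<bar> \<le> c i" by blast
  have "\<bar>elementary_value n \<tau> \<xi> r \<omega>\<bar> \<le> (\<Sum>i<n. \<bar>c i\<bar>)" if "\<omega> \<in> space M" for r \<omega>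
  proof -
    have "\<bar>elementary_value n \<tau> \<xi> r \<omega>\<bar> \<le> (\<Sum>i<n. \<bar>\<xi> i \<omega> * indicator {\<tau> i<..\<tau> (Suc i)} r\<bar>)"
      unfolding elementary_value_def by (rule sum_abs)
    also have "\<dots> \<le> (\<Sum>i<n. \<bar>c i\<bar>)"
    proof (rule sum_mono)
      fix i assume "i \<in> {..<n}"
      then have "\<bar>\<xi> i \<omega>\<bar> \<le> \<bar>c i\<bar>" using c[OF _ that, of i] by auto
      then show "\<bar>\<xi> i \<omega> * indicator {\<tau> i<..\<tau> (Suc i)} r\<bar> \<le> \<bar>c i\<bar>" by (auto simp: indicator_def)
    qed
    finally show ?thesis .
  qed
  then show thesis by (intro that[of "\<Sum>i<n. \<bar>c i\<bar>"]) (auto intro: sum_nonneg)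
qed

lemma jointly_measurable_section:
  assumes "jointly_measurable M f" "\<omega> \<in> space M" "0 \<le> a"
  shows "(\<lambda>r. indicator {a..b} r *\<^sub>R f r \<omega>) \<in> borel_measurable lborel"
proof -
  have 1: "(\<lambda>r. (\<lambda>(\<omega>, r). f (max 0 r) \<omega>) (\<omega>, r)) \<in> borel_measurable lborel"
    using assms(1,2) unfolding jointly_measurable_def by (intro measurable_Pair2)
  have "(\<lambda>r. indicator {a..b} r *\<^sub>R f r \<omega>) = (\<lambda>r. indicator {a..b} r * (\<lambda>(\<omega>, r). f (max 0 r) \<omega>) (\<omega>, r))"
    using assms(3) by (auto simp: indicator_def max_def)
  also have "\<dots> \<in> borel_measurable lborel" using 1 by measurable
  finally show ?thesis .
qed

lemma set_integrable_dominated_section: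
  assumes "jointly_measurable M f" "\<omega> \<in> space M" "0 \<le> a" "set_integrable lborel {a..b} g"
    "\<And>r. r \<in> {a..b} \<Longrightarrow> \<bar>f r \<omega>\<bar> \<le> g r"
  shows "set_integrable lborel {a..b} (\<lambda>r. f r \<omega>)"
  unfolding set_integrable_def
proof (rule Bochner_Integration.integrable_bound)
  show "integrable lborel (\<lambda>r. indicator {a..b} r *\<^sub>R g r)"
    using assms(4) by (simp add: set_integrable_def)
  show "(\<lambda>r. indicator {a..b} r *\<^sub>R f r \<omega>) \<in> borel_measurable lborel"
    by (rule jointly_measurable_section[OF assms(1-3)])
  show "AE r in lborel. norm (indicator {a..b} r *\<^sub>R f r \<omega>) \<le> norm (indicator {a..b} r *\<^sub>R g r)"
    using assms(5) by (intro AE_I2) (fastforce simp: indicator_def)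
qed

text \<open>The drift process \<open>A\<close> is a datum, tied to its density \<open>m\<close> only
  almost surely and only through increments. It will be \<open>X - x - J\<close>, which is adapted
  and continuous because \<open>X\<close> and \<open>J\<close> are; adaptedness of the time integral
  of \<open>m\<close> then never has to be proved.\<close>

locale drift_test = brownian_test M F B \<phi> \<phi>1 \<phi>2 C
  for M :: "'a measure" and F B \<phi> \<phi>1 \<phi>2 C +
  fixes A m :: "real \<Rightarrow> 'a \<Rightarrow> real" and T :: real
  assumes T_nonneg: "0 \<le> T"
    and A_adapted: "\<And>t. 0 \<le> t \<Longrightarrow> A t \<in> borel_measurable (F t)"
    and A_continuous: "continuous_paths M A"
    and m_measurable: "jointly_measurable M m"
    and m_integrable: "AE \<omega> in M. set_integrable lborel {0..T} (\<lambda>r. m r \<omega>)"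
    and A_eq: "AE \<omega> in M. \<forall>u v. 0 \<le> u \<longrightarrow> u \<le> v \<longrightarrow> v \<le> T \<longrightarrow>
      A v \<omega> - A u \<omega> = (LINT r:{u..v}|lborel. m r \<omega>)"
    and m_expectation: "integrable M (\<lambda>\<omega>. LINT r:{0..T}|lborel. \<bar>m r \<omega>\<bar>)"
begin

text \<open>The drift of \<open>\<phi> (Z)\<close> in Ito's formula, for \<open>Z\<close> with drift
  density \<open>m\<close> and diffusion coefficient \<open>H\<close>. The locale fixes
  \<open>m\<close>, whereas \<open>H\<close> varies because it is approximated.\<close>

definition generator :: "(real \<Rightarrow> 'a \<Rightarrow> real) \<Rightarrow> (real \<Rightarrow> 'a \<Rightarrow> real) \<Rightarrow> real \<Rightarrow> 'a \<Rightarrow> real" where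
  "generator Z H r \<omega> = \<phi>1 (Z r \<omega>) * m r \<omega> + \<phi>2 (Z r \<omega>) * (H r \<omega>)\<^sup>2 / 2"

lemma jointly_measurable_generator:
  assumes "jointly_measurable M Z" "jointly_measurable M H"
  shows "jointly_measurable M (generator Z H)"
proof -
  note 1 = jointly_measurable_arith(2)[OF jointly_measurable_compose[OF assms(1) measurable_phi(2)] m_measurable]
  note 2 = jointly_measurable_arith(2)[OF jointly_measurable_compose[OF assms(1) measurable_phi(3)]
      jointly_measurable_compose[OF assms(2), of "\<lambda>x. x\<^sup>2 / 2"]]
  have "generator Z H = (\<lambda>r \<omega>. \<phi>1 (Z r \<omega>) * m r \<omega> + \<phi>2 (Z r \<omega>) * ((H r \<omega>)\<^sup>2 / 2))"
    by (intro ext) (simp add: generator_def)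
  then show ?thesis using jointly_measurable_arith(1)[OF 1 2] by simp
qed

lemma abs_m_subinterval:
  assumes "set_integrable lborel {0..T} (\<lambda>r. m r \<omega>)" "0 \<le> a" "b \<le> T"
  shows "(LINT r:{a..b}|lborel. \<bar>m r \<omega>\<bar>) \<le> (LINT r:{0..T}|lborel. \<bar>m r \<omega>\<bar>)"
proof -
  have "set_integrable lborel {0..T} (\<lambda>r. \<bar>m r \<omega>\<bar>)" using assms(1) by (rule set_integrable_abs)
  then show ?thesis
    unfolding set_integrable_def set_lebesgue_integral_def real_scaleR_def using assms(2,3)
    by (intro integral_mono' mult_right_mono) (auto simp: indicator_def)
qed

lemma generator_integrable:
  assumes H: "jointly_measurable M H" and Z: "jointly_measurable M Z"
    and K: "\<And>r \<omega>. \<omega> \<in> space M \<Longrightarrow> \<bar>H r \<omega>\<bar> \<le> K"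
  shows "AE \<omega> in M. set_integrable lborel {0..T} (\<lambda>r. generator Z H r \<omega>)"
    and "0 \<le> a \<Longrightarrow> b \<le> T \<Longrightarrow> integrable M (\<lambda>\<omega>. LINT r:{a..b}|lborel. generator Z H r \<omega>)"
proof -
  note jm = jointly_measurable_generator[OF Z H]
  have bound: "\<bar>generator Z H r \<omega>\<bar> \<le> C * \<bar>m r \<omega>\<bar> + C * K\<^sup>2 / 2" if "\<omega> \<in> space M" for r \<omega>
  proof -
    have "\<bar>generator Z H r \<omega>\<bar> \<le> \<bar>\<phi>1 (Z r \<omega>)\<bar> * \<bar>m r \<omega>\<bar> + \<bar>\<phi>2 (Z r \<omega>)\<bar> * (H r \<omega>)\<^sup>2 / 2"
      unfolding generator_def by (rule order_trans[OF abs_triangle_ineq]) (simp add: abs_mult)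
    also have "\<dots> \<le> C * \<bar>m r \<omega>\<bar> + C * K\<^sup>2 / 2"
      using power_mono[OF K[OF that, of r], of 2] bound_phi1 bound_phi2 C_nonneg
      by (intro add_mono divide_right_mono mult_mono) auto
    finally show ?thesis .
  qed
  have dom: "set_integrable lborel {a..b} (\<lambda>r. C * \<bar>m r \<omega>\<bar> + C * K\<^sup>2 / 2)"
    if "set_integrable lborel {0..T} (\<lambda>r. m r \<omega>)" "0 \<le> a" "b \<le> T" for a b \<omega>
  proof (rule set_integral_add(1))
    show "set_integrable lborel {a..b} (\<lambda>r. C * \<bar>m r \<omega>\<bar>)"
      using set_integrable_subset[OF set_integrable_abs[OF that(1)], of "{a..b}"] that by simp
  qed (auto intro!: borel_integrable_atLeastAtMost')
  have int: "set_integrable lborel {a..b} (\<lambda>r. generator Z H r \<omega>)"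
    if "set_integrable lborel {0..T} (\<lambda>r. m r \<omega>)" "\<omega> \<in> space M" "0 \<le> a" "b \<le> T" for a b \<omega>
    by (rule set_integrable_dominated_section[OF jm that(2,3) dom[OF that(1,3,4)] bound[OF that(2)]])
  show "AE \<omega> in M. set_integrable lborel {0..T} (\<lambda>r. generator Z H r \<omega>)"
    using m_integrable AE_space by eventually_elim (rule int, auto)
  assume ab: "0 \<le> a" "b \<le> T"
  show "integrable M (\<lambda>\<omega>. LINT r:{a..b}|lborel. generator Z H r \<omega>)"
  proof (rule Bochner_Integration.integrable_bound)
    show "integrable M (\<lambda>\<omega>. C * (LINT r:{0..T}|lborel. \<bar>m r \<omega>\<bar>) + C * K\<^sup>2 / 2 * \<bar>b - a\<bar>)"
      using m_expectation by simp
    show "(\<lambda>\<omega>. LINT r:{a..b}|lborel. generator Z H r \<omega>) \<in> borel_measurable M"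
      by (rule borel_measurable_set_integral[OF jm ab(1)])
    show "AE \<omega> in M. norm (LINT r:{a..b}|lborel. generator Z H r \<omega>)
        \<le> norm (C * (LINT r:{0..T}|lborel. \<bar>m r \<omega>\<bar>) + C * K\<^sup>2 / 2 * \<bar>b - a\<bar>)"
      using m_integrable AE_space
    proof eventually_elim
      case (elim \<omega>)
      have "\<bar>LINT r:{a..b}|lborel. generator Z H r \<omega>\<bar> \<le> (LINT r:{a..b}|lborel. C * \<bar>m r \<omega>\<bar> + C * K\<^sup>2 / 2)"
        using int[OF elim ab] dom[OF elim(1) ab] bound[OF elim(2)] by (rule set_integral_abs_le)
      also have "\<dots> = C * (LINT r:{a..b}|lborel. \<bar>m r \<omega>\<bar>) + (LINT r:{a..b}|lborel. C * K\<^sup>2 / 2)"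
        using set_integrable_subset[OF set_integrable_abs[OF elim(1)], of "{a..b}"] ab
        by (subst set_integral_add(2)) (auto intro!: borel_integrable_atLeastAtMost')
      also have "(LINT r:{a..b}|lborel. C * K\<^sup>2 / 2) \<le> C * K\<^sup>2 / 2 * \<bar>b - a\<bar>"
        using C_nonneg by (auto simp: set_lebesgue_integral_def mult.commute)
      also have "C * (LINT r:{a..b}|lborel. \<bar>m r \<omega>\<bar>) \<le> C * (LINT r:{0..T}|lborel. \<bar>m r \<omega>\<bar>)"
        using abs_m_subinterval[OF elim(1) ab] C_nonneg by (rule mult_left_mono)
      finally show ?case by (simp only: real_norm_def) linarith
    qed
  qed
qed

lemma adapted_measurable:
  assumes "adapted F Z" "0 \<le> t"
  shows "Z t \<in> borel_measurable (F t)" "Z t \<in> borel_measurable M"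
  using assms borel_measurable_F by (auto simp: adapted_def)

lemma adapted_jointly_measurable:
  assumes "adapted F Z" "continuous_paths M Z"
  shows "jointly_measurable M Z"
  using assms adapted_measurable by (intro jointly_measurable_continuous_paths) auto

text \<open>With the integrand frozen at \<open>\<xi>\<close>, the limit of the expectations of one
  and the same grid sum is found twice: pathwise convergence with domination yields the generator
  integral, while telescoping and \<open>gaussian_step\<close> yield the difference of the
  expectations of \<open>\<phi>\<close>.\<close>

lemma ito_interval:
  assumes st: "0 \<le> s" "s \<le> t" "t \<le> T"
    and Z: "adapted F Z" "continuous_paths M Z"
    and \<xi>: "\<xi> \<in> borel_measurable (F s)" and K: "\<And>\<omega>. \<omega> \<in> space M \<Longrightarrow> \<bar>\<xi> \<omega>\<bar> \<le> K"
    and inc: "\<And>\<omega> u v. \<omega> \<in> space M \<Longrightarrow> s \<le> u \<Longrightarrow> u \<le> v \<Longrightarrow> v \<le> t \<Longrightarrow>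
      Z v \<omega> - Z u \<omega> = \<xi> \<omega> * (B v \<omega> - B u \<omega>) + (A v \<omega> - A u \<omega>)"
  shows "expectation (\<lambda>\<omega>. \<phi> (Z t \<omega>)) - expectation (\<lambda>\<omega>. \<phi> (Z s \<omega>))
    = expectation (\<lambda>\<omega>. LINT r:{s..t}|lborel. generator Z (\<lambda>r. \<xi>) r \<omega>)"
proof -
  define p where "p n i = s + (t - s) * real i / real (Suc n)" for n i
  have p0: "p n 0 = s" for n by (simp add: p_def)
  have pn: "p n (Suc n) = t" for n
    unfolding p_def using nonzero_mult_div_cancel_right[of "real (Suc n)" "t - s"] by linarith
  have step: "p n (Suc i) - p n i = (t - s) / real (Suc n)" for n i
  proof -
    have "(t - s) * real (Suc i) - (t - s) * real i = t - s" by (simp add: algebra_simps)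
    then show ?thesis unfolding p_def by (simp only: add_diff_cancel_left flip: diff_divide_distrib)
  qed
  have mono: "p n i \<le> p n (Suc i)" for n i
  proof -
    have "0 \<le> (t - s) / real (Suc n)" using st by simp
    then show ?thesis using step[of n i] by linarith
  qed
  have sp: "s \<le> p n i" for n i using lift_Suc_mono_le[of "p n" 0 i] mono p0 by auto
  have pt: "p n i \<le> t" if "i \<le> Suc n" for n i
    using lift_Suc_mono_le[of "p n" i "Suc n"] mono pn that by auto
  have p_pos: "0 \<le> p n i" for n i using sp[of n i] st by linarith
  note Zm = adapted_measurable[OF Z(1)]
  note ZF = Zm(1)[OF p_pos]
  note [measurable] = Zm(2)[OF p_pos] borel_measurable_F[OF \<xi> st(1)]
    borel_measurable_F[OF B_measurable, OF p_pos p_pos]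
  have \<xi>F: "\<xi> \<in> borel_measurable (F (p n i))" for n i
    by (rule borel_measurable_F_mono[OF \<xi> st(1) sp])
  have \<xi>2: "(\<xi> \<omega>)\<^sup>2 \<le> K\<^sup>2" if "\<omega> \<in> space M" for \<omega>
    using power_mono[OF K[OF that], of 2] by simp
  define S where "S n i \<omega> = \<phi> (Z (p n (Suc i)) \<omega>) - \<phi> (Z (p n i) \<omega> + \<xi> \<omega> * (B (p n (Suc i)) \<omega> - B (p n i) \<omega>))
    + \<phi>2 (Z (p n i) \<omega>) * (\<xi> \<omega>)\<^sup>2 * (p n (Suc i) - p n i) / 2" for n i \<omega>
  have S_meas [measurable]: "S n i \<in> borel_measurable M" for n i
    unfolding S_def[abs_def] by measurable
  let ?gen = "\<lambda>r \<omega>. generator Z (\<lambda>r. \<xi>) r \<omega>"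
  \<comment> \<open>Dominating function independent of the grid: the drift part is bounded by the
    Lipschitz property of \<open>\<phi>\<close>, the other part by \<open>|\<phi>2| \<le> C\<close>
    and \<open>|\<xi>| \<le> K\<close>.\<close>
  let ?Q = "\<lambda>\<omega>. C * (LINT r:{0..T}|lborel. \<bar>m r \<omega>\<bar>) + C * K\<^sup>2 * (t - s) / 2"
  have int: "AE \<omega> in M. set_integrable lborel {s..t} (\<lambda>r. m r \<omega>)"
    using m_integrable by eventually_elim (rule set_integrable_subset, use st in auto)
  have bound: "AE \<omega> in M. norm (\<Sum>i<Suc n. S n i \<omega>) \<le> ?Q \<omega>" for n
    using m_integrable int A_eq AE_space
  proof eventually_elim
    case (elim \<omega>)
    have "norm (\<Sum>i<Suc n. S n i \<omega>) \<le> (\<Sum>i<Suc n. \<bar>S n i \<omega>\<bar>)" unfolding real_norm_def by (rule sum_abs)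
    also have "\<dots> \<le> (\<Sum>i<Suc n. C * (LINT r:{p n i..p n (Suc i)}|lborel. \<bar>m r \<omega>\<bar>) + C * K\<^sup>2 / 2 * (p n (Suc i) - p n i))"
    proof (rule sum_mono)
      fix i assume i: "i \<in> {..<Suc n}"
      have pi: "p n (Suc i) \<le> t" using pt[of "Suc i" n] i by auto
      have d: "A (p n (Suc i)) \<omega> - A (p n i) \<omega> = (LINT r:{p n i..p n (Suc i)}|lborel. m r \<omega>)"
        using elim(3) p_pos mono pi st(3) by (meson order_trans)
      have si: "set_integrable lborel {p n i..p n (Suc i)} (\<lambda>r. m r \<omega>)"
        by (rule set_integrable_subset[OF elim(2)]) (use sp[of n i] pi in auto)
      have dd: "\<bar>A (p n (Suc i)) \<omega> - A (p n i) \<omega>\<bar> \<le> (LINT r:{p n i..p n (Suc i)}|lborel. \<bar>m r \<omega>\<bar>)"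
        unfolding d using set_integral_norm_bound[OF si] by simp
      have "\<bar>\<phi> (Z (p n (Suc i)) \<omega>) - \<phi> (Z (p n i) \<omega> + \<xi> \<omega> * (B (p n (Suc i)) \<omega> - B (p n i) \<omega>))\<bar>
          \<le> C * \<bar>A (p n (Suc i)) \<omega> - A (p n i) \<omega>\<bar>"
      proof -
        have "Z (p n (Suc i)) \<omega> - (Z (p n i) \<omega> + \<xi> \<omega> * (B (p n (Suc i)) \<omega> - B (p n i) \<omega>))
            = A (p n (Suc i)) \<omega> - A (p n i) \<omega>"
          using inc[OF elim(4) sp mono pi] by linarith
        then show ?thesis
          using lipschitz_phi[of "Z (p n (Suc i)) \<omega>" "Z (p n i) \<omega> + \<xi> \<omega> * (B (p n (Suc i)) \<omega> - B (p n i) \<omega>)"]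
          by (simp only:)
      qed
      also have "\<dots> \<le> C * (LINT r:{p n i..p n (Suc i)}|lborel. \<bar>m r \<omega>\<bar>)"
        by (rule mult_left_mono[OF dd C_nonneg])
      finally have 1: "\<bar>\<phi> (Z (p n (Suc i)) \<omega>) - \<phi> (Z (p n i) \<omega> + \<xi> \<omega> * (B (p n (Suc i)) \<omega> - B (p n i) \<omega>))\<bar>
          \<le> C * (LINT r:{p n i..p n (Suc i)}|lborel. \<bar>m r \<omega>\<bar>)" .
      have "\<bar>\<phi>2 (Z (p n i) \<omega>) * (\<xi> \<omega>)\<^sup>2\<bar> \<le> C * K\<^sup>2"
        using bound_phi2 \<xi>2[OF elim(4)] C_nonneg by (auto simp: abs_mult intro!: mult_mono)
      then have 2: "\<bar>\<phi>2 (Z (p n i) \<omega>) * (\<xi> \<omega>)\<^sup>2 * (p n (Suc i) - p n i) / 2\<bar> \<le> C * K\<^sup>2 / 2 * (p n (Suc i) - p n i)"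
        using mult_right_mono[of _ _ "p n (Suc i) - p n i"] mono[of n i] by (simp add: abs_mult)
      show "\<bar>S n i \<omega>\<bar> \<le> C * (LINT r:{p n i..p n (Suc i)}|lborel. \<bar>m r \<omega>\<bar>) + C * K\<^sup>2 / 2 * (p n (Suc i) - p n i)"
        unfolding S_def by (rule order_trans[OF abs_triangle_ineq add_mono[OF 1 2]])
    qed
    also have "\<dots> = C * (\<Sum>i<Suc n. LINT r:{p n i..p n (Suc i)}|lborel. \<bar>m r \<omega>\<bar>) + C * K\<^sup>2 / 2 * (\<Sum>i<Suc n. p n (Suc i) - p n i)"
      by (simp only: sum.distrib sum_distrib_left)
    also have "(\<Sum>i<Suc n. p n (Suc i) - p n i) = t - s"
      unfolding sum_lessThan_telescope p0 pn by simp
    also have "(\<Sum>i<Suc n. LINT r:{p n i..p n (Suc i)}|lborel. \<bar>m r \<omega>\<bar>) = (LINT r:{s..t}|lborel. \<bar>m r \<omega>\<bar>)"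
      using sum_set_lebesgue_integral_grid[of "p n" "Suc n" "\<lambda>r. \<bar>m r \<omega>\<bar>"] set_integrable_abs[OF elim(2)] mono
      unfolding p0 pn by simp
    also have "C * (LINT r:{s..t}|lborel. \<bar>m r \<omega>\<bar>) \<le> C * (LINT r:{0..T}|lborel. \<bar>m r \<omega>\<bar>)"
      by (rule mult_left_mono[OF abs_m_subinterval[OF elim(1) st(1,3)] C_nonneg])
    finally show ?case by simp
  qed
  have lim: "(\<lambda>n. expectation (\<lambda>\<omega>. \<Sum>i<Suc n. S n i \<omega>)) \<longlonglongrightarrow> expectation (\<lambda>\<omega>. LINT r:{s..t}|lborel. ?gen r \<omega>)"
  proof (rule integral_dominated_convergence)
    show "(\<lambda>\<omega>. LINT r:{s..t}|lborel. ?gen r \<omega>) \<in> borel_measurable M"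
      by (intro borel_measurable_set_integral[OF _ st(1)] jointly_measurable_generator
          adapted_jointly_measurable[OF Z] jointly_measurable_time_const borel_measurable_F[OF \<xi> st(1)])
    show "(\<lambda>\<omega>. \<Sum>i<Suc n. S n i \<omega>) \<in> borel_measurable M" for n by measurable
    show "integrable M ?Q" using m_expectation by simp
    show "AE \<omega> in M. (\<lambda>n. \<Sum>i<Suc n. S n i \<omega>) \<longlonglongrightarrow> (LINT r:{s..t}|lborel. ?gen r \<omega>)"
      using int A_eq AE_space
    proof eventually_elim
      case (elim \<omega>)
      have c: "continuous_on {s..t} (\<lambda>r. Z r \<omega>)" "continuous_on {s..t} (\<lambda>r. A r \<omega>)"
        using Z(2) A_continuous elim(3) st(1) unfolding continuous_paths_def
        by (auto elim!: continuous_on_subset)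
      show ?case
        unfolding S_def p_def generator_def
      proof (rule path_sum_tendsto[OF st(2) c inc[OF elim(3)] _ elim(1)])
        fix u v assume "s \<le> u" "u \<le> v" "v \<le> t"
        then show "A v \<omega> - A u \<omega> = (LINT r:{u..v}|lborel. m r \<omega>)"
          using elim(2) st by (meson order_trans)
      qed
    qed
    show "AE \<omega> in M. norm (\<Sum>i<Suc n. S n i \<omega>) \<le> ?Q \<omega>" for n by (rule bound)
  qed
  let ?E = "\<lambda>n i. expectation (\<lambda>\<omega>. \<phi> (Z (p n i) \<omega> + \<xi> \<omega> * (B (p n (Suc i)) \<omega> - B (p n i) \<omega>)) - \<phi> (Z (p n i) \<omega>)
      - \<phi>2 (Z (p n i) \<omega>) * (\<xi> \<omega>)\<^sup>2 * (p n (Suc i) - p n i) / 2)"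
  let ?P = "\<lambda>t. expectation (\<lambda>\<omega>. \<phi> (Z t \<omega>))"
  have i2: "integrable M (\<lambda>\<omega>. \<phi>2 (Z (p n i) \<omega>) * (\<xi> \<omega>)\<^sup>2)" for n i
    using bound_phi2 \<xi>2 C_nonneg by (intro integrable_const_bound[where B="C * K\<^sup>2"]) (auto simp: abs_mult intro!: mult_mono)
  have i1: "integrable M (\<lambda>\<omega>. \<phi> (Z (p n i) \<omega> + \<xi> \<omega> * (B (p n (Suc i)) \<omega> - B (p n i) \<omega>)))" for n i
    by (intro integrable_phi) measurable
  have i0: "integrable M (\<lambda>\<omega>. \<phi> (Z (p n i) \<omega>))" for n i by (intro integrable_phi) measurable
  have S_int: "integrable M (S n i)" for n i
    unfolding S_def[abs_def]
    by (intro Bochner_Integration.integrable_add Bochner_Integration.integrable_diff i0 i1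
        integrable_divide integrable_mult_left i2)
  \<comment> \<open>Adding and subtracting \<open>\<phi>\<close> at the left grid point leaves a
    telescoping difference and the one-step error of \<open>gaussian_step\<close>.\<close>
  have ES: "expectation (S n i) = ?P (p n (Suc i)) - ?P (p n i) - ?E n i" for n i
    unfolding S_def[abs_def] integral_diff_diff[OF i1 i0 i2]
    by (subst Bochner_Integration.integral_add)
       (auto intro!: Bochner_Integration.integrable_diff integrable_divide integrable_mult_left i0 i1 i2
         simp: Bochner_Integration.integral_diff[OF i0 i1])
  \<comment> \<open>There are \<open>Suc n\<close> steps, each with error at most
    \<open>2 * C * K ^ 3\<close> times the power 3/2 of the step length.\<close>
  let ?e = "\<lambda>n. 2 * C * K ^ 3 * ((t - s) * sqrt ((t - s) / real (Suc n)))"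
  have err: "\<bar>expectation (\<lambda>\<omega>. \<Sum>i<Suc n. S n i \<omega>) - (?P t - ?P s)\<bar> \<le> ?e n" for n
  proof -
    have "expectation (\<lambda>\<omega>. \<Sum>i<Suc n. S n i \<omega>) = (\<Sum>i<Suc n. expectation (S n i))"
      using S_int by (rule Bochner_Integration.integral_sum)
    also have "\<dots> = (\<Sum>i<Suc n. ?P (p n (Suc i)) - ?P (p n i)) - (\<Sum>i<Suc n. ?E n i)"
      unfolding ES by (rule sum_subtractf)
    also have "(\<Sum>i<Suc n. ?P (p n (Suc i)) - ?P (p n i)) = ?P t - ?P s"
      using sum_lessThan_telescope[of "\<lambda>i. ?P (p n i)" "Suc n"] unfolding p0 pn .
    finally have *: "expectation (\<lambda>\<omega>. \<Sum>i<Suc n. S n i \<omega>) - (?P t - ?P s) = - (\<Sum>i<Suc n. ?E n i)" by simp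
    have "\<bar>\<Sum>i<Suc n. ?E n i\<bar> \<le> (\<Sum>i<Suc n. \<bar>?E n i\<bar>)" by (rule sum_abs)
    also have "\<dots> \<le> (\<Sum>i<Suc n. 2 * C * K ^ 3 * ((t - s) / real (Suc n) * sqrt ((t - s) / real (Suc n))))"
      using gaussian_step[OF ZF \<xi>F K p_pos mono] unfolding step by (intro sum_mono) simp
    also have "\<dots> = ?e n" by (simp del: of_nat_Suc)
    finally show ?thesis unfolding * abs_minus_cancel .
  qed
  have e0: "?e \<longlonglongrightarrow> 2 * C * K ^ 3 * ((t - s) * sqrt 0)"
    by (intro tendsto_intros LIMSEQ_Suc lim_const_over_n)
  have "(\<lambda>n. expectation (\<lambda>\<omega>. \<Sum>i<Suc n. S n i \<omega>) - (?P t - ?P s)) \<longlonglongrightarrow> 0"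
    by (rule Lim_null_comparison[OF _ e0[simplified]]) (use err in auto)
  then have "(\<lambda>n. expectation (\<lambda>\<omega>. \<Sum>i<Suc n. S n i \<omega>)) \<longlonglongrightarrow> ?P t - ?P s"
    by (rule LIM_zero_cancel)
  then show ?thesis using lim by (rule LIMSEQ_unique)
qed

text \<open>The formula is additive over adjacent intervals. The blocks cut at \<open>T\<close>,
  together with the idle stretches before \<open>\<tau> 0\<close> and after \<open>\<tau> n\<close>,
  exhaust \<open>[0,T]\<close>, and on each of them the integrand is constant up to an endpoint, so
  \<open>ito_interval\<close> applies.\<close>

lemma ito_elementary:
  assumes e: "elementary M F n \<tau> \<xi>"
    and Z: "adapted F Z" "continuous_paths M Z"
    and inc: "\<And>\<omega> u v. \<omega> \<in> space M \<Longrightarrow> 0 \<le> u \<Longrightarrow> u \<le> v \<Longrightarrow> v \<le> T \<Longrightarrow>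
      Z v \<omega> - Z u \<omega> = elementary_integral n \<tau> \<xi> B v \<omega> - elementary_integral n \<tau> \<xi> B u \<omega> + (A v \<omega> - A u \<omega>)"
  shows "expectation (\<lambda>\<omega>. \<phi> (Z T \<omega>)) - expectation (\<lambda>\<omega>. \<phi> (Z 0 \<omega>))
    = expectation (\<lambda>\<omega>. LINT r:{0..T}|lborel. generator Z (elementary_value n \<tau> \<xi>) r \<omega>)"
proof -
  let ?H = "elementary_value n \<tau> \<xi>"
  define P where "P a b \<longleftrightarrow> expectation (\<lambda>\<omega>. \<phi> (Z b \<omega>)) - expectation (\<lambda>\<omega>. \<phi> (Z a \<omega>))
    = expectation (\<lambda>\<omega>. LINT r:{a..b}|lborel. generator Z ?H r \<omega>)" for a b
  have \<tau>0: "0 \<le> \<tau> j" if "j \<le> n" for j using elementary_nonneg[OF e that] .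
  have \<xi>F: "\<xi> i \<in> borel_measurable (F (\<tau> i))" if "i < n" for i using e that by (auto simp: elementary_def)
  have jmH: "jointly_measurable M ?H"
  proof (rule elementary_value_measurable)
    fix i assume "i < n"
    then show "\<xi> i \<in> borel_measurable M" using borel_measurable_F[OF \<xi>F[of i] \<tau>0[of i]] by simp
  qed
  have jmZ: "jointly_measurable M Z" by (rule adapted_jointly_measurable[OF Z])
  obtain K where K: "\<And>r \<omega>. \<omega> \<in> space M \<Longrightarrow> \<bar>?H r \<omega>\<bar> \<le> K" using elementary_value_bounded[OF e] by metis
  have gi: "AE \<omega> in M. set_integrable lborel {0..T} (\<lambda>r. generator Z ?H r \<omega>)"
    "\<And>a b. 0 \<le> a \<Longrightarrow> b \<le> T \<Longrightarrow> integrable M (\<lambda>\<omega>. LINT r:{a..b}|lborel. generator Z ?H r \<omega>)"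
    by (rule generator_integrable[OF jmH jmZ]; use K in blast)+
  have P_trans: "P a c" if ab: "0 \<le> a" "a \<le> b" "b \<le> c" "c \<le> T" and P: "P a b" "P b c" for a b c
  proof -
    have "AE \<omega> in M. (LINT r:{a..c}|lborel. generator Z ?H r \<omega>)
      = (LINT r:{a..b}|lborel. generator Z ?H r \<omega>) + (LINT r:{b..c}|lborel. generator Z ?H r \<omega>)"
      using gi(1)
    proof eventually_elim
      case (elim \<omega>)
      have "set_integrable lborel {a..c} (\<lambda>r. generator Z ?H r \<omega>)"
        using ab by (intro set_integrable_subset[OF elim]) auto
      then show ?case by (rule set_lebesgue_integral_split[OF _ ab(2,3)])
    qed
    then have "expectation (\<lambda>\<omega>. LINT r:{a..c}|lborel. generator Z ?H r \<omega>)
      = expectation (\<lambda>\<omega>. (LINT r:{a..b}|lborel. generator Z ?H r \<omega>) + (LINT r:{b..c}|lborel. generator Z ?H r \<omega>))"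
      using ab gi(2) by (intro integral_cong_AE) auto
    also have "\<dots> = expectation (\<lambda>\<omega>. LINT r:{a..b}|lborel. generator Z ?H r \<omega>)
        + expectation (\<lambda>\<omega>. LINT r:{b..c}|lborel. generator Z ?H r \<omega>)"
      using ab gi(2) by (intro Bochner_Integration.integral_add) auto
    finally show ?thesis using P unfolding P_def by linarith
  qed
  have P_step: "P a b" if ab: "0 \<le> a" "a \<le> b" "b \<le> T"
    and idle: "\<And>i. i < n \<Longrightarrow> i \<noteq> j \<Longrightarrow> \<tau> (Suc i) \<le> a \<or> b \<le> \<tau> i"
    and active: "j < n \<Longrightarrow> \<tau> j \<le> a \<and> b \<le> \<tau> (Suc j)" for a b j
  proof -
    let ?\<zeta> = "\<lambda>\<omega>. if j < n then \<xi> j \<omega> else 0"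
    have \<zeta>: "?\<zeta> \<in> borel_measurable (F a)"
      using \<xi>F[of j] active \<tau>0[of j] by (cases "j < n") (auto intro: borel_measurable_F_mono)
    have "\<exists>c. \<forall>\<omega>\<in>space M. \<bar>?\<zeta> \<omega>\<bar> \<le> c"
      using e unfolding elementary_def by (cases "j < n") auto
    then obtain c where c: "\<And>\<omega>. \<omega> \<in> space M \<Longrightarrow> \<bar>?\<zeta> \<omega>\<bar> \<le> c" by blast
    have "expectation (\<lambda>\<omega>. \<phi> (Z b \<omega>)) - expectation (\<lambda>\<omega>. \<phi> (Z a \<omega>))
        = expectation (\<lambda>\<omega>. LINT r:{a..b}|lborel. generator Z (\<lambda>r. ?\<zeta>) r \<omega>)"
    proof (rule ito_interval[OF ab Z \<zeta> c])
      fix \<omega> u v assume \<omega>: "\<omega> \<in> space M" and uv: "a \<le> u" "u \<le> v" "v \<le> b"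
      show "Z v \<omega> - Z u \<omega> = ?\<zeta> \<omega> * (B v \<omega> - B u \<omega>) + (A v \<omega> - A u \<omega>)"
        using inc[OF \<omega>, of u v] elementary_integral_increment[OF e uv idle active, of B \<omega>] uv ab by simp
    qed
    also have "\<dots> = expectation (\<lambda>\<omega>. LINT r:{a..b}|lborel. generator Z ?H r \<omega>)"
    proof (intro Bochner_Integration.integral_cong refl)
      fix \<omega> assume \<omega>: "\<omega> \<in> space M"
      show "(LINT r:{a..b}|lborel. generator Z (\<lambda>r. ?\<zeta>) r \<omega>) = (LINT r:{a..b}|lborel. generator Z ?H r \<omega>)"
        unfolding set_lebesgue_integral_def
      proof (rule integral_cong_AE)
        have jm\<zeta>: "jointly_measurable M (\<lambda>r. ?\<zeta>)"
          by (intro jointly_measurable_time_const borel_measurable_F[OF \<zeta> ab(1)])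
        show "(\<lambda>r. indicator {a..b} r *\<^sub>R generator Z (\<lambda>r. ?\<zeta>) r \<omega>) \<in> borel_measurable lborel"
          "(\<lambda>r. indicator {a..b} r *\<^sub>R generator Z ?H r \<omega>) \<in> borel_measurable lborel"
          using ab \<omega> by (intro jointly_measurable_section jointly_measurable_generator jmZ jmH jm\<zeta>; simp)+
        show "AE r in lborel. indicator {a..b} r *\<^sub>R generator Z (\<lambda>r. ?\<zeta>) r \<omega> = indicator {a..b} r *\<^sub>R generator Z ?H r \<omega>"
          using AE_lborel_singleton[of a]
        proof eventually_elim
          case (elim r)
          show ?case
          proof (cases "r \<in> {a..b}")
            case True
            then have r: "a < r" "r \<le> b" using elim by auto
            have "?H r \<omega> = ?\<zeta> \<omega>" by (rule elementary_value_eq[OF e r idle active])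
            then show ?thesis by (simp only: generator_def)
          qed simp
        qed
      qed
    qed
    finally show ?thesis unfolding P_def .
  qed
  \<comment> \<open>Cutting at \<open>T\<close> collapses every block that starts after
    \<open>T\<close> to the trivial interval from \<open>T\<close> to \<open>T\<close>, so the
    induction can run over all \<open>n\<close> blocks.\<close>
  let ?c = "\<lambda>j. min T (\<tau> j)"
  have P_refl: "P T T"
    by (simp add: P_def set_lebesgue_integral_point)
  have 0: "P 0 (?c 0)"
  proof (rule P_step[of _ _ n])
    fix i assume "i < n"
    then show "\<tau> (Suc i) \<le> 0 \<or> ?c 0 \<le> \<tau> i" using elementary_mono[OF e, of 0 i] by auto
  qed (use T_nonneg \<tau>0[of 0] in auto)
  have c0: "P 0 (?c j)" if "j \<le> n" for j
    using that
  proof (induction j)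
    case (Suc j)
    then have m: "\<tau> j \<le> \<tau> (Suc j)" and t0: "0 \<le> \<tau> j" using elementary_mono[OF e, of j "Suc j"] \<tau>0 by auto
    have "P (?c j) (?c (Suc j))"
    proof (cases "\<tau> j \<le> T")
      case True
      show ?thesis
      proof (rule P_step[of _ _ j])
        fix i assume i: "i < n" "i \<noteq> j"
        then show "\<tau> (Suc i) \<le> ?c j \<or> ?c (Suc j) \<le> \<tau> i"
          using elementary_mono[OF e, of "Suc i" j] elementary_mono[OF e, of "Suc j" i] True Suc.prems
          by (cases "i < j") (auto simp: min_def)
      qed (use True m t0 T_nonneg in auto)
    next
      case False
      then show ?thesis using P_refl m by (simp add: min_def)
    qed
    with Suc show ?case
      using m t0 T_nonneg by (intro P_trans[of 0 "?c j" "?c (Suc j)"]) auto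
  qed (use 0 in simp)
  have "P (?c n) T"
  proof (cases "\<tau> n \<le> T")
    case True
    show ?thesis
    proof (rule P_step[of _ _ n])
      fix i assume "i < n"
      then show "\<tau> (Suc i) \<le> ?c n \<or> T \<le> \<tau> i" using True elementary_mono[OF e, of "Suc i" n] by auto
    qed (use True \<tau>0[of n] T_nonneg in auto)
  next
    case False
    then show ?thesis using P_refl by (simp add: min_def)
  qed
  with c0[of n] have "P 0 T" using \<tau>0[of n] T_nonneg by (intro P_trans[of 0 "?c n" T]) auto
  then show ?thesis by (simp add: P_def)
qed

end

section \<open>Truncation and passage to the limit\<close>

text \<open>The squared \<open>L\<^sup>2([0,T])\<close> norm of the elementary integrand, by
  \<open>elementary_square_integral\<close>. As a finite sum over blocks it lets one read off at
  which time each partial energy is known.\<close>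

definition energy :: "real \<Rightarrow> nat \<Rightarrow> (nat \<Rightarrow> real) \<Rightarrow> (nat \<Rightarrow> 'a \<Rightarrow> real) \<Rightarrow> 'a \<Rightarrow> real" where
  "energy T n \<tau> \<xi> \<omega> = (\<Sum>i<n. (\<xi> i \<omega>)\<^sup>2 * (min T (\<tau> (Suc i)) - min T (\<tau> i)))"

text \<open>The energy up to \<open>\<tau> (Suc i)\<close> is already known at time \<open>\<tau> i\<close>, so switching an elementary
  integrand off once its energy exceeds a level keeps it elementary; no stopping time is needed.\<close>

definition truncate ::
    "real \<Rightarrow> real \<Rightarrow> (nat \<Rightarrow> real) \<Rightarrow> (nat \<Rightarrow> 'a \<Rightarrow> real) \<Rightarrow> nat \<Rightarrow> 'a \<Rightarrow> real" where
  "truncate T N \<tau> \<xi> i \<omega> = (if energy T (Suc i) \<tau> \<xi> \<omega> \<le> N then \<xi> i \<omega> else 0)"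

lemma elementary_measurable:
  "elementary M F n \<tau> \<xi> \<Longrightarrow> i < n \<Longrightarrow> \<xi> i \<in> borel_measurable (F (\<tau> i))"
  by (simp add: elementary_def)

text \<open>At most one block contains \<open>r\<close>, so the cross terms of the square
  vanish.\<close>

lemma elementary_value_square:
  assumes e: "elementary M F n \<tau> \<xi>"
  shows "(elementary_value n \<tau> \<xi> r \<omega>)\<^sup>2 = (\<Sum>i<n. (\<xi> i \<omega>)\<^sup>2 * indicator {\<tau> i<..\<tau> (Suc i)} r)"
proof (cases "\<exists>j<n. r \<in> {\<tau> j<..\<tau> (Suc j)}")
  case True
  then obtain j where j: "j < n" "r \<in> {\<tau> j<..\<tau> (Suc j)}" by blast
  have *: "r \<notin> {\<tau> i<..\<tau> (Suc i)}" if "i < n" "i \<noteq> j" for i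
    using elementary_mono[OF e, of "Suc i" j] elementary_mono[OF e, of "Suc j" i] that j
    by (cases "i < j") auto
  have "elementary_value n \<tau> \<xi> r \<omega> = \<xi> j \<omega>"
    unfolding elementary_value_def using * j by (subst sum_single[of _ j]) auto
  moreover have "(\<Sum>i<n. (\<xi> i \<omega>)\<^sup>2 * indicator {\<tau> i<..\<tau> (Suc i)} r) = (\<xi> j \<omega>)\<^sup>2"
    using * j by (subst sum_single[of _ j]) auto
  ultimately show ?thesis by simp
next
  case False
  then show ?thesis by (auto simp: elementary_value_def intro!: sum.neutral)
qed

lemma elementary_square_integral:
  assumes e: "elementary M F n \<tau> \<xi>" and T: "0 \<le> T"
  shows "set_integrable lborel {0..T} (\<lambda>r. (elementary_value n \<tau> \<xi> r \<omega>)\<^sup>2)"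
    and "(LINT r:{0..T}|lborel. (elementary_value n \<tau> \<xi> r \<omega>)\<^sup>2) = energy T n \<tau> \<xi> \<omega>"
proof -
  have *: "indicator {0..T} r * ((\<xi> i \<omega>)\<^sup>2 * indicator {\<tau> i<..\<tau> (Suc i)} r)
      = (\<xi> i \<omega>)\<^sup>2 * indicator {min T (\<tau> i)<..min T (\<tau> (Suc i))} r" if "i < n" for i r
    using elementary_nonneg[OF e, of i] that by (auto simp: indicator_def)
  have eq: "indicator {0..T} r *\<^sub>R (elementary_value n \<tau> \<xi> r \<omega>)\<^sup>2
      = (\<Sum>i<n. (\<xi> i \<omega>)\<^sup>2 * indicator {min T (\<tau> i)<..min T (\<tau> (Suc i))} r)" for r
    unfolding elementary_value_square[OF e] real_scaleR_def sum_distrib_left using * by (intro sum.cong) auto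
  have int: "integrable lborel (\<lambda>r. (\<xi> i \<omega>)\<^sup>2 * indicator {min T (\<tau> i)<..min T (\<tau> (Suc i))} r)" for i
    by (cases "min T (\<tau> i) \<le> min T (\<tau> (Suc i))") (auto intro!: integrable_mult_right integrable_real_indicator)
  show "set_integrable lborel {0..T} (\<lambda>r. (elementary_value n \<tau> \<xi> r \<omega>)\<^sup>2)"
    unfolding set_integrable_def eq using int by (rule Bochner_Integration.integrable_sum)
  have "(LINT r:{0..T}|lborel. (elementary_value n \<tau> \<xi> r \<omega>)\<^sup>2)
      = (\<Sum>i<n. \<integral>r. (\<xi> i \<omega>)\<^sup>2 * indicator {min T (\<tau> i)<..min T (\<tau> (Suc i))} r \<partial>lborel)"
    unfolding set_lebesgue_integral_def eq using int by (rule Bochner_Integration.integral_sum)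
  also have "\<dots> = energy T n \<tau> \<xi> \<omega>"
    unfolding energy_def
  proof (rule sum.cong)
    fix i assume "i \<in> {..<n}"
    then have "\<tau> i \<le> \<tau> (Suc i)" using e by (auto simp: elementary_def)
    then have "min T (\<tau> i) \<le> min T (\<tau> (Suc i))" by auto
    then show "(\<integral>r. (\<xi> i \<omega>)\<^sup>2 * indicator {min T (\<tau> i)<..min T (\<tau> (Suc i))} r \<partial>lborel)
      = (\<xi> i \<omega>)\<^sup>2 * (min T (\<tau> (Suc i)) - min T (\<tau> i))" by simp
  qed simp
  finally show "(LINT r:{0..T}|lborel. (elementary_value n \<tau> \<xi> r \<omega>)\<^sup>2) = energy T n \<tau> \<xi> \<omega>" .
qed

lemma energy_mono:
  assumes e: "elementary M F n \<tau> \<xi>" and "i \<le> j" "j \<le> n"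
  shows "energy T i \<tau> \<xi> \<omega> \<le> energy T j \<tau> \<xi> \<omega>"
  unfolding energy_def
proof (rule sum_mono2)
  fix b assume "b \<in> {..<j} - {..<i}"
  then have "min T (\<tau> b) \<le> min T (\<tau> (Suc b))"
    using e assms(3) by (intro min.mono) (auto simp: elementary_def)
  then show "0 \<le> (\<xi> b \<omega>)\<^sup>2 * (min T (\<tau> (Suc b)) - min T (\<tau> b))" by simp
qed (use assms in auto)

lemma truncate_eq:
  assumes "elementary M F n \<tau> \<xi>" "energy T n \<tau> \<xi> \<omega> \<le> N" "i < n"
  shows "truncate T N \<tau> \<xi> i \<omega> = \<xi> i \<omega>"
  using energy_mono[OF assms(1), of "Suc i" n T \<omega>] assms by (auto simp: truncate_def)

text \<open>Induction on the number of blocks. If the original energy through the last block is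
  within the level, monotonicity shows that no earlier block was switched off and the energies
  agree; otherwise the last block is switched off and adds nothing.\<close>

lemma energy_truncate_le:
  assumes e: "elementary M F n \<tau> \<xi>" and N: "0 \<le> N"
  shows "energy T n \<tau> (truncate T N \<tau> \<xi>) \<omega> \<le> N"
proof -
  have "energy T k \<tau> (truncate T N \<tau> \<xi>) \<omega> \<le> N" if "k \<le> n" for k
    using that
  proof (induction k)
    case (Suc k)
    show ?case
    proof (cases "energy T (Suc k) \<tau> \<xi> \<omega> \<le> N")
      case True
      have "truncate T N \<tau> \<xi> i \<omega> = \<xi> i \<omega>" if "i < Suc k" for i
        using energy_mono[OF e, of "Suc i" "Suc k" T \<omega>] that Suc.prems True by (auto simp: truncate_def)
      then have "energy T (Suc k) \<tau> (truncate T N \<tau> \<xi>) \<omega> = energy T (Suc k) \<tau> \<xi> \<omega>"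
        unfolding energy_def by (intro sum.cong) auto
      then show ?thesis using True by simp
    next
      case False
      then show ?thesis using Suc by (simp add: energy_def truncate_def)
    qed
  qed (simp add: energy_def N)
  then show ?thesis by simp
qed

context brownian_filtration
begin

lemma elementary_truncate:
  assumes e: "elementary M F n \<tau> \<xi>"
  shows "elementary M F n \<tau> (truncate T N \<tau> \<xi>)"
proof -
  have "truncate T N \<tau> \<xi> i \<in> borel_measurable (F (\<tau> i))" if i: "i < n" for i
  proof -
    have j: "\<xi> j \<in> borel_measurable (F (\<tau> i))" if "j \<le> i" for j
      using i that by (intro borel_measurable_F_mono[OF elementary_measurable[OF e]]
          elementary_nonneg[OF e] elementary_mono[OF e]) auto
    have [measurable]: "energy T (Suc i) \<tau> \<xi> \<in> borel_measurable (F (\<tau> i))"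
      unfolding energy_def[abs_def] using j by (intro borel_measurable_sum borel_measurable_times borel_measurable_power) auto
    have [measurable]: "\<xi> i \<in> borel_measurable (F (\<tau> i))" using j by simp
    show ?thesis unfolding truncate_def[abs_def] by measurable
  qed
  moreover have "\<exists>C. \<forall>\<omega>\<in>space M. \<bar>truncate T N \<tau> \<xi> i \<omega>\<bar> \<le> C" if "i < n" for i
  proof -
    have "\<exists>C. \<forall>\<omega>\<in>space M. \<bar>\<xi> i \<omega>\<bar> \<le> C" using e that by (simp add: elementary_def)
    then obtain C where "\<forall>\<omega>\<in>space M. \<bar>\<xi> i \<omega>\<bar> \<le> C" ..
    then have "\<forall>\<omega>\<in>space M. \<bar>truncate T N \<tau> \<xi> i \<omega>\<bar> \<le> \<bar>C\<bar>" by (fastforce simp: truncate_def)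
    then show ?thesis ..
  qed
  ultimately show ?thesis using e unfolding elementary_def by blast
qed

lemma elementary_integral_continuous:
  assumes e: "elementary M F n \<tau> \<xi>" and \<omega>: "\<omega> \<in> space M"
  shows "continuous_on {0..} (\<lambda>t. elementary_integral n \<tau> \<xi> B t \<omega>)"
proof -
  have B: "continuous_on {0..} (\<lambda>t. B t \<omega>)"
    using brownian \<omega> by (auto simp: brownian_motion_def continuous_paths_def)
  have "continuous_on {0..} (\<lambda>t. B (min t c) \<omega>)" if "0 \<le> c" for c
    using that by (intro continuous_on_compose2[OF B]) (auto intro!: continuous_intros)
  then show ?thesis
    unfolding elementary_integral_def using elementary_nonneg[OF e]
    by (intro continuous_on_sum continuous_on_mult continuous_on_diff continuous_on_const) auto
qed

lemma elementary_integral_adapted: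
  assumes e: "elementary M F n \<tau> \<xi>"
  shows "adapted F (elementary_integral n \<tau> \<xi> B)"
  unfolding adapted_def elementary_integral_def[abs_def]
proof (intro allI impI borel_measurable_sum)
  fix t :: real and i assume t: "0 \<le> t" and i: "i \<in> {..<n}"
  then have \<tau>: "0 \<le> \<tau> i" "\<tau> i \<le> \<tau> (Suc i)" using elementary_nonneg[OF e, of i] e by (auto simp: elementary_def)
  show "(\<lambda>\<omega>. \<xi> i \<omega> * (B (min t (\<tau> (Suc i))) \<omega> - B (min t (\<tau> i)) \<omega>)) \<in> borel_measurable (F t)"
  proof (cases "\<tau> i \<le> t")
    case True
    have "\<xi> i \<in> borel_measurable (F t)"
      using i by (intro borel_measurable_F_mono[OF elementary_measurable[OF e] \<tau>(1) True]) auto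
    moreover have "B (min t (\<tau> (Suc i))) \<in> borel_measurable (F t)" "B (min t (\<tau> i)) \<in> borel_measurable (F t)"
      using t \<tau> by (intro borel_measurable_F_mono[OF B_measurable]; simp)+
    ultimately show ?thesis by (intro borel_measurable_times borel_measurable_diff)
  next
    \<comment> \<open>Before the block starts both clipped times equal \<open>t\<close>, so the term
      vanishes and the not yet known \<open>\<xi> i\<close> does not enter.\<close>
    case False
    then have "min t (\<tau> (Suc i)) = t" "min t (\<tau> i) = t" using \<tau> by auto
    then show ?thesis by simp
  qed
qed

end

text \<open>The delicate term is \<open>H\<^sup>2 - G\<^sup>2\<close>, which need not be small
  pointwise. The arithmetic-geometric mean inequality with weight \<open>e\<close> bounds it by
  \<open>e * H\<^sup>2 + (1 + 1 / e) * (G - H)\<^sup>2\<close>. The integral of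
  \<open>(G - H)\<^sup>2\<close> is at most \<open>e\<^sup>2\<close>, so its share is again of order
  \<open>e\<close>, and \<open>e \<le> 1\<close> gives the constant.\<close>

lemma (in test_function) generator_difference:
  fixes X Z m H G :: "real \<Rightarrow> real"
  assumes e: "0 < e" "e \<le> 1" and close: "\<And>r. r \<in> S \<Longrightarrow> \<bar>X r - Z r\<bar> \<le> e"
    and m: "set_integrable lborel S m" and H: "set_integrable lborel S (\<lambda>r. (H r)\<^sup>2)"
    and GH: "set_integrable lborel S (\<lambda>r. (G r - H r)\<^sup>2)" and GHe: "(LINT r:S|lborel. (G r - H r)\<^sup>2) \<le> e\<^sup>2"
    and iX: "set_integrable lborel S (\<lambda>r. \<phi>1 (X r) * m r + \<phi>2 (X r) * (H r)\<^sup>2 / 2)"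
    and iZ: "set_integrable lborel S (\<lambda>r. \<phi>1 (Z r) * m r + \<phi>2 (Z r) * (G r)\<^sup>2 / 2)"
  shows "\<bar>(LINT r:S|lborel. \<phi>1 (X r) * m r + \<phi>2 (X r) * (H r)\<^sup>2 / 2)
      - (LINT r:S|lborel. \<phi>1 (Z r) * m r + \<phi>2 (Z r) * (G r)\<^sup>2 / 2)\<bar>
    \<le> C * e * (1 + (LINT r:S|lborel. \<bar>m r\<bar>) + (LINT r:S|lborel. (H r)\<^sup>2))"
proof -
  let ?I = "\<lambda>f. LINT r:S|lborel. f r"
  let ?a = "\<lambda>r. \<phi>1 (X r) * m r + \<phi>2 (X r) * (H r)\<^sup>2 / 2" and ?b = "\<lambda>r. \<phi>1 (Z r) * m r + \<phi>2 (Z r) * (G r)\<^sup>2 / 2"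
  have am: "set_integrable lborel S (\<lambda>r. \<bar>m r\<bar>)" using m by (rule set_integrable_abs)
  have "?I ?a - ?I ?b = ?I (\<lambda>r. ?a r - ?b r)" using iX iZ by (simp add: set_integral_diff)
  moreover have "\<bar>?I (\<lambda>r. ?a r - ?b r)\<bar>
      \<le> ?I (\<lambda>r. C * e * \<bar>m r\<bar> + C * e * (H r)\<^sup>2 + C / 2 * (1 + 1 / e) * (G r - H r)\<^sup>2)"
  proof (rule set_integral_abs_le)
    show "set_integrable lborel S (\<lambda>r. ?a r - ?b r)" using iX iZ by (rule set_integral_diff(1))
    show "set_integrable lborel S (\<lambda>r. C * e * \<bar>m r\<bar> + C * e * (H r)\<^sup>2 + C / 2 * (1 + 1 / e) * (G r - H r)\<^sup>2)"
      using am H GH by (intro set_integral_add(1)) auto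
    fix r assume r: "r \<in> S"
    have Ce: "C * \<bar>X r - Z r\<bar> \<le> C * e" using close[OF r] C_nonneg by (rule mult_left_mono)
    have 1: "\<bar>(\<phi>1 (X r) - \<phi>1 (Z r)) * m r\<bar> \<le> C * e * \<bar>m r\<bar>"
      unfolding abs_mult using order_trans[OF lipschitz_phi1 Ce] by (rule mult_right_mono) simp
    have 2: "\<bar>(\<phi>2 (X r) - \<phi>2 (Z r)) * (H r)\<^sup>2\<bar> \<le> C * e * (H r)\<^sup>2"
      unfolding abs_mult using order_trans[OF lipschitz_phi2 Ce] by (simp add: mult_right_mono)
    let ?d = "\<bar>G r - H r\<bar>"
    have amgm: "2 * (?d * \<bar>H r\<bar>) \<le> ?d\<^sup>2 / e + e * (H r)\<^sup>2"
    proof -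
      have "0 \<le> (?d - e * \<bar>H r\<bar>)\<^sup>2 / e" using e by simp
      also have "\<dots> = ?d\<^sup>2 / e - 2 * (?d * \<bar>H r\<bar>) + e * (H r)\<^sup>2"
        using e by (simp add: power2_diff field_simps power2_eq_square)
      finally show ?thesis by simp
    qed
    have "\<bar>(H r)\<^sup>2 - (G r)\<^sup>2\<bar> = ?d * \<bar>2 * H r + (G r - H r)\<bar>"
      unfolding abs_mult[symmetric] by (subst abs_minus_commute) (rule arg_cong[where f=abs], simp add: power2_eq_square algebra_simps)
    also have "\<dots> \<le> ?d * (2 * \<bar>H r\<bar> + ?d)" by (intro mult_left_mono) auto
    also have "\<dots> = 2 * (?d * \<bar>H r\<bar>) + ?d\<^sup>2" by (simp add: power2_eq_square algebra_simps)
    also have "\<dots> \<le> e * (H r)\<^sup>2 + (1 + 1 / e) * (G r - H r)\<^sup>2" using amgm by (simp add: algebra_simps)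
    finally have "\<bar>\<phi>2 (Z r)\<bar> * \<bar>(H r)\<^sup>2 - (G r)\<^sup>2\<bar> \<le> C * (e * (H r)\<^sup>2 + (1 + 1 / e) * (G r - H r)\<^sup>2)"
      using bound_phi2 C_nonneg by (intro mult_mono) auto
    then have 3: "\<bar>\<phi>2 (Z r) * ((H r)\<^sup>2 - (G r)\<^sup>2)\<bar> \<le> C * e * (H r)\<^sup>2 + C * (1 + 1 / e) * (G r - H r)\<^sup>2"
      unfolding abs_mult distrib_left[of C "e * (H r)\<^sup>2"] mult.assoc .
    have "?a r - ?b r = (\<phi>1 (X r) - \<phi>1 (Z r)) * m r + (\<phi>2 (X r) - \<phi>2 (Z r)) * (H r)\<^sup>2 / 2
        + \<phi>2 (Z r) * ((H r)\<^sup>2 - (G r)\<^sup>2) / 2"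
      by (simp add: left_diff_distrib right_diff_distrib diff_divide_distrib)
    then show "\<bar>?a r - ?b r\<bar> \<le> C * e * \<bar>m r\<bar> + C * e * (H r)\<^sup>2 + C / 2 * (1 + 1 / e) * (G r - H r)\<^sup>2"
      using 1 2 3 by linarith
  qed
  moreover have "?I (\<lambda>r. C * e * \<bar>m r\<bar> + C * e * (H r)\<^sup>2 + C / 2 * (1 + 1 / e) * (G r - H r)\<^sup>2)
      = C * e * ?I (\<lambda>r. \<bar>m r\<bar>) + C * e * ?I (\<lambda>r. (H r)\<^sup>2) + C / 2 * (1 + 1 / e) * ?I (\<lambda>r. (G r - H r)\<^sup>2)"
    using am H GH by (subst set_integral_add(2), simp_all)+
  moreover have "C / 2 * (1 + 1 / e) * ?I (\<lambda>r. (G r - H r)\<^sup>2) \<le> C * e"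
  proof -
    have "C / 2 * (1 + 1 / e) * ?I (\<lambda>r. (G r - H r)\<^sup>2) \<le> C / 2 * (1 + 1 / e) * e\<^sup>2"
      using GHe C_nonneg e by (intro mult_left_mono) auto
    also have "\<dots> = C / 2 * (e * e + e)" using e by (simp add: field_simps power2_eq_square)
    also have "\<dots> \<le> C / 2 * (1 * e + e)" using e C_nonneg by (intro mult_left_mono add_right_mono mult_right_mono) auto
    finally show ?thesis by simp
  qed
  ultimately show ?thesis by (simp only: distrib_left mult_1_right)
qed

text \<open>For each outcome the integrand vanishes once \<open>N\<close> exceeds \<open>Q\<close>,
  and \<open>|Q|\<close> dominates.\<close>

lemma (in prob_space) tail_expectation_tendsto_zero:
  fixes Q :: "'a \<Rightarrow> real"
  assumes "integrable M Q"
  shows "(\<lambda>N. expectation (\<lambda>\<omega>. if real N < Q \<omega> then Q \<omega> else 0)) \<longlonglongrightarrow> 0"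
proof -
  have [measurable]: "Q \<in> borel_measurable M" using assms by simp
  have "(\<lambda>N. expectation (\<lambda>\<omega>. if real N < Q \<omega> then Q \<omega> else 0)) \<longlonglongrightarrow> expectation (\<lambda>\<omega>. 0)"
  proof (rule integral_dominated_convergence[where w="\<lambda>\<omega>. \<bar>Q \<omega>\<bar>"])
    show "AE \<omega> in M. (\<lambda>N. if real N < Q \<omega> then Q \<omega> else 0) \<longlonglongrightarrow> 0"
    proof (intro AE_I2 tendsto_eventually)
      fix \<omega>
      show "eventually (\<lambda>N. (if real N < Q \<omega> then Q \<omega> else 0) = 0) sequentially"
        using eventually_ge_at_top[of "nat \<lceil>Q \<omega>\<rceil>"] by eventually_elim (simp add: nat_le_iff ceiling_le_iff not_less)
    qed
  qed (use assms in auto)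
  then show ?thesis by simp
qed

section \<open>Ito's formula in expectation for a general integrand\<close>

context drift_test
begin

lemma ito_limit:
  assumes X: "\<And>t \<omega>. 0 \<le> t \<Longrightarrow> \<omega> \<in> space M \<Longrightarrow> X t \<omega> = x + J t \<omega> + A t \<omega>"
    and A0: "AE \<omega> in M. A 0 \<omega> = 0"
    and Xad: "adapted F X" "continuous_paths M X" and J_cont: "continuous_paths M J"
    and H_jm: "jointly_measurable M H"
    and H_int: "AE \<omega> in M. set_integrable lborel {0..T} (\<lambda>r. (H r \<omega>)\<^sup>2)"
    and H_exp: "integrable M (\<lambda>\<omega>. LINT r:{0..T}|lborel. (H r \<omega>)\<^sup>2)"
    and e: "\<And>k. elementary M F (n k) (\<tau> k) (\<xi> k)"
    and lim_value: "tendsto_zero_in_prob M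
      (\<lambda>k \<omega>. LINT s:{0..T}|lborel. (elementary_value (n k) (\<tau> k) (\<xi> k) s \<omega> - H s \<omega>)\<^sup>2)"
    and lim_integral: "tendsto_zero_in_prob M
      (\<lambda>k \<omega>. SUP t\<in>{0..T}. \<bar>elementary_integral (n k) (\<tau> k) (\<xi> k) B t \<omega> - J t \<omega>\<bar>)"
  shows "expectation (\<lambda>\<omega>. \<phi> (X T \<omega>)) = \<phi> x + expectation (\<lambda>\<omega>. LINT r:{0..T}|lborel. generator X H r \<omega>)"
proof -
  have X_jm: "jointly_measurable M X" by (rule adapted_jointly_measurable[OF Xad])
  \<comment> \<open>The summand 1 gives \<open>1 \<le> Q\<close>, so bounded contributions can be
    absorbed into multiples of \<open>Q\<close>.\<close>
  define Q where "Q \<omega> = 1 + (LINT r:{0..T}|lborel. \<bar>m r \<omega>\<bar>) + (LINT r:{0..T}|lborel. (H r \<omega>)\<^sup>2)" for \<omega>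
  have Q_int: "integrable M Q" unfolding Q_def[abs_def] using m_expectation H_exp by simp
  then have [measurable]: "Q \<in> borel_measurable M" by simp
  have Qm: "0 \<le> (LINT r:{0..T}|lborel. \<bar>m r \<omega>\<bar>)" and QH: "0 \<le> (LINT r:{0..T}|lborel. (H r \<omega>)\<^sup>2)" for \<omega>
    by (auto simp: set_lebesgue_integral_def intro!: integral_nonneg_AE)
  have Q1: "1 \<le> Q \<omega>" for \<omega> using Qm[of \<omega>] QH[of \<omega>] by (simp add: Q_def)
  have square_bound: "\<bar>\<phi>1 y * c + \<phi>2 y * d\<^sup>2 / 2\<bar> \<le> C * \<bar>c\<bar> + C / 2 * d\<^sup>2" for y c d
  proof -
    have "\<bar>\<phi>1 y * c + \<phi>2 y * d\<^sup>2 / 2\<bar> \<le> \<bar>\<phi>1 y\<bar> * \<bar>c\<bar> + \<bar>\<phi>2 y\<bar> * d\<^sup>2 / 2"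
      by (rule order_trans[OF abs_triangle_ineq]) (simp add: abs_mult)
    also have "\<dots> \<le> C * \<bar>c\<bar> + C * d\<^sup>2 / 2"
      using bound_phi1 bound_phi2 by (intro add_mono divide_right_mono mult_right_mono) auto
    finally show ?thesis by simp
  qed
  define gX where "gX \<omega> = (LINT r:{0..T}|lborel. generator X H r \<omega>)" for \<omega>
  have gen_int: "set_integrable lborel {0..T} (\<lambda>r. generator Y G r \<omega>)"
    and gen_bound: "\<bar>LINT r:{0..T}|lborel. generator Y G r \<omega>\<bar>
      \<le> C * (LINT r:{0..T}|lborel. \<bar>m r \<omega>\<bar>) + C / 2 * (LINT r:{0..T}|lborel. (G r \<omega>)\<^sup>2)"
    if Y: "jointly_measurable M Y" and G: "jointly_measurable M G" and \<omega>: "\<omega> \<in> space M"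
      and m: "set_integrable lborel {0..T} (\<lambda>r. m r \<omega>)" and G2: "set_integrable lborel {0..T} (\<lambda>r. (G r \<omega>)\<^sup>2)" for Y G \<omega>
  proof -
    have am: "set_integrable lborel {0..T} (\<lambda>r. \<bar>m r \<omega>\<bar>)" using m by (rule set_integrable_abs)
    have dom: "set_integrable lborel {0..T} (\<lambda>r. C * \<bar>m r \<omega>\<bar> + C / 2 * (G r \<omega>)\<^sup>2)"
      using am G2 by (intro set_integral_add(1)) auto
    show i: "set_integrable lborel {0..T} (\<lambda>r. generator Y G r \<omega>)"
      by (rule set_integrable_dominated_section[OF jointly_measurable_generator[OF Y G] \<omega> order.refl dom])
         (simp only: generator_def square_bound)
    have "\<bar>LINT r:{0..T}|lborel. generator Y G r \<omega>\<bar> \<le> (LINT r:{0..T}|lborel. C * \<bar>m r \<omega>\<bar> + C / 2 * (G r \<omega>)\<^sup>2)"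
      by (rule set_integral_abs_le[OF i dom]) (simp only: generator_def square_bound)
    also have "\<dots> = C * (LINT r:{0..T}|lborel. \<bar>m r \<omega>\<bar>) + C / 2 * (LINT r:{0..T}|lborel. (G r \<omega>)\<^sup>2)"
      using am G2 by (subst set_integral_add(2)) auto
    finally show "\<bar>LINT r:{0..T}|lborel. generator Y G r \<omega>\<bar>
      \<le> C * (LINT r:{0..T}|lborel. \<bar>m r \<omega>\<bar>) + C / 2 * (LINT r:{0..T}|lborel. (G r \<omega>)\<^sup>2)" .
  qed
  have gX_meas [measurable]: "gX \<in> borel_measurable M"
    unfolding gX_def[abs_def] by (intro borel_measurable_set_integral jointly_measurable_generator X_jm H_jm order.refl)
  have gX_bound: "AE \<omega> in M. \<bar>gX \<omega>\<bar> \<le> C * Q \<omega>"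
    using m_integrable H_int AE_space
  proof eventually_elim
    case (elim \<omega>)
    have "\<bar>gX \<omega>\<bar> \<le> C * (LINT r:{0..T}|lborel. \<bar>m r \<omega>\<bar>) + C / 2 * (LINT r:{0..T}|lborel. (H r \<omega>)\<^sup>2)"
      unfolding gX_def by (rule gen_bound[OF X_jm H_jm elim(3,1,2)])
    also have "C / 2 * (LINT r:{0..T}|lborel. (H r \<omega>)\<^sup>2) \<le> C * (LINT r:{0..T}|lborel. (H r \<omega>)\<^sup>2)"
      using C_nonneg QH by (intro mult_right_mono) auto
    finally show ?case using C_nonneg by (simp add: Q_def distrib_left)
  qed
  have gX_int: "integrable M gX"
    by (rule Bochner_Integration.integrable_bound[of _ "\<lambda>\<omega>. C * Q \<omega>"])
       (use Q_int gX_bound in \<open>auto elim!: eventually_mono intro: order_trans[OF _ abs_ge_self]\<close>)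
  have XT: "X T \<in> borel_measurable M" by (rule adapted_measurable(2)[OF Xad(1) T_nonneg])
  \<comment> \<open>Truncating at \<open>2 N + 2\<close> changes nothing on the event where \<open>Q \<le> N\<close> and the approximation is
    good; elsewhere the crude bounds suffice because \<open>Q\<close> is integrable.\<close>
  define err where "err = \<bar>expectation (\<lambda>\<omega>. \<phi> (X T \<omega>)) - \<phi> x - expectation gX\<bar>"
  have main: "err \<le> 2 * C * \<epsilon> * expectation Q + 5 * C * expectation (\<lambda>\<omega>. if real N < Q \<omega> then Q \<omega> else 0)
      + 5 * C * real N * (prob {\<omega>\<in>space M. \<epsilon> < \<bar>SUP t\<in>{0..T}. \<bar>elementary_integral (n k) (\<tau> k) (\<xi> k) B t \<omega> - J t \<omega>\<bar>\<bar>}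
        + prob {\<omega>\<in>space M. \<epsilon>\<^sup>2 < \<bar>LINT s:{0..T}|lborel. (elementary_value (n k) (\<tau> k) (\<xi> k) s \<omega> - H s \<omega>)\<^sup>2\<bar>})"
    (is "_ \<le> _ + _ + _ * (prob ?U1 + prob ?U2)")
    if \<epsilon>: "0 < \<epsilon>" "\<epsilon> \<le> 1" and N: "1 \<le> N" for \<epsilon> N k
  proof -
    let ?EI = "elementary_integral (n k) (\<tau> k) (\<xi> k) B" and ?G = "elementary_value (n k) (\<tau> k) (\<xi> k)"
    \<comment> \<open>Where \<open>Q \<le> N\<close> and the squared distance to \<open>H\<close>
      integrates to at most \<open>\<epsilon>\<^sup>2 \<le> 1\<close>, the inequality
      \<open>a\<^sup>2 \<le> 2 * b\<^sup>2 + 2 * (a - b)\<^sup>2\<close> bounds the energy of the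
      approximation by this level, and the truncation is inactive.\<close>
    let ?N = "2 * real N + 2"
    define \<zeta> where "\<zeta> = truncate T ?N (\<tau> k) (\<xi> k)"
    have e\<zeta>: "elementary M F (n k) (\<tau> k) \<zeta>" unfolding \<zeta>_def by (rule elementary_truncate[OF e])
    let ?EI' = "elementary_integral (n k) (\<tau> k) \<zeta> B" and ?G' = "elementary_value (n k) (\<tau> k) \<zeta>"
    define Z where "Z t \<omega> = x + ?EI' t \<omega> + A t \<omega>" for t \<omega>
    have Zad: "adapted F Z"
      using elementary_integral_adapted[OF e\<zeta>] A_adapted unfolding adapted_def Z_def[abs_def] by auto
    have Zc: "continuous_paths M Z"
      using elementary_integral_continuous[OF e\<zeta>] A_continuous
      unfolding continuous_paths_def Z_def by (auto intro!: continuous_intros)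
    have Z_jm: "jointly_measurable M Z" by (rule adapted_jointly_measurable[OF Zad Zc])
    have G_jm: "jointly_measurable M (elementary_value (n k) (\<tau> k) \<eta>)"
      if "elementary M F (n k) (\<tau> k) \<eta>" for \<eta>
      using borel_measurable_F[OF elementary_measurable[OF that] elementary_nonneg[OF that]]
      by (intro elementary_value_measurable) auto
    define gZ where "gZ \<omega> = (LINT r:{0..T}|lborel. generator Z ?G' r \<omega>)" for \<omega>
    have ZT: "Z T \<in> borel_measurable M" by (rule adapted_measurable(2)[OF Zad T_nonneg])
    obtain K where K: "\<And>r \<omega>. \<omega> \<in> space M \<Longrightarrow> \<bar>?G' r \<omega>\<bar> \<le> K" using elementary_value_bounded[OF e\<zeta>] by metis
    have gZ_int: "integrable M gZ"
      unfolding gZ_def[abs_def] by (rule generator_integrable(2)[OF G_jm[OF e\<zeta>] Z_jm]) (use K in auto)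
    have "expectation (\<lambda>\<omega>. \<phi> (Z T \<omega>)) - expectation (\<lambda>\<omega>. \<phi> (Z 0 \<omega>)) = expectation gZ"
      unfolding gZ_def[abs_def] by (rule ito_elementary[OF e\<zeta> Zad Zc]) (simp add: Z_def)
    moreover have "expectation (\<lambda>\<omega>. \<phi> (Z 0 \<omega>)) = \<phi> x"
    proof -
      have Z0: "Z 0 \<in> borel_measurable M" by (rule adapted_measurable(2)[OF Zad order.refl])
      have "?EI' 0 \<omega> = 0" for \<omega>
        using elementary_nonneg[OF e\<zeta>] by (auto simp: elementary_integral_def min_absorb1 intro!: sum.neutral)
      then have "AE \<omega> in M. \<phi> (Z 0 \<omega>) = \<phi> x" using A0 by (auto simp: Z_def)
      then have "expectation (\<lambda>\<omega>. \<phi> (Z 0 \<omega>)) = expectation (\<lambda>\<omega>. \<phi> x)"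
        using Z0 by (intro integral_cong_AE) auto
      then show ?thesis by (simp add: prob_space)
    qed
    ultimately have "err = \<bar>(expectation (\<lambda>\<omega>. \<phi> (X T \<omega>)) - expectation (\<lambda>\<omega>. \<phi> (Z T \<omega>))) - (expectation gX - expectation gZ)\<bar>"
      unfolding err_def by (intro arg_cong[where f=abs]) linarith
    also have "\<dots> = \<bar>expectation (\<lambda>\<omega>. (\<phi> (X T \<omega>) - \<phi> (Z T \<omega>)) - (gX \<omega> - gZ \<omega>))\<bar>"
      using integrable_phi(1)[OF XT] integrable_phi(1)[OF ZT] gX_int gZ_int by simp
    finally have err_eq: "err = \<bar>expectation (\<lambda>\<omega>. (\<phi> (X T \<omega>) - \<phi> (Z T \<omega>)) - (gX \<omega> - gZ \<omega>))\<bar>" .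
    have [measurable]: "?U1 \<in> sets M" "?U2 \<in> sets M"
    proof -
      \<comment> \<open>Measurability of the supremum over uncountably many times is part of
        \<open>tendsto_zero_in_prob\<close>.\<close>
      have m: "(\<lambda>\<omega>. SUP t\<in>{0..T}. \<bar>?EI t \<omega> - J t \<omega>\<bar>) \<in> borel_measurable M"
        "(\<lambda>\<omega>. LINT s:{0..T}|lborel. (?G s \<omega> - H s \<omega>)\<^sup>2) \<in> borel_measurable M"
        using lim_integral lim_value unfolding tendsto_zero_in_prob_def by blast+
      have "{\<omega>\<in>space M. c < \<bar>f \<omega>\<bar>} \<in> sets M" if [measurable]: "f \<in> borel_measurable M" for f and c :: real
        by measurable
      then show "?U1 \<in> sets M" "?U2 \<in> sets M" using m by blast+
    qed
    \<comment> \<open>On the good event \<open>\<phi>\<close> and the generator integral each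
      contribute \<open>C * \<epsilon> * Q\<close>. Elsewhere the crude bound
      \<open>C * (2 + 2 * Q + N)\<close> is at most \<open>5 * C * max Q N\<close>; it is charged to
      the tail of \<open>Q\<close> if \<open>N < Q\<close>, and to the indicators of the bad events
      otherwise.\<close>
    let ?bd = "\<lambda>\<omega>. 2 * C * \<epsilon> * Q \<omega> + 5 * C * (if real N < Q \<omega> then Q \<omega> else 0)
        + 5 * C * real N * (indicator ?U1 \<omega> + indicator ?U2 \<omega>)"
    have tail_int: "integrable M (\<lambda>\<omega>. if real N < Q \<omega> then Q \<omega> else 0)"
      by (rule Bochner_Integration.integrable_bound[OF Q_int]) auto
    have ind_int: "integrable M (indicator ?U1 :: 'a \<Rightarrow> real)" "integrable M (indicator ?U2 :: 'a \<Rightarrow> real)"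
      by (auto intro!: integrable_real_indicator simp: emeasure_eq_measure)
    have bd_int: "integrable M ?bd"
      using Q_int tail_int ind_int by (intro Bochner_Integration.integrable_add integrable_mult_right) auto
    have "AE \<omega> in M. \<bar>(\<phi> (X T \<omega>) - \<phi> (Z T \<omega>)) - (gX \<omega> - gZ \<omega>)\<bar> \<le> ?bd \<omega>"
      using m_integrable H_int gX_bound AE_space
    proof eventually_elim
      case (elim \<omega>)
      have bd_nonneg: "0 \<le> 2 * C * \<epsilon> * Q \<omega>" "0 \<le> 5 * C * (if real N < Q \<omega> then Q \<omega> else 0)"
        "0 \<le> 5 * C * real N * (indicator ?U1 \<omega> + indicator ?U2 \<omega>)"
        using C_nonneg \<epsilon> Q1[of \<omega>] by (auto intro!: mult_nonneg_nonneg add_nonneg_nonneg)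
      note G2 = elementary_square_integral[OF e T_nonneg]
      note G'2 = elementary_square_integral[OF e\<zeta> T_nonneg]
      show ?case
      proof (cases "real N < Q \<omega> \<or> \<omega> \<in> ?U1 \<or> \<omega> \<in> ?U2")
        case True
        have "\<bar>gZ \<omega>\<bar> \<le> C * (LINT r:{0..T}|lborel. \<bar>m r \<omega>\<bar>) + C / 2 * (LINT r:{0..T}|lborel. (?G' r \<omega>)\<^sup>2)"
          unfolding gZ_def by (rule gen_bound[OF Z_jm G_jm[OF e\<zeta>] elim(4,1) G'2(1)])
        also have "\<dots> \<le> C * (LINT r:{0..T}|lborel. \<bar>m r \<omega>\<bar>) + C / 2 * ?N"
        proof -
          have "(LINT r:{0..T}|lborel. (?G' r \<omega>)\<^sup>2) \<le> ?N"
            unfolding G'2(2) using energy_truncate_le[OF e, of ?N] by (simp add: \<zeta>_def)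
          then show ?thesis using C_nonneg by (intro add_left_mono mult_left_mono) auto
        qed
        finally have gZ: "\<bar>gZ \<omega>\<bar> \<le> C * (Q \<omega> - 1) + C * real N + C"
          using mult_nonneg_nonneg[OF C_nonneg QH[of \<omega>]] by (simp add: Q_def algebra_simps)
        have "\<bar>(\<phi> (X T \<omega>) - \<phi> (Z T \<omega>)) - (gX \<omega> - gZ \<omega>)\<bar> \<le> \<bar>\<phi> (X T \<omega>)\<bar> + \<bar>\<phi> (Z T \<omega>)\<bar> + \<bar>gX \<omega>\<bar> + \<bar>gZ \<omega>\<bar>"
          by linarith
        also have "\<dots> \<le> C + C + C * Q \<omega> + (C * (Q \<omega> - 1) + C * real N + C)"
          by (intro add_mono bound_phi gZ elim(3))
        also have "\<dots> = C * (2 + 2 * Q \<omega> + real N)" by (simp add: algebra_simps)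
        also have "\<dots> \<le> C * (4 * max (Q \<omega>) (real N)) + C * max (Q \<omega>) (real N)"
          unfolding distrib_left[symmetric] using Q1[of \<omega>] N by (intro mult_left_mono C_nonneg) auto
        finally have b: "\<bar>(\<phi> (X T \<omega>) - \<phi> (Z T \<omega>)) - (gX \<omega> - gZ \<omega>)\<bar> \<le> 5 * C * max (Q \<omega>) (real N)" by simp
        show ?thesis
        proof (cases "real N < Q \<omega>")
          case True
          then show ?thesis using b bd_nonneg by simp
        next
          case False
          then have "1 \<le> indicator ?U1 \<omega> + (indicator ?U2 \<omega> :: real)" using \<open>_ \<or> _\<close> by (auto simp: indicator_def)
          then have "5 * C * real N * 1 \<le> 5 * C * real N * (indicator ?U1 \<omega> + indicator ?U2 \<omega>)"
            using C_nonneg by (intro mult_left_mono) auto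
          then show ?thesis using b bd_nonneg False by simp
        qed
      next
        case False
        have QN: "Q \<omega> \<le> real N" using False by simp
        have sup: "(SUP t\<in>{0..T}. \<bar>?EI t \<omega> - J t \<omega>\<bar>) \<le> \<epsilon>" using False elim(4) by auto
        have GHe: "(LINT s:{0..T}|lborel. (?G s \<omega> - H s \<omega>)\<^sup>2) \<le> \<epsilon>\<^sup>2" using False elim(4) by auto
        \<comment> \<open>A real \<open>SUP\<close> bounds its members only if they are bounded
          above; continuity of the path on the compact interval provides this.\<close>
        have "continuous_on {0..} (\<lambda>t. \<bar>?EI t \<omega> - J t \<omega>\<bar>)"
          using elementary_integral_continuous[OF e elim(4)] J_cont elim(4)
          unfolding continuous_paths_def by (auto intro!: continuous_intros)
        then have "continuous_on {0..T} (\<lambda>t. \<bar>?EI t \<omega> - J t \<omega>\<bar>)"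
          by (rule continuous_on_subset) auto
        then have "bdd_above ((\<lambda>t. \<bar>?EI t \<omega> - J t \<omega>\<bar>) ` {0..T})"
          by (intro bounded_imp_bdd_above compact_imp_bounded compact_continuous_image) auto
        then have close: "\<bar>?EI t \<omega> - J t \<omega>\<bar> \<le> \<epsilon>" if "t \<in> {0..T}" for t
          using cSUP_upper[OF that, of "\<lambda>t. \<bar>?EI t \<omega> - J t \<omega>\<bar>"] sup by linarith
        have sq: "(a - b)\<^sup>2 \<le> 2 * a\<^sup>2 + 2 * b\<^sup>2" "a\<^sup>2 \<le> 2 * b\<^sup>2 + 2 * (a - b)\<^sup>2" for a b :: real
          using zero_le_power2[of "a + b"] zero_le_power2[of "a - 2 * b"] by (simp_all add: power2_eq_square algebra_simps)
        have GH_jm: "jointly_measurable M (\<lambda>r \<omega>. (?G r \<omega> - H r \<omega>)\<^sup>2)"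
          using jointly_measurable_compose[OF jointly_measurable_arith(1)[OF G_jm[OF e] jointly_measurable_compose[OF H_jm, of uminus]],
              of "\<lambda>x. x\<^sup>2"] by simp
        have GH: "set_integrable lborel {0..T} (\<lambda>r. (?G r \<omega> - H r \<omega>)\<^sup>2)"
        proof (rule set_integrable_dominated_section[OF GH_jm elim(4) order.refl])
          show "set_integrable lborel {0..T} (\<lambda>r. 2 * (?G r \<omega>)\<^sup>2 + 2 * (H r \<omega>)\<^sup>2)"
            using G2(1) elim(2) by (intro set_integral_add(1)) auto
          show "\<bar>(?G r \<omega> - H r \<omega>)\<^sup>2\<bar> \<le> 2 * (?G r \<omega>)\<^sup>2 + 2 * (H r \<omega>)\<^sup>2" for r
            using sq(1)[of "?G r \<omega>" "H r \<omega>"] by simp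
        qed
        have "energy T (n k) (\<tau> k) (\<xi> k) \<omega> \<le> (LINT r:{0..T}|lborel. 2 * (H r \<omega>)\<^sup>2 + 2 * (?G r \<omega> - H r \<omega>)\<^sup>2)"
          unfolding G2(2)[symmetric] using G2(1) elim(2) GH sq(2)
          by (intro set_integral_mono set_integral_add(1)) auto
        also have "\<dots> = 2 * (LINT r:{0..T}|lborel. (H r \<omega>)\<^sup>2) + 2 * (LINT r:{0..T}|lborel. (?G r \<omega> - H r \<omega>)\<^sup>2)"
          using elim(2) GH by (subst set_integral_add(2)) auto
        also have "\<dots> \<le> 2 * real N + 2 * 1"
        proof -
          have "\<epsilon>\<^sup>2 \<le> 1" using \<epsilon> by (simp add: power_le_one)
          then show ?thesis using GHe QN Qm[of \<omega>] unfolding Q_def by linarith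
        qed
        finally have "\<zeta> i \<omega> = \<xi> k i \<omega>" if "i < n k" for i
          unfolding \<zeta>_def by (intro truncate_eq[OF e _ that]) simp
        then have eqs: "?G' r \<omega> = ?G r \<omega>" "?EI' r \<omega> = ?EI r \<omega>" for r
          by (auto simp: elementary_value_def elementary_integral_def)
        have XZ: "\<bar>X r \<omega> - Z r \<omega>\<bar> \<le> \<epsilon>" if "r \<in> {0..T}" for r
          using close[OF that] X[of r \<omega>] elim(4) that by (simp add: Z_def eqs abs_minus_commute)
        have "\<bar>gX \<omega> - gZ \<omega>\<bar> \<le> C * \<epsilon> * Q \<omega>"
          unfolding gX_def gZ_def generator_def Q_def
        proof (rule generator_difference[OF \<epsilon> XZ elim(1,2)])
          show "set_integrable lborel {0..T} (\<lambda>r. \<phi>1 (X r \<omega>) * m r \<omega> + \<phi>2 (X r \<omega>) * (H r \<omega>)\<^sup>2 / 2)"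
            using gen_int[OF X_jm H_jm elim(4,1,2)] by (simp only: generator_def)
          show "set_integrable lborel {0..T} (\<lambda>r. \<phi>1 (Z r \<omega>) * m r \<omega> + \<phi>2 (Z r \<omega>) * (?G' r \<omega>)\<^sup>2 / 2)"
            using gen_int[OF Z_jm G_jm[OF e\<zeta>] elim(4,1) G'2(1)] by (simp only: generator_def)
        qed (use GH GHe in \<open>simp_all only: eqs\<close>)
        moreover have "\<bar>\<phi> (X T \<omega>) - \<phi> (Z T \<omega>)\<bar> \<le> C * \<epsilon> * Q \<omega>"
        proof -
          have "\<bar>\<phi> (X T \<omega>) - \<phi> (Z T \<omega>)\<bar> \<le> C * \<bar>X T \<omega> - Z T \<omega>\<bar>" by (rule lipschitz_phi)
          also have "\<dots> \<le> C * \<epsilon>" using XZ[of T] T_nonneg by (intro mult_left_mono C_nonneg) auto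
          also have "\<dots> \<le> C * \<epsilon> * Q \<omega>" using mult_left_mono[OF Q1[of \<omega>], of "C * \<epsilon>"] C_nonneg \<epsilon> by simp
          finally show ?thesis .
        qed
        ultimately show ?thesis using bd_nonneg by linarith
      qed
    qed
    then have "err \<le> expectation ?bd"
      unfolding err_eq using bd_int gX_int gZ_int integrable_phi(1)[OF XT] integrable_phi(1)[OF ZT]
      by (intro order_trans[OF integral_abs_bound] integral_mono_AE
          integrable_abs Bochner_Integration.integrable_diff) auto
    also have "expectation ?bd = 2 * C * \<epsilon> * expectation Q + 5 * C * expectation (\<lambda>\<omega>. if real N < Q \<omega> then Q \<omega> else 0)
        + 5 * C * real N * expectation (\<lambda>\<omega>. indicator ?U1 \<omega> + indicator ?U2 \<omega>)"
      using Q_int tail_int ind_int by (simp add: Bochner_Integration.integral_add)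
    also have "expectation (\<lambda>\<omega>. indicator ?U1 \<omega> + indicator ?U2 \<omega>) = prob ?U1 + prob ?U2"
      using ind_int by (simp add: Bochner_Integration.integral_add)
    finally show ?thesis .
  qed
  let ?tail = "\<lambda>N. expectation (\<lambda>\<omega>. if real N < Q \<omega> then Q \<omega> else 0)"
  \<comment> \<open>The factor \<open>real N\<close> in front of the probabilities forces the order
    of limits: \<open>k\<close> has to go first while \<open>N\<close> is fixed. Then
    \<open>N\<close> removes the tail of \<open>Q\<close>, and \<open>\<epsilon>\<close> comes
    last.\<close>
  have step1: "err \<le> 2 * C * \<epsilon> * expectation Q + 5 * C * ?tail N" if \<epsilon>: "0 < \<epsilon>" "\<epsilon> \<le> 1" and N: "1 \<le> N" for \<epsilon> N
  proof -
    have p1: "(\<lambda>k. prob {\<omega>\<in>space M. \<epsilon> < \<bar>SUP t\<in>{0..T}. \<bar>elementary_integral (n k) (\<tau> k) (\<xi> k) B t \<omega> - J t \<omega>\<bar>\<bar>}) \<longlonglongrightarrow> 0"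
      using lim_integral \<epsilon> unfolding tendsto_zero_in_prob_def by blast
    have "0 < \<epsilon>\<^sup>2" using \<epsilon> by simp
    then have p2: "(\<lambda>k. prob {\<omega>\<in>space M. \<epsilon>\<^sup>2 < \<bar>LINT s:{0..T}|lborel. (elementary_value (n k) (\<tau> k) (\<xi> k) s \<omega> - H s \<omega>)\<^sup>2\<bar>}) \<longlonglongrightarrow> 0"
      using lim_value unfolding tendsto_zero_in_prob_def by blast
    have "(\<lambda>k. 2 * C * \<epsilon> * expectation Q + 5 * C * ?tail N + 5 * C * real N *
       (prob {\<omega>\<in>space M. \<epsilon> < \<bar>SUP t\<in>{0..T}. \<bar>elementary_integral (n k) (\<tau> k) (\<xi> k) B t \<omega> - J t \<omega>\<bar>\<bar>}
        + prob {\<omega>\<in>space M. \<epsilon>\<^sup>2 < \<bar>LINT s:{0..T}|lborel. (elementary_value (n k) (\<tau> k) (\<xi> k) s \<omega> - H s \<omega>)\<^sup>2\<bar>}))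
      \<longlonglongrightarrow> 2 * C * \<epsilon> * expectation Q + 5 * C * ?tail N + 5 * C * real N * (0 + 0)"
      by (intro tendsto_add tendsto_mult tendsto_const p1 p2)
    then have "err \<le> 2 * C * \<epsilon> * expectation Q + 5 * C * ?tail N + 5 * C * real N * (0 + 0)"
      by (rule LIMSEQ_le_const) (use main[OF \<epsilon> N] in blast)
    then show ?thesis by simp
  qed
  have step2: "err \<le> 2 * C * \<epsilon> * expectation Q" if \<epsilon>: "0 < \<epsilon>" "\<epsilon> \<le> 1" for \<epsilon>
  proof -
    have "(\<lambda>N. 2 * C * \<epsilon> * expectation Q + 5 * C * ?tail N) \<longlonglongrightarrow> 2 * C * \<epsilon> * expectation Q + 5 * C * 0"
      by (intro tendsto_add tendsto_mult tendsto_const tail_expectation_tendsto_zero[OF Q_int])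
    then have "err \<le> 2 * C * \<epsilon> * expectation Q + 5 * C * 0"
      by (rule LIMSEQ_le_const) (use step1[OF \<epsilon>] in blast)
    then show ?thesis by simp
  qed
  have "(\<lambda>j. 2 * C * (1 / real (Suc j)) * expectation Q) \<longlonglongrightarrow> 2 * C * 0 * expectation Q"
    by (intro tendsto_mult tendsto_const LIMSEQ_Suc[OF lim_const_over_n[of 1, simplified]])
  then have "err \<le> 2 * C * 0 * expectation Q"
    by (rule LIMSEQ_le_const) (intro exI allI impI step2, simp_all)
  then have "err = 0" by (simp add: err_def)
  then show ?thesis by (simp add: err_def gX_def[abs_def])
qed

end

section \<open>Exponentials of weak solutions\<close>

text \<open>The moment hypotheses are stated with nonnegative integrals. Almost surely the inner one
  is finite and equals the Bochner integral, so finiteness of the outer one is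
  integrability.\<close>

lemma (in prob_space) integrable_set_integral:
  assumes jm: "jointly_measurable M f" and nonneg: "\<And>r \<omega>. 0 \<le> f r \<omega>"
    and int: "AE \<omega> in M. set_integrable lborel {0..T} (\<lambda>r. f r \<omega>)"
    and fin: "(\<integral>\<^sup>+\<omega>. (\<integral>\<^sup>+u\<in>{0..T}. ennreal (f u \<omega>) \<partial>lborel) \<partial>M) < \<infinity>"
  shows "integrable M (\<lambda>\<omega>. LINT r:{0..T}|lborel. f r \<omega>)"
proof (rule integrableI_bounded)
  show "(\<lambda>\<omega>. LINT r:{0..T}|lborel. f r \<omega>) \<in> borel_measurable M"
    by (rule borel_measurable_set_integral[OF jm order.refl])
  have "(\<integral>\<^sup>+\<omega>. ennreal (norm (LINT r:{0..T}|lborel. f r \<omega>)) \<partial>M) = (\<integral>\<^sup>+\<omega>. (\<integral>\<^sup>+u\<in>{0..T}. ennreal (f u \<omega>) \<partial>lborel) \<partial>M)"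
    using int
  proof (intro nn_integral_cong_AE, eventually_elim)
    case (elim \<omega>)
    have "0 \<le> (LINT r:{0..T}|lborel. f r \<omega>)"
      using nonneg by (auto simp: set_lebesgue_integral_def intro!: integral_nonneg_AE)
    moreover have "(\<integral>\<^sup>+u\<in>{0..T}. ennreal (f u \<omega>) \<partial>lborel) = (\<integral>\<^sup>+u. ennreal (indicator {0..T} u *\<^sub>R f u \<omega>) \<partial>lborel)"
      by (intro nn_integral_cong) (auto simp: indicator_def)
    ultimately show ?case
      using elim nonneg unfolding set_integrable_def set_lebesgue_integral_def
      by (simp add: nn_integral_eq_integral)
  qed
  with fin show "(\<integral>\<^sup>+\<omega>. ennreal (norm (LINT r:{0..T}|lborel. f r \<omega>)) \<partial>M) < \<infinity>" by simp
qed

text \<open>\<open>borel_coeff\<close> controls the coefficient only on the closed quadrant; clipped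
  time and a nonnegative state stay inside it.\<close>

lemma jointly_measurable_borel_coeff:
  assumes b: "borel_coeff b" and X: "jointly_measurable M X"
    and nonneg: "\<And>t \<omega>. 0 \<le> t \<Longrightarrow> \<omega> \<in> space M \<Longrightarrow> 0 \<le> X t \<omega>"
  shows "jointly_measurable M (\<lambda>r \<omega>. b r (X r \<omega>))"
proof -
  have "(\<lambda>(\<omega>, r). (max 0 r, X (max 0 r) \<omega>)) \<in> measurable (M \<Otimes>\<^sub>M lborel) (restrict_space borel ({0..} \<times> {0..}))"
  proof (rule measurable_restrict_space2)
    show "(\<lambda>(\<omega>, r). (max 0 r, X (max 0 r) \<omega>)) \<in> space (M \<Otimes>\<^sub>M lborel) \<rightarrow> {0..} \<times> {0..}"
      using nonneg by (auto simp: space_pair_measure)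
    show "(\<lambda>(\<omega>, r). (max 0 r, X (max 0 r) \<omega>)) \<in> borel_measurable (M \<Otimes>\<^sub>M lborel)"
      using X unfolding jointly_measurable_def case_prod_beta' borel_prod[symmetric] by measurable
  qed
  from measurable_compose[OF this b[unfolded borel_coeff_def]]
  show ?thesis by (simp add: jointly_measurable_def case_prod_beta')
qed

text \<open>A nonnegative solution meets the test function only where it is the exponential, so the
  generator is \<open>g\<close>. Since \<open>exp (- (l * X)) \<le> 1\<close>, it is dominated by
  \<open>l\<^sup>2 / 2 * \<sigma>\<^sup>2 + l * |\<mu>|\<close>; the two moment hypotheses thus
  serve both Ito's formula and the exchange of expectation and time integral.\<close>

lemma weak_solution_ito_exp:
  assumes sol: "weak_solution M F B X \<sigma> \<mu> x" and x: "0 \<le> x"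
    and sigma_fin: "(\<integral>\<^sup>+\<omega>. (\<integral>\<^sup>+u\<in>{0..T}. ennreal ((\<sigma> u (X u \<omega>))\<^sup>2) \<partial>lborel) \<partial>M) < \<infinity>"
    and mu_fin: "(\<integral>\<^sup>+\<omega>. (\<integral>\<^sup>+u\<in>{0..T}. ennreal \<bar>\<mu> u (X u \<omega>)\<bar> \<partial>lborel) \<partial>M) < \<infinity>"
    and l: "0 < l" and T: "0 \<le> T"
  defines "g \<equiv> \<lambda>r \<omega>. exp (- (l * X r \<omega>)) * (l\<^sup>2 / 2 * (\<sigma> r (X r \<omega>))\<^sup>2 - l * \<mu> r (X r \<omega>))"
  shows "set_integrable lborel {0..T} (\<lambda>r. \<integral>\<omega>. g r \<omega> \<partial>M)"
    and "(\<integral>\<omega>. exp (- (l * X T \<omega>)) \<partial>M) = exp (- (l * x)) + (LINT r:{0..T}|lborel. \<integral>\<omega>. g r \<omega> \<partial>M)"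
proof -
  interpret prob_space M using sol by (simp add: weak_solution_def)
  from sol obtain J where J: "ito_integral M F B (\<lambda>u \<omega>. \<sigma> u (X u \<omega>)) J"
    and X_eq: "AE \<omega> in M. \<forall>t\<ge>0. X t \<omega> = x + J t \<omega> + (LINT u:{0..t}|lborel. \<mu> u (X u \<omega>))"
    unfolding weak_solution_def by blast
  have uf: "usual_filtration M F" and bm: "brownian_motion M F B" and Xad: "adapted F X"
    and Xc: "continuous_paths M X" and Xn: "\<And>t \<omega>. 0 \<le> t \<Longrightarrow> \<omega> \<in> space M \<Longrightarrow> 0 \<le> X t \<omega>"
    and b\<sigma>: "borel_coeff \<sigma>" and b\<mu>: "borel_coeff \<mu>"
    and \<mu>_int: "AE \<omega> in M. \<forall>t\<ge>0. set_integrable lborel {0..t} (\<lambda>u. \<mu> u (X u \<omega>))"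
    using sol unfolding weak_solution_def by blast+
  obtain \<phi> \<phi>1 \<phi>2 C where tf: "test_function \<phi> \<phi>1 \<phi>2 C"
    and \<phi>: "\<And>y. 0 \<le> y \<Longrightarrow> \<phi> y = exp (- (l * y))"
      "\<And>y. 0 \<le> y \<Longrightarrow> \<phi>1 y = - (l * exp (- (l * y)))"
      "\<And>y. 0 \<le> y \<Longrightarrow> \<phi>2 y = l\<^sup>2 * exp (- (l * y))"
    using ex_test_function_exp[OF l] by metis
  interpret brownian_test M F B \<phi> \<phi>1 \<phi>2 C
  proof (intro brownian_test.intro brownian_filtration.intro brownian_filtration_axioms.intro tf prob_space_axioms)
  qed (use uf bm in \<open>auto simp: usual_filtration_def\<close>)
  have J_ad: "adapted F J" and J_c: "continuous_paths M J"
    using J by (auto simp: ito_integral_def)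
  define A where "A t \<omega> = X t \<omega> - x - J t \<omega>" for t \<omega>
  define m where "m r \<omega> = \<mu> r (X r \<omega>)" for r \<omega>
  define H where "H r \<omega> = \<sigma> r (X r \<omega>)" for r \<omega>
  have X_jm: "jointly_measurable M X"
    using Xad Xc borel_measurable_F by (intro jointly_measurable_continuous_paths) (auto simp: adapted_def)
  have m_jm: "jointly_measurable M m" and H_jm: "jointly_measurable M H"
    unfolding m_def[abs_def] H_def[abs_def] using b\<sigma> b\<mu> X_jm Xn by (auto intro: jointly_measurable_borel_coeff)
  have m_int: "AE \<omega> in M. set_integrable lborel {0..T} (\<lambda>r. m r \<omega>)"
    using \<mu>_int by eventually_elim (use T in \<open>auto simp: m_def\<close>)
  have H_int: "AE \<omega> in M. set_integrable lborel {0..T} (\<lambda>r. (H r \<omega>)\<^sup>2)"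
  proof -
    have "AE \<omega> in M. \<forall>t\<ge>0. set_integrable lborel {0..t} (\<lambda>s. (\<sigma> s (X s \<omega>))\<^sup>2)"
      using J by (simp add: ito_integral_def)
    then show ?thesis by eventually_elim (use T in \<open>auto simp: H_def\<close>)
  qed
  have m_exp: "integrable M (\<lambda>\<omega>. LINT r:{0..T}|lborel. \<bar>m r \<omega>\<bar>)"
  proof (rule integrable_set_integral)
    show "jointly_measurable M (\<lambda>r \<omega>. \<bar>m r \<omega>\<bar>)" by (rule jointly_measurable_compose[OF m_jm]) measurable
    show "AE \<omega> in M. set_integrable lborel {0..T} (\<lambda>r. \<bar>m r \<omega>\<bar>)"
      using m_int by eventually_elim (rule set_integrable_abs)
  qed (use mu_fin in \<open>auto simp: m_def\<close>)
  have H_exp: "integrable M (\<lambda>\<omega>. LINT r:{0..T}|lborel. (H r \<omega>)\<^sup>2)"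
  proof (rule integrable_set_integral)
    show "jointly_measurable M (\<lambda>r \<omega>. (H r \<omega>)\<^sup>2)" by (rule jointly_measurable_compose[OF H_jm]) measurable
  qed (use sigma_fin H_int in \<open>auto simp: H_def\<close>)
  interpret drift_test M F B \<phi> \<phi>1 \<phi>2 C A m T
  proof (intro drift_test.intro drift_test_axioms.intro T m_jm m_int m_exp brownian_test_axioms)
    show "A t \<in> borel_measurable (F t)" if "0 \<le> t" for t
    proof -
      have "X t \<in> borel_measurable (F t)" "J t \<in> borel_measurable (F t)"
        using Xad J_ad that by (simp_all add: adapted_def)
      then show ?thesis unfolding A_def[abs_def] by (intro borel_measurable_diff borel_measurable_const)
    qed
    show "continuous_paths M A"
      using Xc J_c unfolding continuous_paths_def A_def by (auto intro!: continuous_intros)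
    show "AE \<omega> in M. \<forall>u v. 0 \<le> u \<longrightarrow> u \<le> v \<longrightarrow> v \<le> T \<longrightarrow> A v \<omega> - A u \<omega> = (LINT r:{u..v}|lborel. m r \<omega>)"
      using X_eq \<mu>_int
    proof (eventually_elim, intro allI impI)
      fix \<omega> u v
      assume eq: "\<forall>t\<ge>0. X t \<omega> = x + J t \<omega> + (LINT u:{0..t}|lborel. \<mu> u (X u \<omega>))"
        and int: "\<forall>t\<ge>0. set_integrable lborel {0..t} (\<lambda>u. \<mu> u (X u \<omega>))"
        and uv: "0 \<le> u" "u \<le> v" "v \<le> T"
      have "A t \<omega> = (LINT r:{0..t}|lborel. m r \<omega>)" if "0 \<le> t" for t
        using eq that by (simp add: A_def m_def)
      moreover have "(LINT r:{0..v}|lborel. m r \<omega>) = (LINT r:{0..u}|lborel. m r \<omega>) + (LINT r:{u..v}|lborel. m r \<omega>)"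
        using int uv by (intro set_lebesgue_integral_split) (auto simp: m_def)
      ultimately show "A v \<omega> - A u \<omega> = (LINT r:{u..v}|lborel. m r \<omega>)" using uv by simp
    qed
  qed
  have g_gen: "generator X H r \<omega> = g r \<omega>" if "0 \<le> r" "\<omega> \<in> space M" for r \<omega>
    using Xn[OF that] by (simp add: generator_def g_def m_def H_def \<phi> algebra_simps)
  from J obtain n \<tau> \<xi> where e: "\<And>k. elementary M F (n k) (\<tau> k) (\<xi> k)"
    and lims: "\<forall>T\<ge>0.
         tendsto_zero_in_prob M
           (\<lambda>k \<omega>. LINT s:{0..T}|lborel. (elementary_value (n k) (\<tau> k) (\<xi> k) s \<omega> - \<sigma> s (X s \<omega>))\<^sup>2) \<and>
         tendsto_zero_in_prob M
           (\<lambda>k \<omega>. SUP t\<in>{0..T}. \<bar>elementary_integral (n k) (\<tau> k) (\<xi> k) B t \<omega> - J t \<omega>\<bar>)"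
    unfolding ito_integral_def by blast
  have "expectation (\<lambda>\<omega>. \<phi> (X T \<omega>)) = \<phi> x + expectation (\<lambda>\<omega>. LINT r:{0..T}|lborel. generator X H r \<omega>)"
  proof (rule ito_limit[OF _ _ Xad Xc J_c H_jm H_int H_exp e])
    show "AE \<omega> in M. A 0 \<omega> = 0"
      using X_eq by eventually_elim (simp add: A_def set_lebesgue_integral_point)
  qed (use lims T in \<open>auto simp: A_def H_def\<close>)
  also have "expectation (\<lambda>\<omega>. \<phi> (X T \<omega>)) = expectation (\<lambda>\<omega>. exp (- (l * X T \<omega>)))"
    using Xn T \<phi>(1) by (intro Bochner_Integration.integral_cong) auto
  also have "\<phi> x = exp (- (l * x))" using \<phi>(1) x by simp
  also have "expectation (\<lambda>\<omega>. LINT r:{0..T}|lborel. generator X H r \<omega>) = expectation (\<lambda>\<omega>. LINT r:{0..T}|lborel. g r \<omega>)"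
    using g_gen by (intro Bochner_Integration.integral_cong set_lebesgue_integral_cong) auto
  finally have ito: "expectation (\<lambda>\<omega>. exp (- (l * X T \<omega>))) = exp (- (l * x)) + expectation (\<lambda>\<omega>. LINT r:{0..T}|lborel. g r \<omega>)" .
  have g_jm: "jointly_measurable M g"
  proof -
    have eq: "g = (\<lambda>r \<omega>. (\<lambda>y. exp (- (l * y))) (X r \<omega>) * ((\<lambda>y. l\<^sup>2 / 2 * y\<^sup>2) (H r \<omega>) + (\<lambda>y. - l * y) (m r \<omega>)))"
      by (intro ext) (simp add: g_def H_def m_def)
    show ?thesis unfolding eq
      by (intro jointly_measurable_arith jointly_measurable_compose[OF X_jm]
          jointly_measurable_compose[OF H_jm] jointly_measurable_compose[OF m_jm]) measurable
  qed
  interpret P: pair_sigma_finite M lborel ..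
  \<comment> \<open>Clipping the time makes the integrand jointly measurable on the whole line and
    does not change it on \<open>[0,T]\<close>.\<close>
  let ?f = "\<lambda>\<omega> r. indicator {0..T} r * g (max 0 r) \<omega>"
  have f_eq: "?f \<omega> r = indicator {0..T} r *\<^sub>R g r \<omega>" for \<omega> r by (auto simp: indicator_def max_def)
  have g_bound: "\<bar>g r \<omega>\<bar> \<le> l\<^sup>2 / 2 * (H r \<omega>)\<^sup>2 + l * \<bar>m r \<omega>\<bar>" if "0 \<le> r" "\<omega> \<in> space M" for r \<omega>
  proof -
    have "\<bar>g r \<omega>\<bar> = exp (- (l * X r \<omega>)) * \<bar>l\<^sup>2 / 2 * (H r \<omega>)\<^sup>2 - l * m r \<omega>\<bar>"
      by (simp add: g_def H_def m_def abs_mult)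
    also have "\<dots> \<le> 1 * \<bar>l\<^sup>2 / 2 * (H r \<omega>)\<^sup>2 - l * m r \<omega>\<bar>"
      using Xn[OF that] l by (intro mult_right_mono) auto
    also have "\<dots> \<le> l\<^sup>2 / 2 * (H r \<omega>)\<^sup>2 + l * \<bar>m r \<omega>\<bar>"
      using l abs_triangle_ineq4[of "l\<^sup>2 / 2 * (H r \<omega>)\<^sup>2" "l * m r \<omega>"] by (simp add: abs_mult)
    finally show ?thesis .
  qed
  have dom: "AE \<omega> in M. set_integrable lborel {0..T} (\<lambda>r. l\<^sup>2 / 2 * (H r \<omega>)\<^sup>2 + l * \<bar>m r \<omega>\<bar>)"
    using m_int H_int by eventually_elim (intro set_integral_add(1) set_integrable_mult_right set_integrable_abs)
  have g_int: "AE \<omega> in M. set_integrable lborel {0..T} (\<lambda>r. g r \<omega>)"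
    using dom AE_space
    by eventually_elim (rule set_integrable_dominated_section[OF g_jm _ order.refl], use g_bound in auto)
  have prod: "integrable (M \<Otimes>\<^sub>M lborel) (\<lambda>(\<omega>, r). ?f \<omega> r)"
  proof (rule P.Fubini_integrable)
    show "(\<lambda>(\<omega>, r). ?f \<omega> r) \<in> borel_measurable (M \<Otimes>\<^sub>M lborel)"
      using g_jm unfolding jointly_measurable_def case_prod_beta' by measurable
    show "AE \<omega> in M. integrable lborel (\<lambda>r. (\<lambda>(\<omega>, r). ?f \<omega> r) (\<omega>, r))"
      using g_int unfolding f_eq set_integrable_def by simp
    have eq: "(\<integral>r. norm ((\<lambda>(\<omega>, r). ?f \<omega> r) (\<omega>, r)) \<partial>lborel) = (LINT r:{0..T}|lborel. \<bar>g r \<omega>\<bar>)" for \<omega>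
      unfolding set_lebesgue_integral_def f_eq by (intro Bochner_Integration.integral_cong) (auto simp: f_eq indicator_def)
    show "integrable M (\<lambda>\<omega>. \<integral>r. norm ((\<lambda>(\<omega>, r). ?f \<omega> r) (\<omega>, r)) \<partial>lborel)"
      unfolding eq
    proof (rule Bochner_Integration.integrable_bound)
      show "integrable M (\<lambda>\<omega>. l\<^sup>2 / 2 * (LINT r:{0..T}|lborel. (H r \<omega>)\<^sup>2) + l * (LINT r:{0..T}|lborel. \<bar>m r \<omega>\<bar>))"
        using m_exp H_exp by simp
      show "(\<lambda>\<omega>. LINT r:{0..T}|lborel. \<bar>g r \<omega>\<bar>) \<in> borel_measurable M"
        by (intro borel_measurable_set_integral jointly_measurable_compose[OF g_jm]) auto
      show "AE \<omega> in M. norm (LINT r:{0..T}|lborel. \<bar>g r \<omega>\<bar>)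
          \<le> norm (l\<^sup>2 / 2 * (LINT r:{0..T}|lborel. (H r \<omega>)\<^sup>2) + l * (LINT r:{0..T}|lborel. \<bar>m r \<omega>\<bar>))"
        using g_int dom m_int H_int AE_space
      proof eventually_elim
        case (elim \<omega>)
        have "\<bar>LINT r:{0..T}|lborel. \<bar>g r \<omega>\<bar>\<bar> \<le> (LINT r:{0..T}|lborel. l\<^sup>2 / 2 * (H r \<omega>)\<^sup>2 + l * \<bar>m r \<omega>\<bar>)"
          using set_integrable_abs[OF elim(1)] elim(2) by (rule set_integral_abs_le) (use g_bound elim(5) in auto)
        also have "\<dots> = l\<^sup>2 / 2 * (LINT r:{0..T}|lborel. (H r \<omega>)\<^sup>2) + l * (LINT r:{0..T}|lborel. \<bar>m r \<omega>\<bar>)"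
          using elim(3,4) set_integrable_abs[OF elim(3)] by (subst set_integral_add(2)) auto
        finally show ?case by (simp only: real_norm_def)
      qed
    qed
  qed
  have ind: "(\<integral>\<omega>. ?f \<omega> r \<partial>M) = indicator {0..T} r *\<^sub>R (\<integral>\<omega>. g r \<omega> \<partial>M)" for r
    unfolding f_eq by (simp add: indicator_def)
  show "set_integrable lborel {0..T} (\<lambda>r. \<integral>\<omega>. g r \<omega> \<partial>M)"
    using P.integrable_snd[OF prod] unfolding ind set_integrable_def .
  have "expectation (\<lambda>\<omega>. LINT r:{0..T}|lborel. g r \<omega>) = (\<integral>\<omega>. \<integral>r. ?f \<omega> r \<partial>lborel \<partial>M)"
    unfolding f_eq set_lebesgue_integral_def ..
  also have "\<dots> = (\<integral>r. \<integral>\<omega>. ?f \<omega> r \<partial>M \<partial>lborel)" by (rule P.Fubini_integral[OF prod, symmetric])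
  also have "\<dots> = (LINT r:{0..T}|lborel. \<integral>\<omega>. g r \<omega> \<partial>M)" unfolding ind set_lebesgue_integral_def ..
  finally show "(\<integral>\<omega>. exp (- (l * X T \<omega>)) \<partial>M) = exp (- (l * x)) + (LINT r:{0..T}|lborel. \<integral>\<omega>. g r \<omega> \<partial>M)"
    using ito by simp
qed

section \<open>Laplace transform of a nonnegative process\<close>

locale nonnegative_process = prob_space M for M :: "'a measure" +
  fixes X :: "real \<Rightarrow> 'a \<Rightarrow> real"
  assumes X_measurable: "\<And>t. 0 \<le> t \<Longrightarrow> X t \<in> borel_measurable M"
    and X_continuous: "continuous_paths M X"
    and X_nonneg: "\<And>t \<omega>. 0 \<le> t \<Longrightarrow> \<omega> \<in> space M \<Longrightarrow> 0 \<le> X t \<omega>"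
begin

text \<open>For \<open>l > 0\<close> this is, up to the sign \<open>(-1) ^ k\<close>, the
  \<open>k\<close>-th derivative in \<open>l\<close> of the Laplace transform, by
  \<open>laplace_has_derivative\<close>.\<close>

definition laplace :: "nat \<Rightarrow> real \<Rightarrow> real \<Rightarrow> real" where
  "laplace k t l = expectation (\<lambda>\<omega>. X t \<omega> ^ k * exp (- (l * X t \<omega>)))"

lemma laplace_integrable:
  assumes "0 \<le> t" "0 < l"
  shows "integrable M (\<lambda>\<omega>. X t \<omega> ^ k * exp (- (l * X t \<omega>)))"
  using X_measurable[OF assms(1)] power_times_exp_le[OF X_nonneg[OF assms(1)] assms(2), of _ k] X_nonneg[OF assms(1)]
  by (intro integrable_const_bound[where B="fact k / l ^ k"]) auto

text \<open>Dominated convergence with a constant. The bound \<open>c\<close> is left open because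
  it comes from two sources: for any \<open>k\<close> when the \<open>l n\<close> stay away from 0,
  and \<open>c = 1\<close> for \<open>k = 0\<close> up to the boundary.\<close>

lemma laplace_tendsto:
  assumes t: "\<And>n. 0 \<le> t n" "0 \<le> t0" "t \<longlonglongrightarrow> t0" and l: "l \<longlonglongrightarrow> l0"
    and c: "\<And>n y. 0 \<le> y \<Longrightarrow> y ^ k * exp (- (l n * y)) \<le> c"
  shows "(\<lambda>n. laplace k (t n) (l n)) \<longlonglongrightarrow> laplace k t0 l0"
  unfolding laplace_def
proof (rule integral_dominated_convergence[where w="\<lambda>_. c"])
  show "AE \<omega> in M. (\<lambda>n. X (t n) \<omega> ^ k * exp (- (l n * X (t n) \<omega>))) \<longlonglongrightarrow> X t0 \<omega> ^ k * exp (- (l0 * X t0 \<omega>))"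
  proof (rule AE_I2)
    fix \<omega> assume "\<omega> \<in> space M"
    then have "continuous_on {0..} (\<lambda>t. X t \<omega>)" using X_continuous by (simp add: continuous_paths_def)
    then have "(\<lambda>n. X (t n) \<omega>) \<longlonglongrightarrow> X t0 \<omega>"
      by (rule continuous_on_tendsto_compose[OF _ t(3)]) (use t in auto)
    then show "(\<lambda>n. X (t n) \<omega> ^ k * exp (- (l n * X (t n) \<omega>))) \<longlonglongrightarrow> X t0 \<omega> ^ k * exp (- (l0 * X t0 \<omega>))"
      using l by (intro tendsto_intros)
  qed
  show "AE \<omega> in M. norm (X (t n) \<omega> ^ k * exp (- (l n * X (t n) \<omega>))) \<le> c" for n
    using c X_nonneg t by (intro AE_I2) (auto simp: abs_mult)
qed (use X_measurable t in auto)

lemma laplace_continuous: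
  "continuous_on ({0<..} \<times> {0<..}) (\<lambda>(t, l). laplace k t l)"
  unfolding continuous_on_sequentially
proof (intro allI ballI impI)
  fix p :: "nat \<Rightarrow> real \<times> real" and a
  assume a: "a \<in> {0<..} \<times> {0<..}" and p: "(\<forall>n. p n \<in> {0<..} \<times> {0<..}) \<and> p \<longlonglongrightarrow> a"
  then have t: "(\<lambda>n. fst (p n)) \<longlonglongrightarrow> fst a" and l: "(\<lambda>n. snd (p n)) \<longlonglongrightarrow> snd a"
    by (auto intro: tendsto_fst tendsto_snd)
  have pos: "0 < fst (p n)" "0 < snd (p n)" for n using p by (metis mem_Times_iff greaterThan_iff)+
  \<comment> \<open>The limit of \<open>snd (p n)\<close> is positive, so these bounds converge and
    have a common upper bound, the dominating constant.\<close>
  have "(\<lambda>n. fact k / snd (p n) ^ k) \<longlonglongrightarrow> fact k / snd a ^ k"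
    using a by (intro tendsto_intros l) auto
  then obtain c where c: "\<And>n. norm (fact k / snd (p n) ^ k) \<le> c"
    by (metis convergent_def convergent_imp_Bseq BseqE)
  have "y ^ k * exp (- (snd (p n) * y)) \<le> c" if "0 \<le> y" for n y
  proof -
    have "y ^ k * exp (- (snd (p n) * y)) \<le> fact k / snd (p n) ^ k" by (rule power_times_exp_le[OF that pos(2)])
    also have "\<dots> \<le> c" using c[of n] by (simp only: real_norm_def abs_le_iff)
    finally show ?thesis .
  qed
  then have "(\<lambda>n. laplace k (fst (p n)) (snd (p n))) \<longlonglongrightarrow> laplace k (fst a) (snd a)"
    using pos a by (intro laplace_tendsto[OF _ _ t l]) (auto intro: less_imp_le)
  then show "((\<lambda>(t, l). laplace k t l) \<circ> p) \<longlonglongrightarrow> (case a of (t, l) \<Rightarrow> laplace k t l)"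
    by (simp add: comp_def case_prod_beta')
qed

lemma laplace_0_continuous:
  "continuous_on ({0..} \<times> {0..}) (\<lambda>(t, l). laplace 0 t l)"
  unfolding continuous_on_sequentially
proof (intro allI ballI impI)
  fix p :: "nat \<Rightarrow> real \<times> real" and a
  assume a: "a \<in> {0..} \<times> {0..}" and p: "(\<forall>n. p n \<in> {0..} \<times> {0..}) \<and> p \<longlonglongrightarrow> a"
  then have t: "(\<lambda>n. fst (p n)) \<longlonglongrightarrow> fst a" and l: "(\<lambda>n. snd (p n)) \<longlonglongrightarrow> snd a"
    by (auto intro: tendsto_fst tendsto_snd)
  have pos: "0 \<le> fst (p n)" "0 \<le> snd (p n)" for n using p by (metis mem_Times_iff atLeast_iff)+
  have "(\<lambda>n. laplace 0 (fst (p n)) (snd (p n))) \<longlonglongrightarrow> laplace 0 (fst a) (snd a)"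
    using pos a by (intro laplace_tendsto[OF _ _ t l, where c=1]) auto
  then show "((\<lambda>(t, l). laplace 0 t l) \<circ> p) \<longlonglongrightarrow> (case a of (t, l) \<Rightarrow> laplace 0 t l)"
    by (simp add: comp_def case_prod_beta')
qed

end

section \<open>Derivatives in \<open>l\<close> and the Cauchy problem\<close>

lemma integral_diff_add_mult:
  fixes f g h :: "'a \<Rightarrow> real"
  assumes "integrable M f" "integrable M g" "integrable M h"
  shows "(\<integral>\<omega>. f \<omega> - g \<omega> + c * h \<omega> \<partial>M) = integral\<^sup>L M f - integral\<^sup>L M g + c * integral\<^sup>L M h"
  using assms by simp

text \<open>From \<open>1 - z \<le> exp (- z)\<close> follows
  \<open>exp z - 1 \<le> z * exp z\<close>, hence
  \<open>exp z - 1 - z \<le> z * (exp z - 1)\<close>. For \<open>z \<ge> 0\<close> the first bound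
  is inserted again; for \<open>z < 0\<close> multiplication by \<open>z\<close> reverses
  \<open>z \<le> exp z - 1\<close>.\<close>

lemma abs_exp_minus_linear_le:
  fixes z :: real
  shows "\<bar>exp z - 1 - z\<bar> \<le> z\<^sup>2 * exp \<bar>z\<bar>"
proof -
  have lo: "0 \<le> exp z - 1 - z" using exp_ge_add_one_self[of z] by linarith
  have "exp z * (1 - z) \<le> exp z * exp (- z)"
    using exp_ge_add_one_self[of "- z"] by (intro mult_left_mono) auto
  then have up: "exp z - 1 \<le> z * exp z" by (simp add: exp_minus algebra_simps)
  have "exp z - 1 - z \<le> z\<^sup>2 * exp \<bar>z\<bar>"
  proof (cases "0 \<le> z")
    case True
    have "exp z - 1 - z \<le> z * (exp z - 1)" using up by (simp add: algebra_simps)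
    also have "\<dots> \<le> z * (z * exp z)" using up True by (rule mult_left_mono)
    finally show ?thesis using True by (simp add: power2_eq_square mult.assoc)
  next
    case False
    have "exp z - 1 - z \<le> z * (exp z - 1)" using up by (simp add: algebra_simps)
    also have "\<dots> \<le> z * z"
      using False lo by (intro mult_left_mono_neg) auto
    also have "\<dots> \<le> z\<^sup>2 * exp \<bar>z\<bar>" using mult_left_mono[of 1 "exp \<bar>z\<bar>" "z\<^sup>2"] by (simp add: power2_eq_square)
    finally show ?thesis .
  qed
  then show ?thesis using lo by simp
qed

context nonnegative_process
begin

text \<open>Differentiation under the expectation with an explicit remainder. For
  \<open>|h| < l / 2\<close> the factor \<open>exp (|h| * y)\<close> from
  \<open>abs_exp_minus_linear_le\<close> uses up at most half of the decay of
  \<open>exp (- (l * y))\<close>, and two more powers of \<open>y\<close> appear, whence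
  \<open>laplace (k + 2) t (l / 2)\<close>.\<close>

lemma laplace_has_derivative:
  assumes t: "0 \<le> t" and l: "0 < l"
  shows "((\<lambda>y. laplace k t y) has_real_derivative - laplace (Suc k) t l) (at l)"
proof -
  let ?K = "laplace (k + 2) t (l / 2)"
  have est: "\<bar>(laplace k t (l + h) - laplace k t l) / h - - laplace (Suc k) t l\<bar> \<le> \<bar>h\<bar> * ?K"
    if h: "\<bar>h\<bar> < l / 2" "h \<noteq> 0" for h
  proof -
    note i = laplace_integrable[OF t]
    have "0 < l + h" using h l by linarith
    note ik = i[OF this, of k] i[OF l, of k] i[OF l, of "Suc k"]
    let ?R = "\<lambda>\<omega>. X t \<omega> ^ k * exp (- ((l + h) * X t \<omega>)) - X t \<omega> ^ k * exp (- (l * X t \<omega>))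
      + h * (X t \<omega> ^ Suc k * exp (- (l * X t \<omega>)))"
    have R: "integrable M ?R"
      by (intro Bochner_Integration.integrable_add Bochner_Integration.integrable_diff integrable_mult_right ik)
    have eq: "laplace k t (l + h) - laplace k t l + h * laplace (Suc k) t l = expectation ?R"
      unfolding laplace_def by (rule integral_diff_add_mult[OF ik, symmetric])
    have "norm (expectation ?R) \<le> expectation (\<lambda>\<omega>. h\<^sup>2 * (X t \<omega> ^ (k + 2) * exp (- (l / 2 * X t \<omega>))))"
    proof (rule order_trans[OF integral_norm_bound integral_mono])
      show "integrable M (\<lambda>\<omega>. norm (?R \<omega>))" using R by (rule integrable_norm)
      show "integrable M (\<lambda>\<omega>. h\<^sup>2 * (X t \<omega> ^ (k + 2) * exp (- (l / 2 * X t \<omega>))))"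
        using l by (intro integrable_mult_right i) auto
      fix \<omega> assume "\<omega> \<in> space M"
      then have y: "0 \<le> X t \<omega>" using X_nonneg t by simp
      let ?y = "X t \<omega>"
      have "?R \<omega> = ?y ^ k * exp (- (l * ?y)) * (exp (- h * ?y) - 1 - (- h * ?y))"
        by (simp add: algebra_simps flip: exp_add)
      then have "norm (?R \<omega>) = ?y ^ k * exp (- (l * ?y)) * \<bar>exp (- h * ?y) - 1 - (- h * ?y)\<bar>"
        using y by (simp only: real_norm_def abs_mult) (simp add: abs_mult)
      also have "\<dots> \<le> ?y ^ k * exp (- (l * ?y)) * ((- h * ?y)\<^sup>2 * exp \<bar>- h * ?y\<bar>)"
        using y by (intro mult_left_mono abs_exp_minus_linear_le) auto
      also have "\<dots> \<le> ?y ^ k * exp (- (l * ?y)) * ((- h * ?y)\<^sup>2 * exp (l / 2 * ?y))"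
        using y h mult_right_mono[of "\<bar>h\<bar>" "l / 2" ?y] by (intro mult_left_mono) (auto simp: abs_mult)
      also have "\<dots> = h\<^sup>2 * (?y ^ (k + 2) * (exp (- (l * ?y)) * exp (l / 2 * ?y)))"
        by (simp add: power_mult_distrib power_add algebra_simps power2_eq_square)
      also have "exp (- (l * ?y)) * exp (l / 2 * ?y) = exp (- (l / 2 * ?y))"
        by (simp add: field_simps flip: exp_add)
      finally show "norm (?R \<omega>) \<le> h\<^sup>2 * (?y ^ (k + 2) * exp (- (l / 2 * ?y)))" .
    qed
    also have "\<dots> = h\<^sup>2 * ?K" by (simp add: laplace_def)
    finally have *: "\<bar>laplace k t (l + h) - laplace k t l + h * laplace (Suc k) t l\<bar> \<le> h\<^sup>2 * ?K"
      unfolding eq real_norm_def .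
    have "(laplace k t (l + h) - laplace k t l) / h - - laplace (Suc k) t l
        = (laplace k t (l + h) - laplace k t l + h * laplace (Suc k) t l) / h"
      using h by (simp add: field_simps)
    then have "\<bar>(laplace k t (l + h) - laplace k t l) / h - - laplace (Suc k) t l\<bar>
        = \<bar>laplace k t (l + h) - laplace k t l + h * laplace (Suc k) t l\<bar> / \<bar>h\<bar>"
      by (simp only: abs_divide)
    also have "\<dots> \<le> h\<^sup>2 * ?K / \<bar>h\<bar>" using * by (rule divide_right_mono) simp
    also have "\<dots> = \<bar>h\<bar> * ?K" using h by (simp add: power2_eq_square field_simps abs_if)
    finally show ?thesis .
  qed
  have "((\<lambda>h. (laplace k t (l + h) - laplace k t l) / h - - laplace (Suc k) t l) \<longlongrightarrow> 0) (at 0)"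
  proof (rule Lim_null_comparison)
    show "eventually (\<lambda>h. norm ((laplace k t (l + h) - laplace k t l) / h - - laplace (Suc k) t l) \<le> \<bar>h\<bar> * ?K) (at 0)"
      unfolding eventually_at using est l by (intro exI[of _ "l / 2"]) (auto simp: dist_real_def)
    have "((\<lambda>h. \<bar>h\<bar> * ?K) \<longlongrightarrow> \<bar>0\<bar> * ?K) (at 0)" by (intro tendsto_intros)
    then show "((\<lambda>h. \<bar>h\<bar> * ?K) \<longlongrightarrow> 0) (at 0)" by simp
  qed
  then show ?thesis unfolding DERIV_def by (rule LIM_zero_cancel)
qed

text \<open>\<open>L\<close> is the right-hand side of the Cauchy problem for
  \<open>laplace 0\<close>, whose first two derivatives in \<open>l\<close> are
  \<open>- laplace 1\<close> and \<open>laplace 2\<close>. Continuity of the coefficients makes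
  \<open>L\<close> continuous in the open quadrant, so \<open>eq\<close> can be differentiated in
  time at every point there and not merely at almost every time.\<close>

lemma classical_solution_laplace:
  fixes \<sigma> \<mu> V g :: "real \<Rightarrow> real \<Rightarrow> real"
  defines "L \<equiv> \<lambda>t l. (1/2 * (\<sigma> t l)\<^sup>2 * laplace 2 t l + \<mu> t l * - laplace 1 t l) - V t l * laplace 0 t l + g t l"
  assumes g_cont: "continuous_on ({0..} \<times> {0..}) (\<lambda>(t, l). g t l)"
    and V_cont: "continuous_on ({0..} \<times> {0..}) (\<lambda>(t, l). V t l)"
    and sigma_cont: "continuous_on ({0<..} \<times> {0<..}) (\<lambda>(t, l). \<sigma> t l)"
    and mu_cont: "continuous_on ({0<..} \<times> {0<..}) (\<lambda>(t, l). \<mu> t l)"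
    and int: "\<And>T l. 0 \<le> T \<Longrightarrow> 0 < l \<Longrightarrow> set_integrable lborel {0..T} (\<lambda>t. L t l)"
    and eq: "\<And>T l. 0 \<le> T \<Longrightarrow> 0 < l \<Longrightarrow> laplace 0 T l = exp (- (l * x)) + (LINT t:{0..T}|lborel. L t l)"
  shows "classical_solution \<sigma> \<mu> V g (\<lambda>l. exp (- (x * l))) (laplace 0)"
proof -
  let ?S = "{0<..} \<times> {0<..} :: (real \<times> real) set"
  have sub: "?S \<subseteq> {0..} \<times> {0..}" by auto
  have L_cont: "continuous_on ?S (\<lambda>(t, l). L t l)"
    unfolding L_def case_prod_beta'
    by (intro continuous_on_add continuous_on_diff continuous_on_mult continuous_on_minus continuous_on_power
        continuous_on_const laplace_continuous[unfolded case_prod_beta']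
        sigma_cont[unfolded case_prod_beta'] mu_cont[unfolded case_prod_beta']
        continuous_on_subset[OF g_cont sub, unfolded case_prod_beta']
        continuous_on_subset[OF V_cont sub, unfolded case_prod_beta'])
  \<comment> \<open>\<open>eq\<close> is available for \<open>l > 0\<close> only; at
    \<open>l = 0\<close> both sides are 1.\<close>
  have init: "laplace 0 0 l = exp (- (x * l))" if "0 \<le> l" for l
  proof (cases "l = 0")
    case True
    then show ?thesis by (simp add: laplace_def prob_space)
  next
    case False
    then show ?thesis using eq[of 0 l] that by (simp add: set_lebesgue_integral_point mult.commute)
  qed
  have dt: "((\<lambda>s. laplace 0 s l) has_real_derivative L t l) (at t)" if t: "0 < t" and l: "0 < l" for t l
  proof -
    \<comment> \<open>\<open>L\<close> is known to be continuous at positive times only, so the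
      integral equation is restarted at \<open>t / 2\<close>, and \<open>t\<close> is interior to
      the interval.\<close>
    let ?a = "t / 2" and ?b = "2 * t"
    have "continuous_on {?a..?b} (\<lambda>s. (\<lambda>(t, l). L t l) (s, l))"
      using t l by (intro continuous_on_compose2[OF L_cont]) (auto intro!: continuous_intros)
    then have c: "continuous_on {?a..?b} (\<lambda>s. L s l)" by simp
    have "((\<lambda>s. integral {?a..s} (\<lambda>s. L s l)) has_real_derivative L t l) (at t within {?a..?b})"
      using t by (intro integral_has_real_derivative[OF c]) auto
    then have D: "((\<lambda>s. laplace 0 ?a l + integral {?a..s} (\<lambda>s. L s l)) has_real_derivative 0 + L t l) (at t within {?a..?b})"
      by (intro DERIV_add DERIV_const)
    have E: "laplace 0 ?a l + integral {?a..s} (\<lambda>s. L s l) = laplace 0 s l" if s: "s \<in> {?a..?b}" for s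
    proof -
      have "laplace 0 s l = laplace 0 ?a l + (LINT t:{?a..s}|lborel. L t l)"
        using eq[of s l] eq[of ?a l] int[of s l] s t l set_lebesgue_integral_split[of 0 s "\<lambda>t. L t l" ?a] by simp
      also have "(LINT t:{?a..s}|lborel. L t l) = integral {?a..s} (\<lambda>s. L s l)"
        using s t l by (intro set_borel_integral_eq_integral set_integrable_subset[OF int[of s l]]) auto
      finally show ?thesis ..
    qed
    have "((\<lambda>s. laplace 0 s l) has_real_derivative 0 + L t l) (at t within {?a..?b})"
      by (rule has_field_derivative_transform_within[OF D zero_less_one]) (use t E in auto)
    then show ?thesis using t by (simp add: at_within_interior[of t "{?a..?b}"])
  qed
  have "continuous_on ?S (\<lambda>(t, l). - laplace 1 t l)"
    using continuous_on_minus[OF laplace_continuous[of 1]] by (simp add: case_prod_beta')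
  moreover have "((\<lambda>y. - laplace 1 t y) has_real_derivative laplace 2 t l) (at l)" if "0 < t" "0 < l" for t l
    using DERIV_minus[OF laplace_has_derivative[of t l 1]] that by (simp add: numeral_2_eq_2)
  moreover have "((\<lambda>y. laplace 0 t y) has_real_derivative - laplace 1 t l) (at l)" if "0 < t" "0 < l" for t l
    using laplace_has_derivative[of t l 0] that by simp
  ultimately show ?thesis
    unfolding classical_solution_def
    using laplace_0_continuous init L_cont laplace_continuous[of 2] dt
    by (intro conjI exI[of _ L] exI[of _ "\<lambda>t l. - laplace 1 t l"] exI[of _ "laplace 2"]) (auto simp: L_def)
qed

end

section \<open>Duality relation and conclusion\<close>

lemma integral_linear3:
  fixes f g h :: "'a \<Rightarrow> real"
  assumes "integrable M f" "integrable M g" "integrable M h"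
  shows "(\<integral>\<omega>. a * f \<omega> - b * g \<omega> - c * h \<omega> \<partial>M) = a * integral\<^sup>L M f - b * integral\<^sup>L M g - c * integral\<^sup>L M h"
  using assms by simp

text \<open>Each initial value \<open>l\<close> may have its own probability space, hence the
  families indexed by \<open>l\<close>. Integrability of the \<open>g\<close> term is asserted
  explicitly because the Bochner integral of a non-integrable function is 0, so the equation alone
  would not show that this expectation exists.\<close>

theorem theorem2p2:
  fixes M :: "'a measure" and F :: "real \<Rightarrow> 'a measure"
    and B Xh :: "real \<Rightarrow> 'a \<Rightarrow> real"
    and M' :: "real \<Rightarrow> 'b measure" and F' :: "real \<Rightarrow> real \<Rightarrow> 'b measure"
    and W X :: "real \<Rightarrow> real \<Rightarrow> 'b \<Rightarrow> real"
    and \<sigma>h \<mu>h \<sigma> \<mu> V g :: "real \<Rightarrow> real \<Rightarrow> real"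
    and x :: real
  assumes x_nonneg: "0 \<le> x"
    and Xh_sol: "weak_solution M F B Xh \<sigma>h \<mu>h x"
    and Xh_unique: "unique_in_law TYPE('a) \<sigma>h \<mu>h x"
    and X_sol: "\<forall>l\<ge>0. weak_solution (M' l) (F' l) (W l) (X l) \<sigma> \<mu> l"
    and X_unique: "\<forall>l\<ge>0. unique_in_law TYPE('b) \<sigma> \<mu> l"
    and sigmah_fin: "\<forall>t\<ge>0. (\<integral>\<^sup>+\<omega>. (\<integral>\<^sup>+u\<in>{0..t}. ennreal ((\<sigma>h u (Xh u \<omega>))\<^sup>2) \<partial>lborel) \<partial>M) < \<infinity>"
    and muh_fin: "\<forall>t\<ge>0. (\<integral>\<^sup>+\<omega>. (\<integral>\<^sup>+u\<in>{0..t}. ennreal \<bar>\<mu>h u (Xh u \<omega>)\<bar> \<partial>lborel) \<partial>M) < \<infinity>"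
    and g_cont: "continuous_on ({0..} \<times> {0..}) (\<lambda>(t, l). g t l)"
    and V_cont: "continuous_on ({0..} \<times> {0..}) (\<lambda>(t, l). V t l)"
    and V_nonneg: "\<forall>t\<ge>0. \<forall>l\<ge>0. 0 \<le> V t l"
    and sigma_cont: "continuous_on ({0<..} \<times> {0<..}) (\<lambda>(t, l). \<sigma> t l)"
    and mu_cont: "continuous_on ({0<..} \<times> {0<..}) (\<lambda>(t, l). \<mu> t l)"
    and FK: "FK_class TYPE('b) \<sigma> \<mu> V g (\<lambda>l. exp (- (x * l)))"
    and duality: "\<forall>t\<ge>0. \<forall>l\<ge>0.
        integrable M (\<lambda>\<omega>. exp (- (l * Xh t \<omega>)) *
          (l\<^sup>2 / 2 * (\<sigma>h t (Xh t \<omega>))\<^sup>2 - l * \<mu>h t (Xh t \<omega>))) \<and>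
        integrable M (\<lambda>\<omega>. exp (- (l * Xh t \<omega>)) *
          ((Xh t \<omega>)\<^sup>2 * ((\<sigma> t l)\<^sup>2 / 2) - Xh t \<omega> * \<mu> t l - V t l)) \<and>
        (LINT \<omega>|M. exp (- (l * Xh t \<omega>)) *
          (l\<^sup>2 / 2 * (\<sigma>h t (Xh t \<omega>))\<^sup>2 - l * \<mu>h t (Xh t \<omega>))) =
        (LINT \<omega>|M. exp (- (l * Xh t \<omega>)) *
          ((Xh t \<omega>)\<^sup>2 * ((\<sigma> t l)\<^sup>2 / 2) - Xh t \<omega> * \<mu> t l - V t l)) + g t l"
  shows "\<forall>t\<ge>0. \<forall>l\<ge>0.
    integrable (M' l) (\<lambda>\<omega>. LINT s:{0..t}|lborel.
      g (t - s) (X l s \<omega>) * exp (- (LINT u:{0..s}|lborel. V (t - u) (X l u \<omega>)))) \<and>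
    (LINT \<omega>|M. exp (- (l * Xh t \<omega>))) =
      (LINT \<omega>|M' l. exp (- (x * X l t \<omega>) - (LINT u:{0..t}|lborel. V (t - u) (X l u \<omega>)))) +
      (LINT \<omega>|M' l. (LINT s:{0..t}|lborel.
        g (t - s) (X l s \<omega>) * exp (- (LINT u:{0..s}|lborel. V (t - u) (X l u \<omega>)))))"
proof -
  interpret prob_space M using Xh_sol by (simp add: weak_solution_def)
  interpret nonnegative_process M Xh
  proof
    show "continuous_paths M Xh" "\<And>t \<omega>. 0 \<le> t \<Longrightarrow> \<omega> \<in> space M \<Longrightarrow> 0 \<le> Xh t \<omega>"
      using Xh_sol by (simp_all add: weak_solution_def)
    fix t :: real assume t: "0 \<le> t"
    have "adapted F Xh" "usual_filtration M F" using Xh_sol by (simp_all add: weak_solution_def)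
    with t have "Xh t \<in> borel_measurable (F t)" "subalgebra M (F t)"
      by (simp_all add: adapted_def usual_filtration_def)
    then show "Xh t \<in> borel_measurable M" using measurable_from_subalg by blast
  qed
  let ?L = "\<lambda>t l. (1/2 * (\<sigma> t l)\<^sup>2 * laplace 2 t l + \<mu> t l * - laplace 1 t l) - V t l * laplace 0 t l + g t l"
  let ?G = "\<lambda>t l. \<integral>\<omega>. exp (- (l * Xh t \<omega>)) * (l\<^sup>2 / 2 * (\<sigma>h t (Xh t \<omega>))\<^sup>2 - l * \<mu>h t (Xh t \<omega>)) \<partial>M"
  \<comment> \<open>The right-hand expectation splits into separate moments because each of them is
    integrable for \<open>l > 0\<close>.\<close>
  have dual: "?G t l = ?L t l" if t: "0 \<le> t" and l: "0 < l" for t l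
  proof -
    have "?G t l = (\<integral>\<omega>. exp (- (l * Xh t \<omega>)) *
          ((Xh t \<omega>)\<^sup>2 * ((\<sigma> t l)\<^sup>2 / 2) - Xh t \<omega> * \<mu> t l - V t l) \<partial>M) + g t l"
      using duality t l by simp
    also have "(\<integral>\<omega>. exp (- (l * Xh t \<omega>)) * ((Xh t \<omega>)\<^sup>2 * ((\<sigma> t l)\<^sup>2 / 2) - Xh t \<omega> * \<mu> t l - V t l) \<partial>M)
        = (\<integral>\<omega>. (\<sigma> t l)\<^sup>2 / 2 * (Xh t \<omega> ^ 2 * exp (- (l * Xh t \<omega>)))
          - \<mu> t l * (Xh t \<omega> ^ 1 * exp (- (l * Xh t \<omega>))) - V t l * (Xh t \<omega> ^ 0 * exp (- (l * Xh t \<omega>))) \<partial>M)"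
      by (intro Bochner_Integration.integral_cong) (auto simp: algebra_simps)
    also have "\<dots> = (\<sigma> t l)\<^sup>2 / 2 * laplace 2 t l - \<mu> t l * laplace 1 t l - V t l * laplace 0 t l"
      unfolding laplace_def by (rule integral_linear3[OF laplace_integrable[OF t l] laplace_integrable[OF t l] laplace_integrable[OF t l]])
    finally show ?thesis by simp
  qed
  have ito: "set_integrable lborel {0..T} (\<lambda>t. ?L t l)"
    "laplace 0 T l = exp (- (l * x)) + (LINT t:{0..T}|lborel. ?L t l)" if T: "0 \<le> T" and l: "0 < l" for T l
  proof -
    note I = weak_solution_ito_exp[OF Xh_sol x_nonneg sigmah_fin[rule_format, OF T] muh_fin[rule_format, OF T] l T]
    have "set_integrable lborel {0..T} (\<lambda>t. ?G t l) \<longleftrightarrow> set_integrable lborel {0..T} (\<lambda>t. ?L t l)"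
      using dual l by (intro set_integrable_cong) auto
    with I(1) show "set_integrable lborel {0..T} (\<lambda>t. ?L t l)" by simp
    have "(LINT t:{0..T}|lborel. ?G t l) = (LINT t:{0..T}|lborel. ?L t l)"
      using dual l by (intro set_lebesgue_integral_cong) auto
    with I(2) show "laplace 0 T l = exp (- (l * x)) + (LINT t:{0..T}|lborel. ?L t l)"
      by (simp add: laplace_def)
  qed
  have "classical_solution \<sigma> \<mu> V g (\<lambda>l. exp (- (x * l))) (laplace 0)"
    using g_cont V_cont sigma_cont mu_cont ito by (rule classical_solution_laplace)
  moreover from FK obtain f where
      "\<forall>f'. classical_solution \<sigma> \<mu> V g (\<lambda>l. exp (- (x * l))) f' \<longrightarrow> (\<forall>t\<ge>0. \<forall>l\<ge>0. f' t l = f t l)"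
    and rep: "\<forall>l\<ge>0. \<forall>(M :: 'b measure) F W X. weak_solution M F W X \<sigma> \<mu> l \<longrightarrow>
             (\<forall>t\<ge>0. feynman_kac M X V g (\<lambda>l. exp (- (x * l))) t (f t l))"
    unfolding FK_class_def by (elim conjE exE)
  \<comment> \<open>Uniqueness in the class identifies solutions on the closed quadrant, so
    \<open>l = 0\<close> is included.\<close>
  ultimately have f: "\<forall>t\<ge>0. \<forall>l\<ge>0. laplace 0 t l = f t l" by blast
  show ?thesis
  proof (intro allI impI)
    fix t l :: real assume t: "0 \<le> t" and l: "0 \<le> l"
    have "weak_solution (M' l) (F' l) (W l) (X l) \<sigma> \<mu> l" using X_sol l by simp
    then have "feynman_kac (M' l) (X l) V g (\<lambda>l. exp (- (x * l))) t (f t l)"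
      using rep t l by blast
    then have "feynman_kac (M' l) (X l) V g (\<lambda>l. exp (- (x * l))) t (laplace 0 t l)"
      using f t l by simp
    \<comment> \<open>Adapts the single exponential of the statement to the product form in
      \<open>feynman_kac\<close>.\<close>
    moreover have "exp (- (x * a) - b) = exp (- (x * a)) * exp (- b)" for a b
      by (simp add: exp_diff exp_minus divide_inverse)
    ultimately show "integrable (M' l) (\<lambda>\<omega>. LINT s:{0..t}|lborel.
      g (t - s) (X l s \<omega>) * exp (- (LINT u:{0..s}|lborel. V (t - u) (X l u \<omega>)))) \<and>
    (LINT \<omega>|M. exp (- (l * Xh t \<omega>))) =
      (LINT \<omega>|M' l. exp (- (x * X l t \<omega>) - (LINT u:{0..t}|lborel. V (t - u) (X l u \<omega>)))) +
      (LINT \<omega>|M' l. (LINT s:{0..t}|lborel.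
        g (t - s) (X l s \<omega>) * exp (- (LINT u:{0..s}|lborel. V (t - u) (X l u \<omega>)))))"
      by (simp add: feynman_kac_def Let_def laplace_def)
  qed
qed

end
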